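(* Let $G$ be a separable locally compact group, let $V:G\to\mathcal{U}(\mathcal{H})$ be a unitary representation on a complex separable Hilbert space $\mathcal{H}$, and consider its central decomposition $$\mathcal{H}=\int^\oplus_{\mathcal{A}}\mathcal{H}^\alpha\,d\mu(\alpha),\qquad V=\int^\oplus_{\mathcal{A}}V^\alpha\,d\mu(\alpha),$$ with $\mu$ a $\sigma$-finite positive measure on $(\mathcal{A},\Sigma(\mathcal{A}))$. Let $Q$ be a closable Hermitian quadratic form, densely defined on $\mathcal{D}_0\subset\mathcal{H}$, where for every $\Phi\in\mathcal{D}_0$ there exists $\Delta\in\Sigma(\mathcal{A})$ with $\mu(\Delta)<\infty$ and $P_\Delta\Phi=\Phi$. (i) If $Q$ is $G$-invariant, then $Q$ is countably orthogonally additive. (ii) If, in addition, the measure $\mu$ is point supported on $(\mathcal{A},\Sigma(\mathcal{A}))$, then the $G$-invariant quadratic form $Q$ is strongly representable (by some self-adjoint operator).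
   Context: Central decomposition. Unitary representations are strongly continuous. Let $\mathcal{V}=\{V(g)\mid g\in G\}''$ be the von Neumann algebra generated by $V$, $\mathcal{V}'$ its commutant and $\mathcal{Z}=\mathcal{V}\cap\mathcal{V}'$ its centre. The central decomposition of $V$ is the direct integral decomposition of $\mathcal{H}$ and $V$ with respect to $\mathcal{Z}\cong L^\infty(\mathcal{A},\mu)$, where $\mathcal{A}$ is a separable Hausdorff space with a regular Borel measure $\mu$: the multiplication (diagonalisable) operators by functions in $L^\infty(\mathcal{A},\mu)$ on $\int^\oplus_{\mathcal{A}}\mathcal{H}^\alpha\,d\mu(\alpha)$ are exactly the elements of $\mathcal{Z}$. For $\Delta\in\Sigma(\mathcal{A})$, $P_\Delta$ is the orthogonal projection onto $\int_\Delta^\oplus\mathcal{H}^\alpha\,d\mu(\alpha)$ (so $P_\Delta\in\mathcal{Z}$). Quadratic forms. A Hermitian quadratic form $Q$ on a dense subspace $\mathcal{D}\subset\mathcal{H}$ is the diagonal $Q(\Phi):=Q(\Phi,\Phi)$ of a sesquilinear form $Q:\mathcal{D}\times\mathcal{D}\to\mathbb{C}$ (antilinear in the first entry, linear in the second) with $Q(\Phi,\Psi)=\overline{Q(\Psi,\Phi)}$. It is closable if for every sequence $\{\Phi_n\}\subset\mathcal{D}$ with $\Phi_n\to0$ in $\mathcal{H}$ and $\lim_{n,m\to\infty}Q(\Phi_n-\Phi_m)=0$ one has $\lim_nQ(\Phi_n)=0$. A form $\widehat Q$ on $\widehat{\mathcal{D}}$ extends $(Q,\mathcal{D})$ if $\mathcal{D}\subset\widehat{\mathcal{D}}\subset\mathcal{H}$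 and $\widehat Q|_{\mathcal{D}}=Q$. $G$-invariance. A closable Hermitian quadratic form $Q$ on the dense domain $\mathcal{D}$ is $G$-invariant if: (1) $P_\Delta\mathcal{D}\subset\mathcal{D}$ for all $\Delta\in\Sigma(\mathcal{A})$; (2) for each $\Delta\in\Sigma(\mathcal{A})$ with $\mu(\Delta)<\infty$ there is $M_\Delta>0$ with $|Q(P_\Delta\Phi)|\le M_\Delta\|P_\Delta\Phi\|^2$ for all $\Phi\in\mathcal{D}$; (3) for each $\Phi\in\mathcal{D}$ there is $M_\Phi>0$ with $|Q(P_\Delta\Phi)|<M_\Phi$ for all $\Delta\in\Sigma(\mathcal{A})$; (4) $V(g)\mathcal{D}=\mathcal{D}$ and $Q(V(g)\Phi)=Q(\Phi)$ for all $g\in G$, $\Phi\in\mathcal{D}$. Countable orthogonal additivity. $(Q,\mathcal{D})$ is countably orthogonally additive if $P_\Delta\mathcal{D}\subset\mathcal{D}$ for all $\Delta\in\Sigma(\mathcal{A})$, and for each countable measurable partition $\{\Delta_i\}_{i\in\mathbb{N}}$ of a $\Delta\in\Sigma(\mathcal{A})$ and each $\Phi\in\mathcal{D}$, $Q(P_\Delta\Phi)=\sum_{i=1}^\infty Q(P_{\Delta_i}\Phi)$ (convergence included). Point supported. $\mu$ is point supported if $\mathcal{A}$ is countable, $\Sigma(\mathcal{A})$ is the set of all subsets of $\mathcal{A}$, and $\mu(\Delta)=\sum_{x\in\Delta}\mu(\{x\})$ for all $\Delta\subset\mathcal{A}$. Strong representability. Let $T$ be self-adjoint with resolution of the identity $E(\cdot)$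 and $\nu_\Phi(\sigma)=\|E(\sigma)\Phi\|^2$. The spectral norm is $|||\Phi|||_E^2=\int_{\mathbb{R}}(1+|\lambda|)\,d\nu_\Phi(\lambda)$, $\Phi\in\mathcal{D}(|T|^{1/2})$. $(Q,\mathcal{D})$ is strongly representable by $T$ if (1) there is an extension $(\widehat Q,\widehat{\mathcal{D}})$ of $(Q,\mathcal{D})$ with $\mathcal{D}(T)\subset\widehat{\mathcal{D}}$, and $\mathcal{D}\subset\mathcal{D}(|T|^{1/2})$; (2) $\widehat{\mathcal{D}}$ is the closure of $\mathcal{D}$ (in $\mathcal{D}(|T|^{1/2})$) with respect to $|||\cdot|||_E$; (3) $\widehat Q(\Phi)=\int_{\mathbb{R}}\lambda\,d\nu_\Phi(\lambda)$ for all $\Phi\in\widehat{\mathcal{D}}$. *)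

theory Defs
  imports "HOL-Analysis.Analysis"
begin

section \<open>Complex Hilbert spaces\<close>

text \<open>
  A complex inner product space is a real one whose real structure comes from a complex one:
  the real inner product is the real part of the Hermitian one. The type class thus inherits norm,
  metric and topology from \<open>real_inner\<close>.
  The Hermitian product is linear in the second argument (hence antilinear in the first).
\<close>

class complex_inner = real_inner +
  fixes scaleC :: "complex \<Rightarrow> 'a \<Rightarrow> 'a" (infixr "*\<^sub>C" 75)
    and cinner :: "'a \<Rightarrow> 'a \<Rightarrow> complex"
  assumes scaleC_add_right: "a *\<^sub>C (x + y) = a *\<^sub>C x + a *\<^sub>C y"
    and scaleC_add_left: "(a + b) *\<^sub>C x = a *\<^sub>C x + b *\<^sub>C x"
    and scaleC_scaleC: "a *\<^sub>C b *\<^sub>C x = (a * b) *\<^sub>C x"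
    and scaleC_of_real: "complex_of_real r *\<^sub>C x = scaleR r x"
    and cinner_commute: "cinner x y = cnj (cinner y x)"
    and cinner_add_right: "cinner x (y + z) = cinner x y + cinner x z"
    and cinner_scaleC_right: "cinner x (a *\<^sub>C y) = a * cinner x y"
    and Re_cinner: "Re (cinner x y) = inner x y"

class complex_hilbert = complex_inner + complete_space

global_interpretation complex_vector: vector_space "scaleC :: complex \<Rightarrow> 'a \<Rightarrow> 'a :: complex_inner"
  defines csubspace = complex_vector.subspace
    and cspan = complex_vector.span
proof unfold_locales
  show "1 *\<^sub>C x = x" for x :: 'a
    using scaleC_of_real[of 1 x] by simp
qed (simp_all add: scaleC_add_right scaleC_add_left scaleC_scaleC)

definition clinear_on :: "'a::complex_inner set \<Rightarrow> ('a \<Rightarrow> 'b::complex_inner) \<Rightarrow> bool" where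
  "clinear_on W A \<longleftrightarrow>
     (\<forall>x\<in>W. \<forall>y\<in>W. A (x + y) = A x + A y) \<and> (\<forall>c. \<forall>x\<in>W. A (c *\<^sub>C x) = c *\<^sub>C A x)"

definition bounded_clinear :: "('a::complex_inner \<Rightarrow> 'b::complex_inner) \<Rightarrow> bool" where
  "bounded_clinear A \<longleftrightarrow> bounded_linear A \<and> clinear_on UNIV A"

definition orth_proj :: "'h::complex_inner set \<Rightarrow> 'h \<Rightarrow> 'h" where
  "orth_proj W \<phi> = (THE p. p \<in> W \<and> (\<forall>w\<in>W. cinner w (\<phi> - p) = 0))"

definition is_orth_projection :: "('h::complex_inner \<Rightarrow> 'h) \<Rightarrow> bool" where
  "is_orth_projection P \<longleftrightarrow>
     bounded_clinear P \<and> P \<circ> P = P \<and> (\<forall>x y. cinner (P x) y = cinner x (P y))"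

section \<open>Unitary representations and von Neumann algebras\<close>

text \<open>
  Groups are written additively, as in the class \<open>topological_group_add\<close>, which does not
  assume commutativity. The representation acts on a complex subspace \<open>K\<close> of the ambient type.
\<close>

definition unitary_rep ::
  "'k::complex_inner set \<Rightarrow> ('g::topological_group_add \<Rightarrow> 'k \<Rightarrow> 'k) \<Rightarrow> bool" where
  "unitary_rep K V \<longleftrightarrow>
     (\<forall>g. clinear_on K (V g) \<and> V g ` K = K \<and>
          (\<forall>x\<in>K. \<forall>y\<in>K. cinner (V g x) (V g y) = cinner x y)) \<and>
     (\<forall>x\<in>K. V 0 x = x) \<and>
     (\<forall>g h. \<forall>x\<in>K. V (g + h) x = V g (V h x)) \<and>
     (\<forall>x\<in>K. continuous_on UNIV (\<lambda>g. V g x))"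

definition commutant :: "('h::complex_inner \<Rightarrow> 'h) set \<Rightarrow> ('h \<Rightarrow> 'h) set" where
  "commutant \<A> = {B. bounded_clinear B \<and> (\<forall>A\<in>\<A>. A \<circ> B = B \<circ> A)}"

definition vN_generated :: "('g \<Rightarrow> 'h::complex_inner \<Rightarrow> 'h) \<Rightarrow> ('h \<Rightarrow> 'h) set" where
  "vN_generated V = commutant (commutant (range V))"

definition vN_centre :: "('g \<Rightarrow> 'h::complex_inner \<Rightarrow> 'h) \<Rightarrow> ('h \<Rightarrow> 'h) set" where
  "vN_centre V = vN_generated V \<inter> commutant (vN_generated V)"

section \<open>Direct integrals\<close>

text \<open>
  Regularity means outer regularity by open and inner regularity by compact sets,
  for all Borel sets.
\<close>

definition regular_borel_measure :: "'a::t2_space measure \<Rightarrow> bool" where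
  "regular_borel_measure \<mu> \<longleftrightarrow> sets \<mu> = sets borel \<and>
     (\<forall>B\<in>sets borel.
        emeasure \<mu> B = (INF U\<in>{U. open U \<and> B \<subseteq> U}. emeasure \<mu> U) \<and>
        emeasure \<mu> B = (SUP K\<in>{K. compact K \<and> K \<subseteq> B}. emeasure \<mu> K))"

text \<open>
  A measurable field of Hilbert spaces, with \<open>S\<close> the space of measurable sections.
  The fibres are closed subspaces of one complex Hilbert space \<open>'k\<close>, of arbitrary dimension.
  This only serves to give the fibres a common type and is no restriction:
  any family of Hilbert spaces embeds into its Hilbert sum. Measurability
  refers to \<open>S\<close> alone and not to the ambient space.
\<close>

definition measurable_field ::
  "'a measure \<Rightarrow> ('a \<Rightarrow> 'k::complex_hilbert set) \<Rightarrow> ('a \<Rightarrow> 'k) set \<Rightarrow> bool" where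
  "measurable_field \<mu> Hf S \<longleftrightarrow>
     (\<forall>\<alpha>. csubspace (Hf \<alpha>) \<and> closed (Hf \<alpha>)) \<and>
     (\<forall>x\<in>S. \<forall>\<alpha>. x \<alpha> \<in> Hf \<alpha>) \<and>
     (\<lambda>\<alpha>. 0) \<in> S \<and>
     (\<forall>x\<in>S. \<forall>y\<in>S. (\<lambda>\<alpha>. x \<alpha> + y \<alpha>) \<in> S) \<and>
     (\<forall>c. \<forall>x\<in>S. (\<lambda>\<alpha>. c *\<^sub>C x \<alpha>) \<in> S) \<and>
     (\<forall>x\<in>S. (\<lambda>\<alpha>. norm (x \<alpha>)) \<in> borel_measurable \<mu>) \<and>
     (\<forall>y. (\<forall>\<alpha>. y \<alpha> \<in> Hf \<alpha>) \<and>
          (\<forall>x\<in>S. (\<lambda>\<alpha>. cinner (x \<alpha>) (y \<alpha>)) \<in> borel_measurable \<mu>) \<longrightarrow> y \<in> S) \<and>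
     (\<exists>e :: nat \<Rightarrow> 'a \<Rightarrow> 'k. range e \<subseteq> S \<and>
          (\<forall>\<alpha>. closure (cspan (range (\<lambda>n. e n \<alpha>))) = Hf \<alpha>))"

definition L2_sections :: "'a measure \<Rightarrow> ('a \<Rightarrow> 'k::complex_hilbert) set \<Rightarrow> ('a \<Rightarrow> 'k) set" where
  "L2_sections \<mu> S = {x\<in>S. integrable \<mu> (\<lambda>\<alpha>. (norm (x \<alpha>))\<^sup>2)}"

text \<open>
  The identification of \<open>'h\<close> with the direct integral of the \<open>Hf \<alpha>\<close> is given by the map \<open>J\<close>
  sending a square integrable section to the vector represented by its almost-everywhere class.
  As \<open>J\<close> preserves inner products, it identifies exactly the sections that
  agree almost everywhere.
\<close>

definition is_direct_integral ::
  "'a measure \<Rightarrow> ('a \<Rightarrow> 'k::complex_hilbert set) \<Rightarrow> ('a \<Rightarrow> 'k) set \<Rightarrow>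
   (('a \<Rightarrow> 'k) \<Rightarrow> 'h::complex_hilbert) \<Rightarrow> bool" where
  "is_direct_integral \<mu> Hf S J \<longleftrightarrow> measurable_field \<mu> Hf S \<and>
     (\<forall>x\<in>L2_sections \<mu> S. \<forall>y\<in>L2_sections \<mu> S. J (\<lambda>\<alpha>. x \<alpha> + y \<alpha>) = J x + J y) \<and>
     (\<forall>c. \<forall>x\<in>L2_sections \<mu> S. J (\<lambda>\<alpha>. c *\<^sub>C x \<alpha>) = c *\<^sub>C J x) \<and>
     (\<forall>x\<in>L2_sections \<mu> S. \<forall>y\<in>L2_sections \<mu> S.
        cinner (J x) (J y) = (\<integral>\<alpha>. cinner (x \<alpha>) (y \<alpha>) \<partial>\<mu>)) \<and>
     J ` L2_sections \<mu> S = UNIV"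

definition Linf :: "'a measure \<Rightarrow> ('a \<Rightarrow> complex) set" where
  "Linf \<mu> = {f \<in> borel_measurable \<mu>. \<exists>C. AE \<alpha> in \<mu>. cmod (f \<alpha>) \<le> C}"

text \<open>
  Multiplication by \<open>f\<close>: multiply any section representing \<open>\<phi>\<close>; the choice is immaterial
  since \<open>J\<close> is an isometric identification.
\<close>

definition mult_op ::
  "'a measure \<Rightarrow> ('a \<Rightarrow> 'k::complex_hilbert) set \<Rightarrow> (('a \<Rightarrow> 'k) \<Rightarrow> 'h) \<Rightarrow>
   ('a \<Rightarrow> complex) \<Rightarrow> 'h \<Rightarrow> 'h" where
  "mult_op \<mu> S J f \<phi> = J (\<lambda>\<alpha>. f \<alpha> *\<^sub>C inv_into (L2_sections \<mu> S) J \<phi> \<alpha>)"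

text \<open>The orthogonal projection onto the direct integral over \<open>\<Delta>\<close>.\<close>

definition dint_proj ::
  "'a measure \<Rightarrow> ('a \<Rightarrow> 'k::complex_hilbert) set \<Rightarrow> (('a \<Rightarrow> 'k) \<Rightarrow> 'h::complex_hilbert) \<Rightarrow>
   'a set \<Rightarrow> 'h \<Rightarrow> 'h" where
  "dint_proj \<mu> S J \<Delta> = orth_proj (J ` {x\<in>L2_sections \<mu> S. \<forall>\<alpha>. \<alpha> \<notin> \<Delta> \<longrightarrow> x \<alpha> = 0})"

text \<open>
  The last two conjuncts say that \<open>f \<mapsto> mult_op \<mu> S J f\<close> is a bijection
  from \<open>L\<^sup>\<infinity>(\<mu>)\<close> (functions modulo null sets) onto the centre.
\<close>

definition central_decomposition ::
  "'a::t2_space measure \<Rightarrow> ('a \<Rightarrow> 'k::complex_hilbert set) \<Rightarrow> ('a \<Rightarrow> 'k) set \<Rightarrow>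
   (('a \<Rightarrow> 'k) \<Rightarrow> 'h::complex_hilbert) \<Rightarrow>
   ('g::topological_group_add \<Rightarrow> 'h \<Rightarrow> 'h) \<Rightarrow> ('a \<Rightarrow> 'g \<Rightarrow> 'k \<Rightarrow> 'k) \<Rightarrow> bool" where
  "central_decomposition \<mu> Hf S J V Vf \<longleftrightarrow>
     separable_space (euclidean :: 'a topology) \<and>
     regular_borel_measure \<mu> \<and>
     is_direct_integral \<mu> Hf S J \<and>
     (\<forall>\<alpha>. unitary_rep (Hf \<alpha>) (Vf \<alpha>)) \<and>
     (\<forall>g. \<forall>x\<in>S. (\<lambda>\<alpha>. Vf \<alpha> g (x \<alpha>)) \<in> S) \<and>
     (\<forall>g. \<forall>x\<in>L2_sections \<mu> S. V g (J x) = J (\<lambda>\<alpha>. Vf \<alpha> g (x \<alpha>))) \<and>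
     mult_op \<mu> S J ` Linf \<mu> = vN_centre V \<and>
     (\<forall>f\<in>Linf \<mu>. \<forall>h\<in>Linf \<mu>. mult_op \<mu> S J f = mult_op \<mu> S J h \<longrightarrow> (AE \<alpha> in \<mu>. f \<alpha> = h \<alpha>))"

definition point_supported :: "'a measure \<Rightarrow> bool" where
  "point_supported \<mu> \<longleftrightarrow> countable (space \<mu>) \<and> sets \<mu> = Pow (space \<mu>) \<and>
     (\<forall>\<Delta>. \<Delta> \<subseteq> space \<mu> \<longrightarrow> emeasure \<mu> \<Delta> = (\<Sum>\<^sub>\<infinity>x\<in>\<Delta>. emeasure \<mu> {x}))"

section \<open>Quadratic forms\<close>

text \<open>
  A quadratic form is given by its sesquilinear form \<open>Q\<close>; its value at \<open>\<Phi>\<close> is \<open>Q \<Phi> \<Phi>\<close>.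
  Antilinearity in the first argument follows from Hermitian symmetry.
  Values of \<open>Q\<close> outside the domain are irrelevant.
\<close>

definition hermitian_form ::
  "('h::complex_inner \<Rightarrow> 'h \<Rightarrow> complex) \<Rightarrow> 'h set \<Rightarrow> bool" where
  "hermitian_form Q D \<longleftrightarrow> csubspace D \<and> closure D = UNIV \<and>
     (\<forall>\<Phi>\<in>D. \<forall>\<Psi>\<in>D. \<forall>\<Xi>\<in>D. Q \<Phi> (\<Psi> + \<Xi>) = Q \<Phi> \<Psi> + Q \<Phi> \<Xi>) \<and>
     (\<forall>c. \<forall>\<Phi>\<in>D. \<forall>\<Psi>\<in>D. Q \<Phi> (c *\<^sub>C \<Psi>) = c * Q \<Phi> \<Psi>) \<and>
     (\<forall>\<Phi>\<in>D. \<forall>\<Psi>\<in>D. Q \<Phi> \<Psi> = cnj (Q \<Psi> \<Phi>))"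

definition closable_form ::
  "('h::complex_inner \<Rightarrow> 'h \<Rightarrow> complex) \<Rightarrow> 'h set \<Rightarrow> bool" where
  "closable_form Q D \<longleftrightarrow>
     (\<forall>\<Phi> :: nat \<Rightarrow> 'h. range \<Phi> \<subseteq> D \<and> \<Phi> \<longlonglongrightarrow> 0 \<and>
        ((\<lambda>(n, m). Q (\<Phi> n - \<Phi> m) (\<Phi> n - \<Phi> m)) \<longlongrightarrow> 0) (sequentially \<times>\<^sub>F sequentially) \<longrightarrow>
        (\<lambda>n. Q (\<Phi> n) (\<Phi> n)) \<longlonglongrightarrow> 0)"

definition form_extends ::
  "('h \<Rightarrow> 'h \<Rightarrow> complex) \<Rightarrow> 'h set \<Rightarrow> ('h \<Rightarrow> 'h \<Rightarrow> complex) \<Rightarrow> 'h set \<Rightarrow> bool" where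
  "form_extends Qh Dh Q D \<longleftrightarrow> D \<subseteq> Dh \<and> (\<forall>\<Phi>\<in>D. \<forall>\<Psi>\<in>D. Qh \<Phi> \<Psi> = Q \<Phi> \<Psi>)"

text \<open>In the next two definitions \<open>P\<close> is the family of projections indexed by measurable sets.\<close>

definition G_invariant_form ::
  "'a measure \<Rightarrow> ('a set \<Rightarrow> 'h \<Rightarrow> 'h) \<Rightarrow> ('g \<Rightarrow> 'h \<Rightarrow> 'h) \<Rightarrow>
   ('h::complex_inner \<Rightarrow> 'h \<Rightarrow> complex) \<Rightarrow> 'h set \<Rightarrow> bool" where
  "G_invariant_form \<mu> P V Q D \<longleftrightarrow>
     (\<forall>\<Delta>\<in>sets \<mu>. P \<Delta> ` D \<subseteq> D) \<and>
     (\<forall>\<Delta>\<in>sets \<mu>. emeasure \<mu> \<Delta> < \<infinity> \<longrightarrow>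
        (\<exists>M>0. \<forall>\<Phi>\<in>D. cmod (Q (P \<Delta> \<Phi>) (P \<Delta> \<Phi>)) \<le> M * (norm (P \<Delta> \<Phi>))\<^sup>2)) \<and>
     (\<forall>\<Phi>\<in>D. \<exists>M>0. \<forall>\<Delta>\<in>sets \<mu>. cmod (Q (P \<Delta> \<Phi>) (P \<Delta> \<Phi>)) < M) \<and>
     (\<forall>g. V g ` D = D \<and> (\<forall>\<Phi>\<in>D. Q (V g \<Phi>) (V g \<Phi>) = Q \<Phi> \<Phi>))"

definition countably_orthogonally_additive ::
  "'a measure \<Rightarrow> ('a set \<Rightarrow> 'h \<Rightarrow> 'h) \<Rightarrow> ('h \<Rightarrow> 'h \<Rightarrow> complex) \<Rightarrow> 'h set \<Rightarrow> bool" where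
  "countably_orthogonally_additive \<mu> P Q D \<longleftrightarrow>
     (\<forall>\<Delta>\<in>sets \<mu>. P \<Delta> ` D \<subseteq> D) \<and>
     (\<forall>\<Delta>\<in>sets \<mu>. \<forall>\<Delta>s :: nat \<Rightarrow> 'a set.
        range \<Delta>s \<subseteq> sets \<mu> \<and> disjoint_family \<Delta>s \<and> (\<Union>i. \<Delta>s i) = \<Delta> \<longrightarrow>
        (\<forall>\<Phi>\<in>D. (\<lambda>i. Q (P (\<Delta>s i) \<Phi>) (P (\<Delta>s i) \<Phi>)) sums Q (P \<Delta> \<Phi>) (P \<Delta> \<Phi>)))"

section \<open>Self-adjoint operators and strong representability\<close>

text \<open>
  The operator \<open>T\<close> with domain \<open>DT\<close>. The last conjunct says that the graph of \<open>T\<close> is the graph of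
  its adjoint.
\<close>

definition self_adjoint :: "'h::complex_hilbert set \<Rightarrow> ('h \<Rightarrow> 'h) \<Rightarrow> bool" where
  "self_adjoint DT T \<longleftrightarrow> csubspace DT \<and> closure DT = UNIV \<and> clinear_on DT T \<and>
     (\<forall>\<Phi> \<Psi>. (\<Phi> \<in> DT \<and> T \<Phi> = \<Psi>) \<longleftrightarrow> (\<forall>\<Xi>\<in>DT. cinner \<Phi> (T \<Xi>) = cinner \<Psi> \<Xi>))"

definition projection_valued_measure :: "(real set \<Rightarrow> 'h::complex_hilbert \<Rightarrow> 'h) \<Rightarrow> bool" where
  "projection_valued_measure E \<longleftrightarrow>
     (\<forall>\<sigma>\<in>sets borel. is_orth_projection (E \<sigma>)) \<and>
     E UNIV = id \<and>
     (\<forall>\<sigma>\<in>sets borel. \<forall>\<tau>\<in>sets borel. E (\<sigma> \<inter> \<tau>) = E \<sigma> \<circ> E \<tau>) \<and>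
     (\<forall>\<sigma> :: nat \<Rightarrow> real set. range \<sigma> \<subseteq> sets borel \<and> disjoint_family \<sigma> \<longrightarrow>
        (\<forall>\<Phi>. (\<lambda>i. E (\<sigma> i) \<Phi>) sums E (\<Union>i. \<sigma> i) \<Phi>))"

definition spectral_measure :: "(real set \<Rightarrow> 'h::complex_hilbert \<Rightarrow> 'h) \<Rightarrow> 'h \<Rightarrow> real measure" where
  "spectral_measure E \<Phi> = measure_of UNIV (sets borel) (\<lambda>\<sigma>. ennreal ((norm (E \<sigma> \<Phi>))\<^sup>2))"

text \<open>The domain of \<open>\<integral>f dE\<close>, i.e. of \<open>f(T)\<close> in the functional calculus.\<close>

definition calculus_domain ::
  "(real set \<Rightarrow> 'h::complex_hilbert \<Rightarrow> 'h) \<Rightarrow> (real \<Rightarrow> real) \<Rightarrow> 'h set" where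
  "calculus_domain E f = {\<Phi>. integrable (spectral_measure E \<Phi>) (\<lambda>t. (f t)\<^sup>2)}"

text \<open>
  \<open>T = \<integral>\<lambda> dE(\<lambda>)\<close>. By polarization, the diagonal matrix elements determine \<open>T\<close> on its domain.
\<close>

definition resolution_of_identity ::
  "(real set \<Rightarrow> 'h::complex_hilbert \<Rightarrow> 'h) \<Rightarrow> 'h set \<Rightarrow> ('h \<Rightarrow> 'h) \<Rightarrow> bool" where
  "resolution_of_identity E DT T \<longleftrightarrow> projection_valued_measure E \<and>
     DT = calculus_domain E (\<lambda>t. t) \<and>
     (\<forall>\<Phi>\<in>DT. cinner \<Phi> (T \<Phi>) = complex_of_real (\<integral>t. t \<partial>spectral_measure E \<Phi>))"

definition spectral_norm :: "(real set \<Rightarrow> 'h::complex_hilbert \<Rightarrow> 'h) \<Rightarrow> 'h \<Rightarrow> real" where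
  "spectral_norm E \<Phi> = sqrt (\<integral>t. 1 + \<bar>t\<bar> \<partial>spectral_measure E \<Phi>)"

text \<open>
  \<open>calculus_domain E (\<lambda>t. sqrt \<bar>t\<bar>)\<close> is the domain of \<open>\<bar>T\<bar>\<^sup>1\<^sup>/\<^sup>2\<close>. The resolution of the identity
  \<open>E\<close> of a self-adjoint operator exists and is unique by the spectral theorem.
\<close>

definition strongly_representable_by ::
  "'h::complex_hilbert set \<Rightarrow> ('h \<Rightarrow> 'h) \<Rightarrow> ('h \<Rightarrow> 'h \<Rightarrow> complex) \<Rightarrow> 'h set \<Rightarrow> bool" where
  "strongly_representable_by DT T Q D \<longleftrightarrow> self_adjoint DT T \<and>
     (\<exists>E. resolution_of_identity E DT T \<and>
       (\<exists>Qh Dh. hermitian_form Qh Dh \<and> form_extends Qh Dh Q D \<and> DT \<subseteq> Dh \<and>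
          D \<subseteq> calculus_domain E (\<lambda>t. sqrt \<bar>t\<bar>) \<and>
          Dh = {\<Phi> \<in> calculus_domain E (\<lambda>t. sqrt \<bar>t\<bar>).
                  \<forall>\<epsilon>>0. \<exists>\<Psi>\<in>D. spectral_norm E (\<Phi> - \<Psi>) < \<epsilon>} \<and>
          (\<forall>\<Phi>\<in>Dh. Qh \<Phi> \<Phi> = complex_of_real (\<integral>t. t \<partial>spectral_measure E \<Phi>))))"

end

theory Submission
  imports Defs "HOL-Probability.Helly_Selection" "HOL-Computational_Algebra.Polynomial"
begin

text \<open>
  On \<open>P\<^sub>\<Delta>\<H>\<close> with \<open>\<mu>(\<Delta>) < \<infinity>\<close> the form is bounded, hence given by a bounded symmetric operator
  \<open>T\<^sub>\<Delta>\<close>. Invariance puts \<open>T\<^sub>\<Delta>\<close> in the commutant of \<open>V\<close>, so it commutes with every projection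
  \<open>P\<^sub>\<Delta>\<^sub>'\<close>, as these lie in the centre. Thus \<open>Q(P\<^sub>\<Delta>\<^sub>'\<Phi>) = \<langle>\<Phi>, T\<^sub>\<Delta> P\<^sub>\<Delta>\<^sub>'\<Phi>\<rangle>\<close> if \<open>P\<^sub>\<Delta>\<Phi> = \<Phi>\<close>, and
  countable additivity follows from the strong countable additivity of \<open>\<Delta>' \<mapsto> P\<^sub>\<Delta>\<^sub>'\<close>.

  For representability, cut the space into countably many disjoint sets of finite measure and let
  \<open>T\<close> be the orthogonal sum of the corresponding bounded operators \<open>T\<^sub>n\<close>. Its resolution of the
  identity is the orthogonal sum of those of the \<open>T\<^sub>n\<close>, and \<open>Q\<close> agrees with \<open>\<langle>\<Phi>, T\<Phi>\<rangle>\<close> on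
  \<open>\<D>\<^sub>0\<close>, which is contained in the domain of \<open>T\<close> and dense in that of \<open>\<bar>T\<bar>\<^sup>1\<^sup>/\<^sup>2\<close> for the spectral norm.

  The bounded spectral theorem is obtained from the Hausdorff moment problem: for \<open>0 \<le> A \<le> 1\<close> the
  numbers \<open>\<langle>x, A\<^sup>k(1 - A)\<^sup>mx\<rangle>\<close> are nonnegative, so \<open>k \<mapsto> \<langle>x, A\<^sup>kx\<rangle>\<close> are the moments of a measure
  on \<open>[0, 1]\<close>; bounded limits of polynomials in \<open>A\<close> then reach the indicators of Borel sets.
\<close>

section \<open>Complex Hilbert spaces\<close>

text \<open>Two estimates make the pieces of finite measure fit together. A set \<open>F\<close> of
  finite measure supporting a vector \<open>x\<close> of \<open>D0\<close> may meet infinitely many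
  blocks, but \<open>loc (A n) x = ?P (A n) (loc F x)\<close>, so the block series converges to
  \<open>loc F x\<close>; this is why \<open>D0\<close> lies in the domain of the orthogonal sum.
  And on finitely many blocks the operators have a common bound, so there the spectral norm is
  dominated by the Hilbert norm, and density in the space turns into density in the form domain.

  The obstacle in the moment approach is that every vector has its own measure, with no visible
  relation between the measures of different vectors. A function of the operator is therefore pinned
  down by its diagonal alone: polarization makes such an operator unique, and bounded limits are
  taken on the diagonal, polarized, and turned back into operators by the Riesz representation.
  These limits are only weak, and weak limits do not respect products, so multiplicativity is passed
  to the limit in one factor at a time.\<close>

instance complex_hilbert \<subseteq> banach ..

lemma scaleC_one [simp]: "1 *\<^sub>C (x::'a::complex_inner) = x"
  using scaleC_of_real[of 1 x] by simp

lemma scaleC_zero_left [simp]: "0 *\<^sub>C (x::'a::complex_inner) = 0"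
  using scaleC_of_real[of 0 x] by simp

lemma scaleC_zero_right [simp]: "c *\<^sub>C (0::'a::complex_inner) = 0"
  by (rule complex_vector.scale_zero_right)

lemma scaleC_minus_left: "(- c) *\<^sub>C (x::'a::complex_inner) = - (c *\<^sub>C x)"
  by (rule complex_vector.scale_minus_left)

lemma cinner_add_left: "cinner (x + y) (z::'a::complex_inner) = cinner x z + cinner y z"
  by (metis cinner_add_right cinner_commute complex_cnj_add)

lemma cinner_scaleC_left: "cinner (a *\<^sub>C x) (y::'a::complex_inner) = cnj a * cinner x y"
  by (metis cinner_commute cinner_scaleC_right complex_cnj_mult)

lemma cinner_zero_right [simp]: "cinner x (0::'a::complex_inner) = 0"
  using cinner_scaleC_right[of x 0 0] by simp

lemma cinner_zero_left [simp]: "cinner 0 (x::'a::complex_inner) = 0"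
  using cinner_scaleC_left[of 0 0 x] by simp

lemma cinner_minus_right: "cinner x (- y::'a::complex_inner) = - cinner x y"
  using cinner_scaleC_right[of x "-1" y] by (simp add: scaleC_minus_left)

lemma cinner_minus_left: "cinner (- x) (y::'a::complex_inner) = - cinner x y"
  using cinner_scaleC_left[of "-1" x y] by (simp add: scaleC_minus_left)

lemma cinner_diff_right: "cinner x (y - z::'a::complex_inner) = cinner x y - cinner x z"
  using cinner_add_right[of x y "-z"] by (simp add: cinner_minus_right)

lemma cinner_scaleR_right: "cinner x (r *\<^sub>R y::'a::complex_inner) = r * cinner x y"
  by (metis cinner_scaleC_right scaleC_of_real)

lemma cinner_scaleR_left: "cinner (r *\<^sub>R x) (y::'a::complex_inner) = r * cinner x y"
  by (metis cinner_scaleC_left complex_cnj_complex_of_real scaleC_of_real)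

lemma cinner_self: "cinner x (x::'a::complex_inner) = complex_of_real ((norm x)\<^sup>2)"
proof (rule complex_eqI)
  show "Re (cinner x x) = Re (complex_of_real ((norm x)\<^sup>2))"
    by (simp add: Re_cinner dot_square_norm)
  have "cinner x x = cnj (cinner x x)" by (rule cinner_commute)
  then show "Im (cinner x x) = Im (complex_of_real ((norm x)\<^sup>2))"
    by (metis Im_complex_of_real complex_cnj_cancel_iff Reals_cnj_iff complex_is_Real_iff)
qed

lemma cinner_self_eq_0 [simp]: "cinner x (x::'a::complex_inner) = 0 \<longleftrightarrow> x = 0"
  by (simp add: cinner_self)

lemma cinner_eqI: "(\<And>z. cinner z x = cinner z y) \<Longrightarrow> x = (y::'a::complex_inner)"
  by (metis cinner_diff_right cinner_self_eq_0 diff_self eq_iff_diff_eq_0)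

text \<open>The norm is that of the real structure, so complex homogeneity has to be derived from
  the sesquilinearity of \<open>cinner\<close>.\<close>

lemma norm_scaleC: "norm (c *\<^sub>C (x::'a::complex_inner)) = cmod c * norm x"
proof -
  have "complex_of_real ((norm (c *\<^sub>C x))\<^sup>2) = (c * cnj c) * cinner x x"
    unfolding cinner_self[symmetric] by (simp add: cinner_scaleC_left cinner_scaleC_right)
  also have "\<dots> = complex_of_real ((cmod c * norm x)\<^sup>2)"
    unfolding complex_norm_square[symmetric] by (simp add: cinner_self power_mult_distrib)
  finally have "complex_of_real ((norm (c *\<^sub>C x))\<^sup>2) = complex_of_real ((cmod c * norm x)\<^sup>2)" .
  then show ?thesis
    by (metis norm_ge_zero mult_nonneg_nonneg of_real_eq_iff power2_eq_imp_eq)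
qed

lemma cinner_Cauchy_Schwarz: "cmod (cinner x (y::'a::complex_inner)) \<le> norm x * norm y"
proof (cases "cinner x y = 0")
  case False
  \<comment> \<open>The phase \<open>u\<close> rotates \<open>cinner x y\<close> onto its modulus,
    so the real inequality for \<open>x\<close> and \<open>u *\<^sub>C y\<close> suffices.\<close>
  define u where "u = cnj (sgn (cinner x y))"
  have u: "cmod u = 1" using False by (simp add: u_def norm_sgn)
  have "u * cinner x y = complex_of_real (cmod (cinner x y))"
    using False by (simp add: u_def sgn_eq field_simps complex_norm_square[symmetric] power2_eq_square)
  then have "cmod (cinner x y) = Re (cinner x (u *\<^sub>C y))"
    by (simp add: cinner_scaleC_right)
  also have "\<dots> \<le> norm x * norm (u *\<^sub>C y)"
    by (simp add: Re_cinner norm_cauchy_schwarz)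
  finally show ?thesis by (simp add: norm_scaleC u)
qed simp

lemma bounded_linear_cinner_right: "bounded_linear (\<lambda>y::'a::complex_inner. cinner x y)"
  by (rule bounded_linear_intro[of _ "norm x"])
     (use cinner_Cauchy_Schwarz[of x] in
        \<open>auto simp: cinner_add_right cinner_scaleR_right scaleR_conv_of_real mult.commute[of _ "norm x"]\<close>)

lemma bounded_linear_cinner_left: "bounded_linear (\<lambda>x::'a::complex_inner. cinner x y)"
  by (rule bounded_linear_intro[of _ "norm y"])
     (use cinner_Cauchy_Schwarz[of _ y] in
        \<open>auto simp: cinner_add_left cinner_scaleR_left scaleR_conv_of_real\<close>)

lemma bounded_linear_scaleC: "bounded_linear (\<lambda>x::'a::complex_inner. c *\<^sub>C x)"
proof (rule bounded_linear_intro[of _ "cmod c"])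
  show "c *\<^sub>C r *\<^sub>R x = r *\<^sub>R c *\<^sub>C x" for r and x :: 'a
    by (simp flip: scaleC_of_real add: scaleC_scaleC mult.commute)
qed (auto simp: scaleC_add_right norm_scaleC mult.commute)

lemmas tendsto_cinner_right = bounded_linear.tendsto[OF bounded_linear_cinner_right]
lemmas tendsto_cinner_left = bounded_linear.tendsto[OF bounded_linear_cinner_left]
lemmas sums_cinner_right = bounded_linear.sums[OF bounded_linear_cinner_right]
lemmas sums_cinner_left = bounded_linear.sums[OF bounded_linear_cinner_left]

text \<open>The parallelogram law for \<open>x\<close> and \<open>\<i> *\<^sub>C y\<close>; it
  controls the two imaginary terms of the polarization identity.\<close>

lemma norm_add_scaleC_i:
  "(norm (x + \<i> *\<^sub>C y))\<^sup>2 + (norm (x - \<i> *\<^sub>C (y::'a::complex_inner)))\<^sup>2 = 2 * (norm x)\<^sup>2 + 2 * (norm y)\<^sup>2"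
proof -
  have "inner (\<i> *\<^sub>C y) (\<i> *\<^sub>C y) = inner y y"
    using norm_scaleC[of \<i> y] by (simp flip: power2_norm_eq_inner)
  then show ?thesis by (simp add: power2_norm_eq_inner inner_diff inner_add inner_commute)
qed

section \<open>Sesquilinear forms and bounded operators\<close>

text \<open>Hermitian symmetry is left out so that \<open>cinner x (F y)\<close> qualifies before
  \<open>F\<close> is known to be symmetric. Antilinearity in the first argument, which symmetry
  would imply, is demanded instead.\<close>

definition sesquilinear_on :: "'h::complex_inner set \<Rightarrow> ('h \<Rightarrow> 'h \<Rightarrow> complex) \<Rightarrow> bool" where
  "sesquilinear_on D b \<longleftrightarrow> csubspace D \<and>
     (\<forall>x\<in>D. \<forall>y\<in>D. \<forall>z\<in>D. b x (y + z) = b x y + b x z \<and> b (x + y) z = b x z + b y z) \<and>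
     (\<forall>c. \<forall>x\<in>D. \<forall>y\<in>D. b x (c *\<^sub>C y) = c * b x y \<and> b (c *\<^sub>C x) y = cnj c * b x y)"

lemma hermitian_form_sesquilinear:
  assumes "hermitian_form b D" shows "sesquilinear_on D b"
proof -
  have cs: "csubspace D" and add: "\<And>x y z. x \<in> D \<Longrightarrow> y \<in> D \<Longrightarrow> z \<in> D \<Longrightarrow> b x (y + z) = b x y + b x z"
    and sc: "\<And>c x y. x \<in> D \<Longrightarrow> y \<in> D \<Longrightarrow> b x (c *\<^sub>C y) = c * b x y"
    and herm: "\<And>x y. x \<in> D \<Longrightarrow> y \<in> D \<Longrightarrow> b x y = cnj (b y x)"
    using assms unfolding hermitian_form_def by blast+
  have "b (x + y) z = b x z + b y z" if "x \<in> D" "y \<in> D" "z \<in> D" for x y z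
    using that herm[of "x+y" z] herm[of x z] herm[of y z] add[of z x y] complex_vector.subspace_add[OF cs]
    by simp
  moreover have "b (c *\<^sub>C x) y = cnj c * b x y" if "x \<in> D" "y \<in> D" for c x y
    using that herm[of "c *\<^sub>C x" y] herm[of x y] sc[of y x c] complex_vector.subspace_scale[OF cs]
    by simp
  ultimately show ?thesis using cs add sc by (simp add: sesquilinear_on_def)
qed

lemma sesquilinear_onD:
  assumes "sesquilinear_on D b"
  shows "csubspace D"
    and "x \<in> D \<Longrightarrow> y \<in> D \<Longrightarrow> z \<in> D \<Longrightarrow> b x (y + z) = b x y + b x z"
    and "x \<in> D \<Longrightarrow> y \<in> D \<Longrightarrow> z \<in> D \<Longrightarrow> b (x + y) z = b x z + b y z"
    and "x \<in> D \<Longrightarrow> y \<in> D \<Longrightarrow> b x (c *\<^sub>C y) = c * b x y"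
    and "x \<in> D \<Longrightarrow> y \<in> D \<Longrightarrow> b (c *\<^sub>C x) y = cnj c * b x y"
    and "x \<in> D \<Longrightarrow> y \<in> D \<Longrightarrow> z \<in> D \<Longrightarrow> b x (y - z) = b x y - b x z"
    and "x \<in> D \<Longrightarrow> y \<in> D \<Longrightarrow> z \<in> D \<Longrightarrow> b (x - y) z = b x z - b y z"
    and "x \<in> D \<Longrightarrow> y \<in> D \<Longrightarrow> x + y \<in> D"
    and "x \<in> D \<Longrightarrow> y \<in> D \<Longrightarrow> x - y \<in> D"
    and "x \<in> D \<Longrightarrow> c *\<^sub>C x \<in> D"
    and "0 \<in> D"
proof -
  show cs: "csubspace D"
    and add: "x \<in> D \<Longrightarrow> y \<in> D \<Longrightarrow> z \<in> D \<Longrightarrow> b x (y + z) = b x y + b x z"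
    and add': "x \<in> D \<Longrightarrow> y \<in> D \<Longrightarrow> z \<in> D \<Longrightarrow> b (x + y) z = b x z + b y z"
    and sc: "x \<in> D \<Longrightarrow> y \<in> D \<Longrightarrow> b x (c *\<^sub>C y) = c * b x y"
    and sc': "x \<in> D \<Longrightarrow> y \<in> D \<Longrightarrow> b (c *\<^sub>C x) y = cnj c * b x y" for x y z c
    using assms unfolding sesquilinear_on_def by auto
  show "x \<in> D \<Longrightarrow> y \<in> D \<Longrightarrow> z \<in> D \<Longrightarrow> b x (y - z) = b x y - b x z"
    using add[of x y "-z"] sc[of x z "-1"] complex_vector.subspace_neg[OF cs, of z]
    by (simp add: scaleC_minus_left)
  show "x \<in> D \<Longrightarrow> y \<in> D \<Longrightarrow> z \<in> D \<Longrightarrow> b (x - y) z = b x z - b y z"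
    using add'[of x "-y" z] sc'[of y z "-1"] complex_vector.subspace_neg[OF cs, of y]
    by (simp add: scaleC_minus_left)
  show "x \<in> D \<Longrightarrow> y \<in> D \<Longrightarrow> x + y \<in> D" "x \<in> D \<Longrightarrow> y \<in> D \<Longrightarrow> x - y \<in> D"
    "x \<in> D \<Longrightarrow> c *\<^sub>C x \<in> D" "0 \<in> D"
    using cs complex_vector.subspace_add complex_vector.subspace_diff
      complex_vector.subspace_scale complex_vector.subspace_0 by blast+
qed

text \<open>Invariance, bounds and limits are all known on the diagonal only; this identity carries
  them over to the whole form.\<close>

lemma polarization:
  assumes b: "sesquilinear_on D b" and x: "x \<in> D" and y: "y \<in> D"
  shows "4 * b x y = b (x + y) (x + y) - b (x - y) (x - y)
     - \<i> * b (x + \<i> *\<^sub>C y) (x + \<i> *\<^sub>C y) + \<i> * b (x - \<i> *\<^sub>C y) (x - \<i> *\<^sub>C y)"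
proof -
  note * = sesquilinear_onD[OF b]
  have "\<i> *\<^sub>C y \<in> D" using *(10) y by blast
  then show ?thesis using x y by (simp add: *(2-10) algebra_simps)
qed

lemma sesquilinear_eqI:
  assumes "sesquilinear_on D b" "sesquilinear_on D b'" and eq: "\<And>x. x \<in> D \<Longrightarrow> b x x = b' x x"
    and x: "x \<in> D" "y \<in> D"
  shows "b x y = b' x y"
proof -
  have "4 * b x y = 4 * b' x y"
    using sesquilinear_onD(8-10)[OF assms(1)] x
    by (subst polarization[OF assms(1) x], subst polarization[OF assms(2) x]) (simp add: eq)
  then show ?thesis by simp
qed

text \<open>On unit vectors the parallelogram law makes each pair of squared norms in the
  polarization identity sum to 4, so four times the value is at most \<open>8 * C\<close>. Rescaling
  to unit vectors is what produces a product of norms.\<close>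

lemma sesquilinear_bound:
  assumes b: "sesquilinear_on D b" and bd: "\<And>x. x \<in> D \<Longrightarrow> cmod (b x x) \<le> C * (norm x)\<^sup>2"
    and x: "x \<in> D" and y: "y \<in> D"
  shows "cmod (b x y) \<le> 2 * C * norm x * norm y"
proof -
  note * = sesquilinear_onD[OF b]
  have unit: "cmod (b u v) \<le> 2 * C" if u: "u \<in> D" "norm u = 1" and v: "v \<in> D" "norm v = 1" for u v
  proof -
    have "cmod (4 * b u v) \<le> cmod (b (u + v) (u + v)) + cmod (b (u - v) (u - v))
       + cmod (b (u + \<i> *\<^sub>C v) (u + \<i> *\<^sub>C v)) + cmod (b (u - \<i> *\<^sub>C v) (u - \<i> *\<^sub>C v))"
      unfolding polarization[OF b u(1) v(1)]
      by (intro order_trans[OF norm_triangle_ineq] order_trans[OF norm_triangle_ineq4] add_mono)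
        (auto simp: norm_mult)
    also have "\<dots> \<le> C * (norm (u + v))\<^sup>2 + C * (norm (u - v))\<^sup>2
       + C * (norm (u + \<i> *\<^sub>C v))\<^sup>2 + C * (norm (u - \<i> *\<^sub>C v))\<^sup>2"
      using u v *(8-10) by (intro add_mono bd) auto
    also have "\<dots> = C * ((norm (u + v))\<^sup>2 + (norm (u - v))\<^sup>2)
       + C * ((norm (u + \<i> *\<^sub>C v))\<^sup>2 + (norm (u - \<i> *\<^sub>C v))\<^sup>2)"
      by (simp add: algebra_simps)
    also have "(norm (u + v))\<^sup>2 + (norm (u - v))\<^sup>2 = 4"
      using u v by (simp add: power2_norm_eq_inner inner_diff inner_add norm_eq_1 algebra_simps)
    also have "(norm (u + \<i> *\<^sub>C v))\<^sup>2 + (norm (u - \<i> *\<^sub>C v))\<^sup>2 = 4"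
      using u v by (simp add: norm_add_scaleC_i)
    finally show ?thesis by (simp add: norm_mult)
  qed
  show ?thesis
  proof (cases "x = 0 \<or> y = 0")
    case True
    then have "b x y = 0"
      using *(4)[OF x y, of 0] *(5)[OF x y, of 0] by auto
    then show ?thesis using True by auto
  next
    case False
    define u v where "u = complex_of_real (1 / norm x) *\<^sub>C x" and "v = complex_of_real (1 / norm y) *\<^sub>C y"
    have u: "u \<in> D" "norm u = 1" and v: "v \<in> D" "norm v = 1"
      using False x y *(10) by (auto simp: u_def v_def norm_scaleC norm_divide)
    have "b x y = complex_of_real (norm x * norm y) * b u v"
      using False x y *(10) by (simp add: u_def v_def *(4,5))
    then have "cmod (b x y) = (norm x * norm y) * cmod (b u v)" by (simp add: norm_mult)
    also have "\<dots> \<le> (norm x * norm y) * (2 * C)" by (intro mult_left_mono unit u v) auto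
    finally show ?thesis by (simp add: mult_ac)
  qed
qed

section \<open>Bounded operators and their diagonals\<close>

lemma bounded_clinearD:
  assumes "bounded_clinear F"
  shows "bounded_linear F" "F (x + y) = F x + F y" "F (c *\<^sub>C x) = c *\<^sub>C F x" "F (x - y) = F x - F y"
    "F 0 = 0" "F (r *\<^sub>R x) = r *\<^sub>R F x" "F (sum f I) = (\<Sum>i\<in>I. F (f i))"
  using assms unfolding bounded_clinear_def clinear_on_def
  by (auto simp: bounded_linear.linear linear_diff linear_0 linear_cmul linear_sum)

lemma sesquilinear_operator:
  assumes "bounded_clinear F" shows "sesquilinear_on UNIV (\<lambda>x y. cinner x (F y))"
  by (simp add: sesquilinear_on_def bounded_clinearD[OF assms] cinner_add_left cinner_add_right
      cinner_scaleC_left cinner_scaleC_right)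

text \<open>A complex phenomenon, by polarization: a rotation of the real plane by a right angle has
  zero diagonal without being zero.\<close>

lemma operator_eqI:
  assumes "bounded_clinear F" "bounded_clinear G" "\<And>x. cinner x (F x) = cinner x (G x)"
  shows "F = G"
proof
  fix y
  have "cinner x (F y) = cinner x (G y)" for x
    using sesquilinear_eqI[OF sesquilinear_operator sesquilinear_operator] assms by blast
  then show "F y = G y" by (rule cinner_eqI)
qed

text \<open>Both \<open>cinner (F x) y\<close> and \<open>cinner x (F y)\<close> are sesquilinear,
  and a real diagonal makes them agree for \<open>x = y\<close>.\<close>

lemma symmetric_operatorI:
  assumes F: "bounded_clinear F" and re: "\<And>x. Im (cinner x (F x)) = 0"
  shows "cinner (F x) y = cinner x (F y)"
proof -
  have "sesquilinear_on UNIV (\<lambda>x y. cinner (F x) y)"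
    by (simp add: sesquilinear_on_def bounded_clinearD[OF F] cinner_add_left cinner_add_right
      cinner_scaleC_left cinner_scaleC_right)
  moreover have "cinner (F x) x = cinner x (F x)" for x
    by (metis cinner_commute complex_is_Real_iff re Reals_cnj_iff)
  ultimately show ?thesis
    using sesquilinear_eqI[OF _ sesquilinear_operator[OF F]] by blast
qed

lemma bounded_clinear_compose:
  "bounded_clinear F \<Longrightarrow> bounded_clinear G \<Longrightarrow> bounded_clinear (F \<circ> G)"
  unfolding bounded_clinear_def clinear_on_def
  by (auto simp: comp_def intro: bounded_linear_compose)

lemma bounded_clinear_id: "bounded_clinear id"
  by (simp add: bounded_clinear_def clinear_on_def id_def bounded_linear_ident)

lemma bounded_clinear_combination:
  "bounded_clinear F \<Longrightarrow> bounded_clinear G \<Longrightarrow> bounded_clinear (\<lambda>x. a *\<^sub>R F x + b *\<^sub>R G x)"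
  unfolding bounded_clinear_def clinear_on_def
  by (auto intro!: bounded_linear_add bounded_linear_const_scaleR
      simp: scaleC_add_right scaleR_add_right)
    (simp_all add: scaleC_scaleC mult.commute[of _ "complex_of_real _"] flip: scaleC_of_real)

text \<open>
  The representing vector is the limit of any sequence minimising \<open>\<parallel>x\<parallel>\<^sup>2 / 2 - Re (f x)\<close> over the
  subspace \<open>W\<close>; as the limit is only sought in the whole space, \<open>W\<close> need not be closed.
\<close>

lemma riesz_representation:
  fixes f :: "'h::complex_hilbert \<Rightarrow> complex"
  assumes W: "csubspace W"
    and add: "\<And>x y. x \<in> W \<Longrightarrow> y \<in> W \<Longrightarrow> f (x + y) = f x + f y"
    and sc: "\<And>c x. x \<in> W \<Longrightarrow> f (c *\<^sub>C x) = c * f x"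
    and bd: "\<And>x. x \<in> W \<Longrightarrow> cmod (f x) \<le> K * norm x"
  obtains v where "\<And>w. w \<in> W \<Longrightarrow> cinner v w = f w" "norm v \<le> \<bar>K\<bar>"
proof -
  note sub = complex_vector.subspace_0[OF W] complex_vector.subspace_add[OF W]
    complex_vector.subspace_diff[OF W] complex_vector.subspace_scale[OF W]
  have scR: "r *\<^sub>R x \<in> W" "f (r *\<^sub>R x) = r * f x" if "x \<in> W" for r x
    using that sub(4)[of x "complex_of_real r"] sc[of x "complex_of_real r"]
    by (simp_all add: scaleC_of_real)
  have f0: "f 0 = 0" using sc[OF sub(1), of 0] by simp
  define q where "q x = (norm x)\<^sup>2 / 2 - Re (f x)" for x
  have q_ge: "- K\<^sup>2 / 2 \<le> q x" if "x \<in> W" for x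
  proof -
    have "Re (f x) \<le> K * norm x"
      using bd[OF that] complex_Re_le_cmod order_trans by blast
    moreover have "0 \<le> (norm x - K)\<^sup>2" by simp
    ultimately show ?thesis unfolding q_def by (simp add: power2_eq_square algebra_simps)
  qed
  define I where "I = Inf (q ` W)"
  have bdd: "bdd_below (q ` W)" using q_ge by (intro bdd_belowI2)
  have I_le: "I \<le> q x" if "x \<in> W" for x
    unfolding I_def using bdd that by (simp add: cInf_lower)
  have "\<exists>x\<in>W. q x < I + 1 / Suc n" for n
  proof -
    have "\<exists>z\<in>q ` W. z < I + 1 / Suc n"
      unfolding I_def by (rule cInf_lessD) (use sub(1) in auto)
    then show ?thesis by auto
  qed
  then obtain x where x: "\<And>n. x n \<in> W" "\<And>n. q (x n) < I + 1 / Suc n" by metis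
  \<comment> \<open>The midpoint of two vectors stays in \<open>W\<close>, so by the parallelogram
    law two near-minimisers are close to each other.\<close>
  have par: "(norm (a - b))\<^sup>2 \<le> 4 * (q a + q b - 2 * I)" if "a \<in> W" "b \<in> W" for a b
  proof -
    have "I \<le> q ((1/2) *\<^sub>R (a + b))" using that scR sub by (intro I_le) auto
    moreover have "q ((1/2) *\<^sub>R (a + b)) = (norm (a + b))\<^sup>2 / 8 - (Re (f a) + Re (f b)) / 2"
    proof -
      have "f ((1/2) *\<^sub>R (a + b)) = complex_of_real (1/2) * (f a + f b)"
        using that scR(2)[of "a + b" "1/2"] sub(2) add by simp
      then have "Re (f ((1/2) *\<^sub>R (a + b))) = (1/2) * (Re (f a) + Re (f b))"
        by (simp only: Re_complex_of_real Im_complex_of_real times_complex.sel plus_complex.sel)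
      moreover have "norm ((1/2) *\<^sub>R (a + b)) = norm (a + b) / 2" by (simp only: norm_scaleR)
      ultimately show ?thesis unfolding q_def by (simp add: power_divide)
    qed
    moreover have "(norm (a + b))\<^sup>2 + (norm (a - b))\<^sup>2 = 2 * (norm a)\<^sup>2 + 2 * (norm b)\<^sup>2"
      by (simp add: power2_norm_eq_inner inner_diff inner_add inner_commute algebra_simps)
    ultimately show ?thesis unfolding q_def by (simp add: field_simps)
  qed
  have "Cauchy x"
  proof (rule metric_CauchyI)
    fix e :: real assume e: "0 < e"
    \<comment> \<open>Two errors below \<open>e\<^sup>2 / 8\<close>, multiplied by the factor 4 of
      \<open>par\<close>, stay below \<open>e\<^sup>2\<close>.\<close>
    obtain N where N: "1 / Suc N < e\<^sup>2 / 8"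
      using nat_approx_posE[of "e\<^sup>2 / 8"] e by auto
    show "\<exists>M. \<forall>m\<ge>M. \<forall>n\<ge>M. dist (x m) (x n) < e"
    proof (intro exI allI impI)
      fix m n assume mn: "N \<le> m" "N \<le> n"
      have "1 / Suc m \<le> 1 / Suc N" "1 / Suc n \<le> 1 / Suc N"
        using mn by (auto simp: field_simps)
      then have "q (x m) + q (x n) - 2 * I < e\<^sup>2 / 4"
        using x(2)[of m] x(2)[of n] N by linarith
      then have "(norm (x m - x n))\<^sup>2 < e\<^sup>2"
        using par[OF x(1) x(1), of m n] by (simp add: field_simps)
      then show "dist (x m) (x n) < e"
        using e by (simp add: dist_norm power2_less_imp_less)
    qed
  qed
  then obtain v where v: "x \<longlonglongrightarrow> v" using Cauchy_convergent convergent_def by blast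
  have qx: "(\<lambda>n. q (x n)) \<longlonglongrightarrow> I"
  proof (rule tendsto_sandwich[of "\<lambda>_. I" _ _ "\<lambda>n. I + 1 / Suc n"])
    show "(\<lambda>n. I + 1 / Suc n) \<longlonglongrightarrow> I"
      using tendsto_add[OF tendsto_const[of I] LIMSEQ_Suc[OF lim_1_over_n]] by simp
  qed (use I_le[OF x(1)] less_imp_le[OF x(2)] in \<open>auto intro!: always_eventually\<close>)
  have re: "Re (cinner v w) = Re (f w)" if w: "w \<in> W" for w
  proof -
    \<comment> \<open>Minimality of \<open>I\<close> along the line
      \<open>x n + s *\<^sub>R w\<close>, taken to the limit in \<open>n\<close>: the first-order
      condition at \<open>v\<close> without assuming \<open>v\<close> in \<open>W\<close>.\<close>
    have ineq: "0 \<le> s * (inner v w - Re (f w)) + s\<^sup>2 * (norm w)\<^sup>2 / 2" for s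
    proof -
      have "I - q (x n) \<le> s * (inner (x n) w - Re (f w)) + s\<^sup>2 * (norm w)\<^sup>2 / 2" for n
      proof -
        have "I \<le> q (x n + s *\<^sub>R w)" using x w scR sub by (intro I_le) auto
        also have "\<dots> = q (x n) + s * (inner (x n) w - Re (f w)) + s\<^sup>2 * (norm w)\<^sup>2 / 2"
        proof -
          have "(norm (x n + s *\<^sub>R w))\<^sup>2 = (norm (x n))\<^sup>2 + 2 * s * inner (x n) w + s\<^sup>2 * (norm w)\<^sup>2"
            unfolding power2_norm_eq_inner by (simp add: inner_add inner_commute power2_eq_square)
          then show ?thesis unfolding q_def
            by (simp add: add[OF x(1) scR(1)[OF w]] scR(2)[OF w] field_simps)
        qed
        finally show ?thesis by simp
      qed
      moreover have lim: "(\<lambda>n. s * (inner (x n) w - Re (f w)) + s\<^sup>2 * (norm w)\<^sup>2 / 2)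
          \<longlonglongrightarrow> s * (inner v w - Re (f w)) + s\<^sup>2 * (norm w)\<^sup>2 / 2"
        by (intro tendsto_intros v)
      moreover have "(\<lambda>n. I - q (x n)) \<longlonglongrightarrow> I - I" by (intro tendsto_intros qx)
      ultimately have "I - I \<le> s * (inner v w - Re (f w)) + s\<^sup>2 * (norm w)\<^sup>2 / 2"
        by (intro LIMSEQ_le[OF _ lim]) auto
      then show ?thesis by simp
    qed
    define d where "d = inner v w - Re (f w)"
    have "d = 0"
    proof (rule ccontr)
      assume d: "d \<noteq> 0"
      \<comment> \<open>The test value \<open>s = - d / r\<close> makes the linear term outweigh the
        quadratic one; adding 1 keeps \<open>r\<close> positive when \<open>w = 0\<close>.\<close>
      define r where "r = (norm w)\<^sup>2 + 1"
      have "0 \<le> (- d / r) * d + (- d / r)\<^sup>2 * (norm w)\<^sup>2 / 2" using ineq[of "- d / r"] d_def by simp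
      also have "\<dots> \<le> (- d / r) * d + (- d / r)\<^sup>2 * r / 2"
        by (intro add_left_mono divide_right_mono mult_left_mono) (auto simp: r_def)
      also have "\<dots> = - d\<^sup>2 / (2 * r)"
        by (simp add: r_def field_simps power2_eq_square add_pos_nonneg add_nonneg_eq_0_iff)
      also have "\<dots> < 0" using d by (simp add: r_def add_nonneg_pos)
      finally show False by simp
    qed
    then show ?thesis by (simp add: d_def Re_cinner)
  qed
  have rep: "cinner v w = f w" if w: "w \<in> W" for w
  proof (rule complex_eqI)
    \<comment> \<open>The real part of \<open>- \<i> * z\<close> is the imaginary part of
      \<open>z\<close>, so the real identity is applied to a rotated vector.\<close>
    show "Im (cinner v w) = Im (f w)"
      using re[OF sub(4)[OF w, of "- \<i>"]] sc[OF w, of "- \<i>"] by (simp add: cinner_scaleC_right cinner_minus_right)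
  qed (rule re[OF w])
  \<comment> \<open>The vector \<open>v\<close> need not lie in \<open>W\<close>, so the bound on
    \<open>f\<close> cannot be applied to it; it is applied along the sequence and passed to the
    limit.\<close>
  have "norm v \<le> \<bar>K\<bar>"
  proof -
    have "(\<lambda>n. Re (cinner v (x n))) \<longlonglongrightarrow> Re (cinner v v)"
      by (intro tendsto_Re tendsto_cinner_right v)
    moreover have "(\<lambda>n. \<bar>K\<bar> * norm (x n)) \<longlonglongrightarrow> \<bar>K\<bar> * norm v" by (intro tendsto_intros v)
    moreover have "Re (cinner v (x n)) \<le> \<bar>K\<bar> * norm (x n)" for n
      using rep[OF x(1)] bd[OF x(1), of n] complex_Re_le_cmod[of "f (x n)"]
        mult_right_mono[OF abs_ge_self[of K] norm_ge_zero[of "x n"]] by simp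
    ultimately have "Re (cinner v v) \<le> \<bar>K\<bar> * norm v" by (meson LIMSEQ_le)
    then show ?thesis by (cases "v = 0") (auto simp: cinner_self power2_eq_square)
  qed
  with rep show ?thesis using that by blast
qed

section \<open>Dense subspaces and the operators of bounded forms\<close>

lemma dense_cinner_eqI:
  fixes x y :: "'h::complex_inner"
  assumes "closure D = UNIV" and eq: "\<And>w. w \<in> D \<Longrightarrow> cinner w x = cinner w y"
  shows "x = y"
proof -
  have "cinner w x = cinner w y" for w
  proof -
    obtain s where s: "\<And>n::nat. s n \<in> D" "s \<longlonglongrightarrow> w"
      using assms(1) closure_sequential[of w D] by auto
    have "(\<lambda>n. cinner (s n) x) \<longlonglongrightarrow> cinner w x" "(\<lambda>n. cinner (s n) y) \<longlonglongrightarrow> cinner w y"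
      using s by (auto intro: tendsto_cinner_left)
    then show ?thesis using eq s(1) LIMSEQ_unique by fastforce
  qed
  then show ?thesis by (rule cinner_eqI)
qed

lemma dense_operator_eqI:
  assumes D: "closure D = UNIV" and F: "bounded_linear F" "bounded_linear G"
    and eq: "\<And>x. x \<in> D \<Longrightarrow> F x = (G x :: 'h::complex_inner)"
  shows "F x = G x"
proof -
  obtain s where s: "\<And>n::nat. s n \<in> D" "s \<longlonglongrightarrow> x"
    using assms(1) closure_sequential[of x D] by auto
  have "(\<lambda>n. F (s n)) \<longlonglongrightarrow> F x" "(\<lambda>n. G (s n)) \<longlonglongrightarrow> G x"
    using s F by (auto intro: bounded_linear.tendsto)
  then show ?thesis using eq s(1) LIMSEQ_unique by fastforce
qed

text \<open>The Riesz representation is used twice. On \<open>D\<close> it yields \<open>T\<close>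
  with \<open>cinner (T y) x = b y x\<close>. A second use, for
  \<open>x \<mapsto> cinner y (T x)\<close> with arbitrary \<open>y\<close>, yields the adjoint
  \<open>F\<close> of \<open>T\<close>, which is defined everywhere at once; this replaces an
  extension of \<open>T\<close> by limits. Hermitian symmetry of \<open>b\<close> makes
  \<open>F\<close> agree with \<open>T\<close> on \<open>D\<close>.\<close>

lemma bounded_form_operator:
  fixes b :: "'h::complex_hilbert \<Rightarrow> 'h \<Rightarrow> complex"
  assumes b: "hermitian_form b D" and bd: "\<And>x. x \<in> D \<Longrightarrow> cmod (b x x) \<le> C * (norm x)\<^sup>2"
  obtains F where "bounded_clinear F" "\<And>x y. cinner (F x) y = cinner x (F y)"
    "\<And>x y. x \<in> D \<Longrightarrow> y \<in> D \<Longrightarrow> cinner x (F y) = b x y"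
proof -
  note s = hermitian_form_sesquilinear[OF b]
  note * = sesquilinear_onD[OF s]
  have dense: "closure D = UNIV" and herm: "\<And>x y. x \<in> D \<Longrightarrow> y \<in> D \<Longrightarrow> b x y = cnj (b y x)"
    using b unfolding hermitian_form_def by blast+
  note bd2 = sesquilinear_bound[OF s bd]
  have "\<exists>v. (\<forall>x\<in>D. cinner v x = b y x) \<and> norm v \<le> \<bar>2 * C * norm y\<bar>" if y: "y \<in> D" for y
    by (rule riesz_representation[of D "b y" "2 * C * norm y"])
      (use * y bd2 in auto)
  then obtain T where T: "\<And>x y. y \<in> D \<Longrightarrow> x \<in> D \<Longrightarrow> cinner (T y) x = b y x"
      "\<And>y. y \<in> D \<Longrightarrow> norm (T y) \<le> \<bar>2 * C * norm y\<bar>" by metis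
  have uniq: "u = v" if "\<And>w. w \<in> D \<Longrightarrow> cinner u w = cinner v w" for u v
    by (rule dense_cinner_eqI[OF dense]) (subst (1 2) cinner_commute, simp add: that)
  have T_add: "T (x + y) = T x + T y" if "x \<in> D" "y \<in> D" for x y
    by (rule uniq) (use that in \<open>simp add: T * cinner_add_left\<close>)
  have T_sc: "T (c *\<^sub>C x) = c *\<^sub>C T x" if "x \<in> D" for x c
    by (rule uniq) (use that in \<open>simp add: T * cinner_scaleC_left\<close>)
  have "\<exists>v. (\<forall>x\<in>D. cinner v x = cinner y (T x)) \<and> norm v \<le> \<bar>2 * \<bar>C\<bar> * norm y\<bar>" for y
  proof (rule riesz_representation[of D "\<lambda>x. cinner y (T x)" "2 * \<bar>C\<bar> * norm y"])
    fix x assume x: "x \<in> D"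
    have "cmod (cinner y (T x)) \<le> norm y * norm (T x)" by (rule cinner_Cauchy_Schwarz)
    also have "\<dots> \<le> norm y * \<bar>2 * C * norm x\<bar>" by (intro mult_left_mono T x) auto
    finally show "cmod (cinner y (T x)) \<le> 2 * \<bar>C\<bar> * norm y * norm x"
      by (simp add: abs_mult mult_ac)
  qed (use * in \<open>auto simp: T_add T_sc cinner_add_right cinner_scaleC_right\<close>)
  then obtain F where F: "\<And>x y. x \<in> D \<Longrightarrow> cinner (F y) x = cinner y (T x)"
      "\<And>y. norm (F y) \<le> \<bar>2 * \<bar>C\<bar> * norm y\<bar>" by metis
  have F_add: "F (x + y) = F x + F y" for x y
    by (rule uniq) (simp add: F cinner_add_left)
  have F_sc: "F (c *\<^sub>C x) = c *\<^sub>C F x" for x c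
    by (rule uniq) (simp add: F cinner_scaleC_left)
  have Fb: "bounded_clinear F" unfolding bounded_clinear_def clinear_on_def
  proof (intro conjI)
    show "bounded_linear F"
    proof (rule bounded_linear_intro[of _ "2 * \<bar>C\<bar>"])
      show "F (r *\<^sub>R x) = r *\<^sub>R F x" for r x
        using F_sc[of "complex_of_real r" x] by (simp add: scaleC_of_real)
      show "norm (F x) \<le> norm x * (2 * \<bar>C\<bar>)" for x using F(2)[of x] by (simp add: abs_mult mult_ac)
    qed (rule F_add)
  qed (use F_add F_sc in auto)
  have FT: "F x = T x" if "x \<in> D" for x
  proof (rule uniq)
    fix w assume w: "w \<in> D"
    have "cinner (F x) w = cnj (cinner (T w) x)" using F(1)[OF w, of x] cinner_commute[of x "T w"] by simp
    also have "\<dots> = cnj (b w x)" using T(1)[OF w that] by simp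
    also have "\<dots> = cinner (T x) w" using T(1)[OF that w] herm[OF that w] by simp
    finally show "cinner (F x) w = cinner (T x) w" .
  qed
  have rep: "cinner x (F y) = b x y" if "x \<in> D" "y \<in> D" for x y
  proof -
    have "cinner x (F y) = cnj (cinner (T y) x)" using FT[OF that(2)] cinner_commute[of x] by simp
    also have "\<dots> = b x y" using T(1)[OF that(2,1)] herm[OF that] by simp
    finally show ?thesis .
  qed
  have sym: "cinner (F x) y = cinner x (F y)" for x y
  proof -
    have 1: "cinner (F x) y = cinner x (F y)" if y: "y \<in> D" for y using F(1) FT y by simp
    obtain s where s: "\<And>n::nat. s n \<in> D" "s \<longlonglongrightarrow> y"
      using dense closure_sequential[of y D] by auto
    have "(\<lambda>n. cinner (F x) (s n)) \<longlonglongrightarrow> cinner (F x) y" "(\<lambda>n. cinner x (F (s n))) \<longlonglongrightarrow> cinner x (F y)"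
      using s bounded_clinearD(1)[OF Fb] by (auto intro: tendsto_cinner_right bounded_linear.tendsto)
    then show ?thesis using 1 s(1) LIMSEQ_unique by fastforce
  qed
  show ?thesis using that Fb sym rep by blast
qed

section \<open>Orthogonal series\<close>

text \<open>The hypothesis \<open>proj\<close> says that each \<open>v i\<close> is the component of
  \<open>w\<close> along itself. The squared distance of the partial sum from \<open>w\<close> is
  then \<open>(norm w)\<^sup>2\<close> minus the partial sum of the squared norms (Bessel), so
  convergence to \<open>w\<close> is the same as Parseval's identity.\<close>

lemma orthogonal_sums_iff_norm:
  fixes v :: "nat \<Rightarrow> 'h::complex_inner"
  assumes ort: "\<And>i j. i \<noteq> j \<Longrightarrow> cinner (v i) (v j) = 0"
    and proj: "\<And>i. cinner (v i) w = cinner (v i) (v i)"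
  shows "v sums w \<longleftrightarrow> (\<lambda>i. (norm (v i))\<^sup>2) sums (norm w)\<^sup>2"
proof -
  have "(norm (w - (\<Sum>i<n. v i)))\<^sup>2 = (norm w)\<^sup>2 - (\<Sum>i<n. (norm (v i))\<^sup>2)" for n
  proof (induction n)
    case (Suc n)
    have "inner (v n) (w - (\<Sum>i<n. v i)) = Re (cinner (v n) w - (\<Sum>i<n. cinner (v n) (v i)))"
      by (simp add: inner_diff_right inner_sum_right Re_cinner)
    also have "\<dots> = (norm (v n))\<^sup>2" by (simp add: proj ort cinner_self)
    finally have "inner (v n) (w - (\<Sum>i<n. v i)) = (norm (v n))\<^sup>2" .
    moreover have "(norm (a - b))\<^sup>2 = (norm a)\<^sup>2 - 2 * inner b a + (norm b)\<^sup>2" for a b :: 'h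
      by (simp add: power2_norm_eq_inner inner_diff inner_commute)
    ultimately have "(norm ((w - (\<Sum>i<n. v i)) - v n))\<^sup>2
        = (norm (w - (\<Sum>i<n. v i)))\<^sup>2 - (norm (v n))\<^sup>2" by simp
    then show ?case using Suc by (simp add: diff_diff_eq)
  qed simp
  then have eq: "(\<lambda>n. (norm (w - (\<Sum>i<n. v i)))\<^sup>2) = (\<lambda>n. (norm w)\<^sup>2 - (\<Sum>i<n. (norm (v i))\<^sup>2))" by simp
  have "v sums w \<longleftrightarrow> (\<lambda>n. (norm (w - (\<Sum>i<n. v i)))\<^sup>2) \<longlonglongrightarrow> 0"
  proof
    assume "v sums w"
    then have "(\<lambda>n. (norm (w - (\<Sum>i<n. v i)))\<^sup>2) \<longlonglongrightarrow> (norm (w - w))\<^sup>2"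
      unfolding sums_def by (intro tendsto_intros)
    then show "(\<lambda>n. (norm (w - (\<Sum>i<n. v i)))\<^sup>2) \<longlonglongrightarrow> 0" by simp
  next
    assume "(\<lambda>n. (norm (w - (\<Sum>i<n. v i)))\<^sup>2) \<longlonglongrightarrow> 0"
    from tendsto_real_sqrt[OF this] have "(\<lambda>n. norm (w - (\<Sum>i<n. v i))) \<longlonglongrightarrow> 0" by simp
    then show "v sums w"
      unfolding sums_def tendsto_dist_iff[of _ w] by (simp add: dist_norm norm_minus_commute)
  qed
  also have "\<dots> \<longleftrightarrow> (\<lambda>i. (norm (v i))\<^sup>2) sums (norm w)\<^sup>2"
  proof
    assume "(\<lambda>n. (norm (w - (\<Sum>i<n. v i)))\<^sup>2) \<longlonglongrightarrow> 0"
    from tendsto_diff[OF tendsto_const[of "(norm w)\<^sup>2"] this[unfolded eq]]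
    show "(\<lambda>i. (norm (v i))\<^sup>2) sums (norm w)\<^sup>2" by (simp add: sums_def)
  next
    assume "(\<lambda>i. (norm (v i))\<^sup>2) sums (norm w)\<^sup>2"
    from tendsto_diff[OF tendsto_const[of "(norm w)\<^sup>2"] this[unfolded sums_def]]
    show "(\<lambda>n. (norm (w - (\<Sum>i<n. v i)))\<^sup>2) \<longlonglongrightarrow> 0" by (simp add: eq)
  qed
  finally show ?thesis .
qed

text \<open>By Pythagoras the Cauchy criterion of the squared norms yields that of the vectors, and
  completeness finishes; in the other direction the sum itself serves as \<open>w\<close> in
  \<open>orthogonal_sums_iff_norm\<close>.\<close>

lemma orthogonal_summable_iff:
  fixes v :: "nat \<Rightarrow> 'h::complex_hilbert"
  assumes ort: "\<And>i j. i \<noteq> j \<Longrightarrow> cinner (v i) (v j) = 0"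
  shows "summable v \<longleftrightarrow> summable (\<lambda>i. (norm (v i))\<^sup>2)"
proof
  assume "summable v"
  then have v: "v sums suminf v" by (rule summable_sums)
  have "cinner (v i) (suminf v) = cinner (v i) (v i)" for i
  proof -
    have "(\<lambda>j. cinner (v i) (v j)) sums cinner (v i) (suminf v)" by (rule sums_cinner_right[OF v])
    moreover have "(\<lambda>j. cinner (v i) (v j)) sums cinner (v i) (v i)"
      using sums_finite[of "{i}" "\<lambda>j. cinner (v i) (v j)"] ort by auto
    ultimately show ?thesis by (rule sums_unique2)
  qed
  from orthogonal_sums_iff_norm[of v "suminf v", OF ort this] v
  show "summable (\<lambda>i. (norm (v i))\<^sup>2)" by (simp add: sums_summable)
next
  assume s: "summable (\<lambda>i. (norm (v i))\<^sup>2)"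
  have pyth: "(norm (\<Sum>i\<in>I. v i))\<^sup>2 = (\<Sum>i\<in>I. (norm (v i))\<^sup>2)" if "finite I" for I
    using that
  proof induction
    case (insert i I)
    have "inner (v i) (\<Sum>j\<in>I. v j) = 0"
      unfolding inner_sum_right using insert(2) ort
      by (intro sum.neutral) (metis Re_cinner zero_complex.sel(1))
    moreover have "(norm (a + b))\<^sup>2 = (norm a)\<^sup>2 + 2 * inner a b + (norm b)\<^sup>2" for a b :: 'h
      by (simp add: power2_norm_eq_inner inner_add inner_commute)
    ultimately show ?case using insert by simp
  qed simp
  show "summable v" unfolding summable_Cauchy
  proof (intro allI impI)
    fix e :: real assume e: "0 < e"
    then obtain N where N: "\<And>m n. m \<ge> N \<Longrightarrow> norm (\<Sum>i=m..<n. (norm (v i))\<^sup>2) < e\<^sup>2"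
      using s unfolding summable_Cauchy by (meson zero_less_power)
    have "norm (\<Sum>i=m..<n. v i) < e" if "m \<ge> N" for m n
      by (rule power2_less_imp_less) (use N[OF that, of n] e in \<open>auto simp: pyth\<close>)
    then show "\<exists>N. \<forall>m\<ge>N. \<forall>n. norm (sum v {m..<n}) < e" by blast
  qed
qed

section \<open>Projections of a direct integral\<close>

text \<open>Apart from membership in the centre, this is what the later arguments use of the direct
  integral; sections do not occur after it has been established.\<close>

locale projection_system =
  fixes M :: "'a measure" and P :: "'a set \<Rightarrow> 'h::complex_hilbert \<Rightarrow> 'h"
  assumes proj_bounded_clinear: "\<Delta> \<in> sets M \<Longrightarrow> bounded_clinear (P \<Delta>)"
    and proj_symmetric: "\<Delta> \<in> sets M \<Longrightarrow> cinner (P \<Delta> x) y = cinner x (P \<Delta> y)"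
    and proj_Int: "\<Delta> \<in> sets M \<Longrightarrow> \<Delta>' \<in> sets M \<Longrightarrow> P \<Delta> (P \<Delta>' x) = P (\<Delta> \<inter> \<Delta>') x"
    and proj_sums: "range \<Delta>s \<subseteq> sets M \<Longrightarrow> disjoint_family \<Delta>s \<Longrightarrow>
          (\<lambda>i::nat. P (\<Delta>s i) x) sums P (\<Union>i. \<Delta>s i) x"
    and proj_space: "P (space M) x = x"
begin

lemma proj_idem: "\<Delta> \<in> sets M \<Longrightarrow> P \<Delta> (P \<Delta> x) = P \<Delta> x"
  using proj_Int[of \<Delta> \<Delta>] by simp

lemma proj_commute: "\<Delta> \<in> sets M \<Longrightarrow> \<Delta>' \<in> sets M \<Longrightarrow> P \<Delta> (P \<Delta>' x) = P \<Delta>' (P \<Delta> x)"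
  by (simp add: proj_Int Int_commute)

text \<open>Additivity over a sequence of empty sets makes a constant series converge, which forces
  its term to vanish.\<close>

lemma proj_empty: "P {} x = 0"
proof -
  have "(\<lambda>i::nat. P {} x) sums P (\<Union>i::nat. {}) x"
    by (rule proj_sums) (auto simp: disjoint_family_on_def)
  then have "(\<lambda>i::nat. P {} x) \<longlonglongrightarrow> 0" using summable_LIMSEQ_zero sums_summable by blast
  then show ?thesis by (simp add: LIMSEQ_const_iff)
qed

end

lemma projection_norm_le:
  assumes "\<And>x y. cinner (p x) y = cinner x (p y)" "\<And>x. p (p x) = p (x :: 'h::complex_inner)"
  shows "norm (p x) \<le> norm x"
proof -
  have "(norm (p x))\<^sup>2 = cmod (cinner (p x) (p x))" by (simp add: cinner_self norm_power)
  also have "\<dots> = cmod (cinner x (p x))" by (simp add: assms)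
  also have "\<dots> \<le> norm x * norm (p x)" by (rule cinner_Cauchy_Schwarz)
  finally show ?thesis by (cases "p x = 0") (auto simp: power2_eq_square)
qed

text \<open>Two candidates for the projection differ by an element of \<open>W\<close> that is
  orthogonal to itself. Closedness of \<open>W\<close> is replaced by exhibiting
  \<open>p\<close>.\<close>

lemma orth_proj_eqI:
  assumes W: "csubspace W" and p: "p \<in> W" "\<And>w. w \<in> W \<Longrightarrow> cinner w (\<phi> - p) = 0"
  shows "orth_proj W \<phi> = p"
  unfolding orth_proj_def
proof (rule the_equality)
  fix p' assume p': "p' \<in> W \<and> (\<forall>w\<in>W. cinner w (\<phi> - p') = 0)"
  then have d: "p' - p \<in> W" using W p complex_vector.subspace_diff by blast
  have "cinner (p' - p) (p' - p) = cinner (p' - p) (\<phi> - p) - cinner (p' - p) (\<phi> - p')"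
    by (simp add: cinner_diff_right)
  then have "cinner (p' - p) (p' - p) = 0" using d p p' by simp
  then show "p' = p" by simp
qed (use p in auto)

definition cut :: "'a set \<Rightarrow> ('a \<Rightarrow> 'k::zero) \<Rightarrow> 'a \<Rightarrow> 'k" where
  "cut \<Delta> x = (\<lambda>\<alpha>. if \<alpha> \<in> \<Delta> then x \<alpha> else 0)"

section \<open>Cutting sections down to measurable sets\<close>

context
  fixes \<mu> :: "'a measure" and Hf :: "'a \<Rightarrow> 'k::complex_hilbert set"
    and S :: "('a \<Rightarrow> 'k) set" and J :: "('a \<Rightarrow> 'k) \<Rightarrow> 'h::complex_hilbert"
  assumes di: "is_direct_integral \<mu> Hf S J"
begin

lemma section_closed:
  shows "x \<in> S \<Longrightarrow> y \<in> S \<Longrightarrow> (\<lambda>\<alpha>. x \<alpha> + y \<alpha>) \<in> S"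
    and "x \<in> S \<Longrightarrow> (\<lambda>\<alpha>. c *\<^sub>C x \<alpha>) \<in> S"
    and "x \<in> S \<Longrightarrow> y \<in> S \<Longrightarrow> (\<lambda>\<alpha>. x \<alpha> - y \<alpha>) \<in> S"
    and "x \<in> S \<Longrightarrow> (\<lambda>\<alpha>. norm (x \<alpha>)) \<in> borel_measurable \<mu>"
proof -
  show add: "x \<in> S \<Longrightarrow> y \<in> S \<Longrightarrow> (\<lambda>\<alpha>. x \<alpha> + y \<alpha>) \<in> S"
    and sc: "x \<in> S \<Longrightarrow> (\<lambda>\<alpha>. c *\<^sub>C x \<alpha>) \<in> S"
    and "x \<in> S \<Longrightarrow> (\<lambda>\<alpha>. norm (x \<alpha>)) \<in> borel_measurable \<mu>" for x y c
    using di unfolding is_direct_integral_def measurable_field_def by blast+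
  show "x \<in> S \<Longrightarrow> y \<in> S \<Longrightarrow> (\<lambda>\<alpha>. x \<alpha> - y \<alpha>) \<in> S"
    using add[of x "\<lambda>\<alpha>. (-1) *\<^sub>C y \<alpha>"] sc[of y "-1"] by (simp add: scaleC_minus_left)
qed

text \<open>A measurable field grants measurability of norms only; polarization recovers that of
  inner products.\<close>

lemma section_cinner_measurable:
  assumes x: "x \<in> S" and y: "y \<in> S"
  shows "(\<lambda>\<alpha>. cinner (x \<alpha>) (y \<alpha>)) \<in> borel_measurable \<mu>"
proof -
  define N :: "('a \<Rightarrow> 'k) \<Rightarrow> 'a \<Rightarrow> complex" where "N z \<alpha> = complex_of_real ((norm (z \<alpha>))\<^sup>2)" for z \<alpha>
  have [measurable]: "N z \<in> borel_measurable \<mu>" if "z \<in> S" for z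
    using section_closed(4)[OF that] unfolding N_def by measurable
  have S: "(\<lambda>\<alpha>. x \<alpha> + y \<alpha>) \<in> S" "(\<lambda>\<alpha>. x \<alpha> - y \<alpha>) \<in> S"
    "(\<lambda>\<alpha>. x \<alpha> + \<i> *\<^sub>C y \<alpha>) \<in> S" "(\<lambda>\<alpha>. x \<alpha> - \<i> *\<^sub>C y \<alpha>) \<in> S"
    using x y by (auto intro!: section_closed)
  have ses: "sesquilinear_on UNIV (cinner :: 'k \<Rightarrow> _)"
    using sesquilinear_operator[OF bounded_clinear_id] by simp
  have eq: "cinner (x \<alpha>) (y \<alpha>) = (N (\<lambda>\<alpha>. x \<alpha> + y \<alpha>) \<alpha> - N (\<lambda>\<alpha>. x \<alpha> - y \<alpha>) \<alpha>
      - \<i> * N (\<lambda>\<alpha>. x \<alpha> + \<i> *\<^sub>C y \<alpha>) \<alpha> + \<i> * N (\<lambda>\<alpha>. x \<alpha> - \<i> *\<^sub>C y \<alpha>) \<alpha>) / 4" for \<alpha>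
    using polarization[OF ses, of "x \<alpha>" "y \<alpha>"] unfolding N_def cinner_self[symmetric]
    by (simp add: field_simps)
  show ?thesis unfolding eq using S by measurable
qed

text \<open>Uses the maximality of \<open>S\<close>: vectors chosen in the fibres whose inner
  products with all sections are measurable form a section.\<close>

lemma cut_section:
  assumes x: "x \<in> S" and \<Delta>: "\<Delta> \<in> sets \<mu>"
  shows "cut \<Delta> x \<in> S"
proof -
  have "measurable_field \<mu> Hf S" using di unfolding is_direct_integral_def by simp
  then have "\<forall>\<alpha>. csubspace (Hf \<alpha>) \<and> closed (Hf \<alpha>)" and mf: "\<forall>x\<in>S. \<forall>\<alpha>. x \<alpha> \<in> Hf \<alpha>"
    "\<forall>y. (\<forall>\<alpha>. y \<alpha> \<in> Hf \<alpha>) \<and> (\<forall>x\<in>S. (\<lambda>\<alpha>. cinner (x \<alpha>) (y \<alpha>)) \<in> borel_measurable \<mu>) \<longrightarrow> y \<in> S"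
    unfolding measurable_field_def by - (elim conjE, assumption)+
  then have 0: "0 \<in> Hf \<alpha>" for \<alpha> using complex_vector.subspace_0 by metis
  show ?thesis
  proof (rule mp[OF spec[OF mf(2)]], rule conjI)
    show "\<forall>\<alpha>. cut \<Delta> x \<alpha> \<in> Hf \<alpha>"
      using mf(1) x 0 by (auto simp: cut_def)
    show "\<forall>y\<in>S. (\<lambda>\<alpha>. cinner (y \<alpha>) (cut \<Delta> x \<alpha>)) \<in> borel_measurable \<mu>"
    proof
      fix y assume "y \<in> S"
      then have [measurable]: "(\<lambda>\<alpha>. cinner (y \<alpha>) (x \<alpha>)) \<in> borel_measurable \<mu>"
        using section_cinner_measurable x by blast
      have "(\<lambda>\<alpha>. cinner (y \<alpha>) (cut \<Delta> x \<alpha>)) = (\<lambda>\<alpha>. if \<alpha> \<in> \<Delta> then cinner (y \<alpha>) (x \<alpha>) else 0)"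
        by (auto simp: cut_def)
      then show "(\<lambda>\<alpha>. cinner (y \<alpha>) (cut \<Delta> x \<alpha>)) \<in> borel_measurable \<mu>" using \<Delta> by simp
    qed
  qed
qed

lemma cut_L2:
  assumes x: "x \<in> L2_sections \<mu> S" and \<Delta>: "\<Delta> \<in> sets \<mu>"
  shows "cut \<Delta> x \<in> L2_sections \<mu> S"
proof -
  have eq: "(\<lambda>\<alpha>. (norm (cut \<Delta> x \<alpha>))\<^sup>2) = (\<lambda>\<alpha>. indicator \<Delta> \<alpha> *\<^sub>R (norm (x \<alpha>))\<^sup>2)"
    by (auto simp: cut_def)
  have "integrable \<mu> (\<lambda>\<alpha>. (norm (cut \<Delta> x \<alpha>))\<^sup>2)"
    unfolding eq by (rule integrable_mult_indicator[OF \<Delta>]) (use x in \<open>simp add: L2_sections_def\<close>)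
  then show ?thesis using x cut_section[OF _ \<Delta>] by (simp add: L2_sections_def)
qed

lemma L2_add:
  assumes x: "x \<in> L2_sections \<mu> S" and y: "y \<in> L2_sections \<mu> S"
  shows "(\<lambda>\<alpha>. x \<alpha> + y \<alpha>) \<in> L2_sections \<mu> S"
proof -
  have S: "x \<in> S" "y \<in> S" using x y by (auto simp: L2_sections_def)
  note [measurable] = section_closed(4)[OF section_closed(1)[OF S]]
  have "integrable \<mu> (\<lambda>\<alpha>. (norm (x \<alpha> + y \<alpha>))\<^sup>2)"
  proof (rule Bochner_Integration.integrable_bound)
    show "integrable \<mu> (\<lambda>\<alpha>. 2 * (norm (x \<alpha>))\<^sup>2 + 2 * (norm (y \<alpha>))\<^sup>2)"
      using x y by (auto simp: L2_sections_def)
    have "(norm (a + b))\<^sup>2 \<le> 2 * (norm a)\<^sup>2 + 2 * (norm b)\<^sup>2" for a b :: 'k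
    proof -
      have "(norm (a + b))\<^sup>2 + (norm (a - b))\<^sup>2 = 2 * (norm a)\<^sup>2 + 2 * (norm b)\<^sup>2"
        by (simp add: power2_norm_eq_inner inner_diff inner_add inner_commute)
      then show ?thesis by (smt (verit) zero_le_power2)
    qed
    then show "AE \<alpha> in \<mu>. norm ((norm (x \<alpha> + y \<alpha>))\<^sup>2) \<le> norm (2 * (norm (x \<alpha>))\<^sup>2 + 2 * (norm (y \<alpha>))\<^sup>2)"
      by auto
  qed measurable
  then show ?thesis using S section_closed(1) by (auto simp: L2_sections_def)
qed

lemma L2_scaleC: "x \<in> L2_sections \<mu> S \<Longrightarrow> (\<lambda>\<alpha>. c *\<^sub>C x \<alpha>) \<in> L2_sections \<mu> S"
  by (auto simp: L2_sections_def section_closed norm_scaleC power_mult_distrib)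

lemma L2_diff:
  "x \<in> L2_sections \<mu> S \<Longrightarrow> y \<in> L2_sections \<mu> S \<Longrightarrow> (\<lambda>\<alpha>. x \<alpha> - y \<alpha>) \<in> L2_sections \<mu> S"
  using L2_add[of x "\<lambda>\<alpha>. (-1) *\<^sub>C y \<alpha>"] L2_scaleC[of y "-1"] by (simp add: scaleC_minus_left)

lemma J_rules:
  shows "x \<in> L2_sections \<mu> S \<Longrightarrow> y \<in> L2_sections \<mu> S \<Longrightarrow> J (\<lambda>\<alpha>. x \<alpha> + y \<alpha>) = J x + J y"
    and "x \<in> L2_sections \<mu> S \<Longrightarrow> J (\<lambda>\<alpha>. c *\<^sub>C x \<alpha>) = c *\<^sub>C J x"
    and "x \<in> L2_sections \<mu> S \<Longrightarrow> y \<in> L2_sections \<mu> S \<Longrightarrow> J (\<lambda>\<alpha>. x \<alpha> - y \<alpha>) = J x - J y"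
    and "x \<in> L2_sections \<mu> S \<Longrightarrow> y \<in> L2_sections \<mu> S \<Longrightarrow>
      cinner (J x) (J y) = (\<integral>\<alpha>. cinner (x \<alpha>) (y \<alpha>) \<partial>\<mu>)"
    and "J ` L2_sections \<mu> S = UNIV"
proof -
  show add: "x \<in> L2_sections \<mu> S \<Longrightarrow> y \<in> L2_sections \<mu> S \<Longrightarrow> J (\<lambda>\<alpha>. x \<alpha> + y \<alpha>) = J x + J y"
    and sc: "x \<in> L2_sections \<mu> S \<Longrightarrow> J (\<lambda>\<alpha>. c *\<^sub>C x \<alpha>) = c *\<^sub>C J x"
    and "x \<in> L2_sections \<mu> S \<Longrightarrow> y \<in> L2_sections \<mu> S \<Longrightarrow>
      cinner (J x) (J y) = (\<integral>\<alpha>. cinner (x \<alpha>) (y \<alpha>) \<partial>\<mu>)"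
    and "J ` L2_sections \<mu> S = UNIV" for x y c
    using di unfolding is_direct_integral_def by blast+
  show "x \<in> L2_sections \<mu> S \<Longrightarrow> y \<in> L2_sections \<mu> S \<Longrightarrow> J (\<lambda>\<alpha>. x \<alpha> - y \<alpha>) = J x - J y"
    using add[of x "\<lambda>\<alpha>. (-1) *\<^sub>C y \<alpha>"] L2_scaleC[of y "-1"] sc[of y "-1"]
    by (simp add: scaleC_minus_left)
qed

text \<open>The remainder \<open>x - cut \<Delta> x\<close> vanishes on \<open>\<Delta>\<close> and
  the sections spanning the range vanish off \<open>\<Delta>\<close>, so the integrand of their
  inner product is zero at every point.\<close>

lemma dint_proj_J:
  assumes x: "x \<in> L2_sections \<mu> S" and \<Delta>: "\<Delta> \<in> sets \<mu>"
  shows "dint_proj \<mu> S J \<Delta> (J x) = J (cut \<Delta> x)"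
  unfolding dint_proj_def
proof (rule orth_proj_eqI)
  let ?W = "{x\<in>L2_sections \<mu> S. \<forall>\<alpha>. \<alpha> \<notin> \<Delta> \<longrightarrow> x \<alpha> = 0}"
  have 0: "(\<lambda>\<alpha>. 0) \<in> ?W" using L2_scaleC[OF x, of 0] by simp
  show "csubspace (J ` ?W)"
  proof (rule complex_vector.subspaceI)
    have "J (\<lambda>\<alpha>. 0) = 0" using J_rules(2)[OF x, of 0] by simp
    then show "0 \<in> J ` ?W" using 0 by (metis (no_types, lifting) imageI)
  next
    fix u v assume "u \<in> J ` ?W" "v \<in> J ` ?W"
    then obtain a b where "u = J a" "v = J b" "a \<in> ?W" "b \<in> ?W" by auto
    then show "u + v \<in> J ` ?W"
      by (intro image_eqI[of _ _ "\<lambda>\<alpha>. a \<alpha> + b \<alpha>"]) (auto simp: J_rules L2_add)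
  next
    fix c u assume "u \<in> J ` ?W"
    then obtain a where "u = J a" "a \<in> ?W" by auto
    then show "c *\<^sub>C u \<in> J ` ?W"
      by (intro image_eqI[of _ _ "\<lambda>\<alpha>. c *\<^sub>C a \<alpha>"]) (auto simp: J_rules L2_scaleC)
  qed
  show "J (cut \<Delta> x) \<in> J ` ?W"
    using cut_L2[OF x \<Delta>] by (auto simp: cut_def)
  show "cinner w (J x - J (cut \<Delta> x)) = 0" if "w \<in> J ` ?W" for w
  proof -
    obtain y where y: "w = J y" "y \<in> L2_sections \<mu> S" "\<And>\<alpha>. \<alpha> \<notin> \<Delta> \<Longrightarrow> y \<alpha> = 0" using \<open>w \<in> J ` ?W\<close> by auto
    have "cinner w (J x - J (cut \<Delta> x)) = (\<integral>\<alpha>. cinner (y \<alpha>) (x \<alpha> - cut \<Delta> x \<alpha>) \<partial>\<mu>)"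
      using y cut_L2[OF x \<Delta>] x by (simp add: J_rules(4) L2_diff flip: J_rules(3))
    also have "(\<lambda>\<alpha>. cinner (y \<alpha>) (x \<alpha> - cut \<Delta> x \<alpha>)) = (\<lambda>\<alpha>. 0)"
      using y(3) by (auto simp: cut_def fun_eq_iff)
    finally show ?thesis by simp
  qed
qed

text \<open>The bridge from the projections to the centre, which is described through multiplication
  operators.\<close>

lemma mult_op_indicator:
  assumes "\<Delta> \<in> sets \<mu>"
  shows "mult_op \<mu> S J (indicator \<Delta>) = dint_proj \<mu> S J \<Delta>"
proof
  fix \<phi>
  have \<phi>: "inv_into (L2_sections \<mu> S) J \<phi> \<in> L2_sections \<mu> S" "J (inv_into (L2_sections \<mu> S) J \<phi>) = \<phi>"
    by (auto simp: J_rules(5) inv_into_into f_inv_into_f)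
  have "mult_op \<mu> S J (indicator \<Delta>) \<phi> = J (cut \<Delta> (inv_into (L2_sections \<mu> S) J \<phi>))"
    unfolding mult_op_def by (rule arg_cong[of _ _ J]) (auto simp: cut_def indicator_def)
  then show "mult_op \<mu> S J (indicator \<Delta>) \<phi> = dint_proj \<mu> S J \<Delta> \<phi>"
    using dint_proj_J[OF \<phi>(1) assms] \<phi>(2) by simp
qed

lemma dint_proj_symmetric:
  assumes \<Delta>: "\<Delta> \<in> sets \<mu>"
  shows "cinner (dint_proj \<mu> S J \<Delta> u) v = cinner u (dint_proj \<mu> S J \<Delta> v)"
proof -
  obtain x y where xy: "x \<in> L2_sections \<mu> S" "u = J x" "y \<in> L2_sections \<mu> S" "v = J y"
    using J_rules(5) by (metis UNIV_I imageE)
  have "(\<lambda>\<alpha>. cinner (cut \<Delta> x \<alpha>) (y \<alpha>)) = (\<lambda>\<alpha>. cinner (x \<alpha>) (cut \<Delta> y \<alpha>))"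
    by (auto simp: cut_def)
  then show ?thesis using xy \<Delta> by (simp add: dint_proj_J J_rules(4) cut_L2)
qed

text \<open>Linearity and boundedness enter as a hypothesis because membership in the centre
  supplies them.\<close>

lemma dint_proj_projection_system:
  assumes bc: "\<And>\<Delta>. \<Delta> \<in> sets \<mu> \<Longrightarrow> bounded_clinear (dint_proj \<mu> S J \<Delta>)"
  shows "projection_system \<mu> (dint_proj \<mu> S J)"
proof
  have ex: "\<exists>x. x \<in> L2_sections \<mu> S \<and> u = J x" for u using J_rules(5) by (metis UNIV_I imageE)
  show Int: "dint_proj \<mu> S J \<Delta> (dint_proj \<mu> S J \<Delta>' u) = dint_proj \<mu> S J (\<Delta> \<inter> \<Delta>') u"
    if "\<Delta> \<in> sets \<mu>" "\<Delta>' \<in> sets \<mu>" for \<Delta> \<Delta>' u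
  proof -
    obtain x where x: "x \<in> L2_sections \<mu> S" "u = J x" using ex by blast
    have "cut \<Delta> (cut \<Delta>' x) = cut (\<Delta> \<inter> \<Delta>') x" by (auto simp: cut_def)
    then show ?thesis using x that by (simp add: dint_proj_J cut_L2)
  qed
  show "dint_proj \<mu> S J (space \<mu>) u = u" for u
  proof -
    obtain x where x: "x \<in> L2_sections \<mu> S" "u = J x" using ex by blast
    \<comment> \<open>A section may be nonzero outside \<open>space \<mu>\<close>, where the
      integral does not see it; so the difference is mapped to zero by \<open>J\<close> without
      having to be zero.\<close>
    define d where "d = (\<lambda>\<alpha>. x \<alpha> - cut (space \<mu>) x \<alpha>)"
    have d: "d \<in> L2_sections \<mu> S" unfolding d_def using x by (intro L2_diff cut_L2) auto
    have "cinner (J d) (J d) = (\<integral>\<alpha>. 0 \<partial>\<mu>)"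
      unfolding J_rules(4)[OF d d] by (rule Bochner_Integration.integral_cong) (auto simp: d_def cut_def)
    then have "J d = 0" by simp
    then have "J x = J (cut (space \<mu>) x)" using x unfolding d_def by (simp add: J_rules(3) cut_L2)
    then show ?thesis unfolding x(2) using dint_proj_J[OF x(1)] by simp
  qed
  show "(\<lambda>i. dint_proj \<mu> S J (\<Delta>s i) u) sums dint_proj \<mu> S J (\<Union>i. \<Delta>s i) u"
    if \<Delta>s: "range \<Delta>s \<subseteq> sets \<mu>" and disj: "disjoint_family \<Delta>s" for \<Delta>s :: "nat \<Rightarrow> _" and u
  proof -
    obtain x where x: "x \<in> L2_sections \<mu> S" "u = J x" using ex by blast
    note [measurable] = section_closed(4)[of x]
    have [simp]: "\<Delta>s i \<in> sets \<mu>" for i using \<Delta>s by auto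
    have [simp]: "(\<Union>i. \<Delta>s i) \<in> sets \<mu>" using \<Delta>s by (intro sets.countable_nat_UN)
    \<comment> \<open>With squared norms given by integrals over sets, the criterion
      \<open>orthogonal_sums_iff_norm\<close> becomes countable additivity of an integral.\<close>
    have nrm: "(norm (dint_proj \<mu> S J \<Delta> u))\<^sup>2 = (LINT \<alpha>:\<Delta>|\<mu>. (norm (x \<alpha>))\<^sup>2)" if \<Delta>: "\<Delta> \<in> sets \<mu>" for \<Delta>
    proof -
      have "complex_of_real ((norm (dint_proj \<mu> S J \<Delta> u))\<^sup>2) = (\<integral>\<alpha>. cinner (cut \<Delta> x \<alpha>) (cut \<Delta> x \<alpha>) \<partial>\<mu>)"
        unfolding cinner_self[symmetric, where x = "dint_proj \<mu> S J \<Delta> u"]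
        using x \<Delta> by (simp add: dint_proj_J J_rules(4) cut_L2)
      also have "\<dots> = (\<integral>\<alpha>. complex_of_real (indicator \<Delta> \<alpha> *\<^sub>R (norm (x \<alpha>))\<^sup>2) \<partial>\<mu>)"
        by (rule Bochner_Integration.integral_cong) (auto simp: cut_def cinner_self)
      also have "\<dots> = complex_of_real (LINT \<alpha>:\<Delta>|\<mu>. (norm (x \<alpha>))\<^sup>2)"
        unfolding set_lebesgue_integral_def by (rule integral_complex_of_real)
      finally show ?thesis using of_real_eq_iff by blast
    qed
    \<comment> \<open>\<open>proj_empty\<close> presupposes the additivity that is being proved, so
      the value is computed from the zero section.\<close>
    have emp: "dint_proj \<mu> S J {} w = 0" for w
    proof -
      obtain y where y: "y \<in> L2_sections \<mu> S" "w = J y" using ex by blast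
      have "cut {} y = (\<lambda>\<alpha>. 0 *\<^sub>C y \<alpha>)" by (auto simp: cut_def)
      then show ?thesis using y J_rules(2)[OF y(1), of 0] by (simp add: dint_proj_J)
    qed
    show ?thesis
    proof (subst orthogonal_sums_iff_norm)
      show "cinner (dint_proj \<mu> S J (\<Delta>s i) u) (dint_proj \<mu> S J (\<Delta>s j) u) = 0" if "i \<noteq> j" for i j
        using disj that by (simp add: dint_proj_symmetric Int disjoint_family_on_def emp)
      show "cinner (dint_proj \<mu> S J (\<Delta>s i) u) (dint_proj \<mu> S J (\<Union>i. \<Delta>s i) u) =
        cinner (dint_proj \<mu> S J (\<Delta>s i) u) (dint_proj \<mu> S J (\<Delta>s i) u)" for i
      proof -
        have "\<Delta>s i \<inter> (\<Union>i. \<Delta>s i) = \<Delta>s i" by auto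
        then show ?thesis by (simp add: dint_proj_symmetric Int)
      qed
      have "set_integrable \<mu> (\<Union>i. \<Delta>s i) (\<lambda>\<alpha>. (norm (x \<alpha>))\<^sup>2)"
        unfolding set_integrable_def
        using x by (intro integrable_mult_indicator) (auto simp: L2_sections_def)
      then have int: "set_integrable \<mu> A (\<lambda>\<alpha>. (norm (x \<alpha>))\<^sup>2)"
        if "A \<in> sets \<mu>" "A \<subseteq> (\<Union>i. \<Delta>s i)" for A
        using that set_integrable_subset by blast
      have UN: "(\<Union>n. \<Union>i<n. \<Delta>s i) = (\<Union>i. \<Delta>s i)" by auto
      have "(\<lambda>n. LINT \<alpha>:(\<Union>i<n. \<Delta>s i)|\<mu>. (norm (x \<alpha>))\<^sup>2)
          \<longlonglongrightarrow> (LINT \<alpha>:(\<Union>n. \<Union>i<n. \<Delta>s i)|\<mu>. (norm (x \<alpha>))\<^sup>2)"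
        by (rule set_integral_cont_up) (auto simp: incseq_def UN intro!: int less_le_trans)
      moreover have "(LINT \<alpha>:(\<Union>i<n. \<Delta>s i)|\<mu>. (norm (x \<alpha>))\<^sup>2) = (\<Sum>i<n. LINT \<alpha>:\<Delta>s i|\<mu>. (norm (x \<alpha>))\<^sup>2)" for n
        using disj by (intro set_integral_finite_Union int) (auto simp: disjoint_family_on_def)
      ultimately have "(\<lambda>i. LINT \<alpha>:\<Delta>s i|\<mu>. (norm (x \<alpha>))\<^sup>2) sums (LINT \<alpha>:(\<Union>i. \<Delta>s i)|\<mu>. (norm (x \<alpha>))\<^sup>2)"
        unfolding sums_def UN by simp
      then show "(\<lambda>i. (norm (dint_proj \<mu> S J (\<Delta>s i) u))\<^sup>2) sums (norm (dint_proj \<mu> S J (\<Union>i. \<Delta>s i) u))\<^sup>2"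
        by (simp add: nrm)
    qed
  qed
qed (use bc dint_proj_symmetric in auto)

end

section \<open>Invariant forms and the commutant\<close>

lemma unitary_bounded_clinear:
  assumes "unitary_rep UNIV V" shows "bounded_clinear (V g)"
proof -
  have lin: "clinear_on UNIV (V g)" and iso: "\<And>x y. cinner (V g x) (V g y) = cinner x y"
    using assms unfolding unitary_rep_def by auto
  have "norm (V g x) = norm x" for x
  proof -
    have "complex_of_real ((norm (V g x))\<^sup>2) = complex_of_real ((norm x)\<^sup>2)"
      using iso[of x x] unfolding cinner_self .
    then have "(norm (V g x))\<^sup>2 = (norm x)\<^sup>2" using of_real_eq_iff by blast
    then show ?thesis by (simp add: power2_eq_iff_nonneg)
  qed
  then have "bounded_linear (V g)"
    using lin by (intro bounded_linear_intro[of _ 1]) (auto simp: clinear_on_def simp flip: scaleC_of_real)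
  then show ?thesis using lin by (simp add: bounded_clinear_def)
qed

lemma vN_centre_bounded_clinear: "A \<in> vN_centre V \<Longrightarrow> bounded_clinear A"
  unfolding vN_centre_def commutant_def by auto

lemma vN_centre_commutes:
  assumes "unitary_rep UNIV V" "A \<in> vN_centre V"
  shows "A \<circ> V g = V g \<circ> A"
proof -
  have "V g \<in> vN_generated V"
    unfolding vN_generated_def commutant_def using unitary_bounded_clinear[OF assms(1)] by auto
  then show ?thesis using assms(2) unfolding vN_centre_def commutant_def by auto
qed

lemma dint_proj_in_centre:
  assumes "central_decomposition \<mu> Hf S J V Vf" "\<Delta> \<in> sets \<mu>"
  shows "dint_proj \<mu> S J \<Delta> \<in> vN_centre V"
proof -
  have di: "is_direct_integral \<mu> Hf S J" and c: "mult_op \<mu> S J ` Linf \<mu> = vN_centre V"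
    using assms(1) unfolding central_decomposition_def by auto
  have "(indicator \<Delta> :: _ \<Rightarrow> complex) \<in> Linf \<mu>"
    using assms(2) by (auto simp: Linf_def intro!: exI[of _ 1] AE_I2 split: split_indicator)
  then have "mult_op \<mu> S J (indicator \<Delta>) \<in> vN_centre V" unfolding c[symmetric] by (rule imageI)
  then show ?thesis using mult_op_indicator[OF di assms(2)] by simp
qed

text \<open>Here \<open>p\<close> plays the role of a projection onto a set of finite measure.
  Compressing by \<open>p\<close> gives a form that is bounded on all of \<open>D\<close>, and since
  \<open>p\<close> commutes with \<open>V g\<close>, the compressed form inherits the invariance; as
  \<open>V g\<close> is unitary, this is commutation of its operator with
  \<open>V g\<close>.\<close>

lemma invariant_form_operator:
  fixes V :: "'g::topological_group_add \<Rightarrow> 'h::complex_hilbert \<Rightarrow> 'h"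
  assumes Q: "hermitian_form Q D" and V: "unitary_rep UNIV V"
    and p: "bounded_clinear p" "\<And>x y. cinner (p x) y = cinner x (p y)" "\<And>x. p (p x) = p x"
    and pD: "\<And>x. x \<in> D \<Longrightarrow> p x \<in> D"
    and pV: "\<And>g x. p (V g x) = V g (p x)"
    and bd: "\<And>x. x \<in> D \<Longrightarrow> cmod (Q (p x) (p x)) \<le> C * (norm (p x))\<^sup>2" and C: "0 \<le> C"
    and inv: "\<And>g. V g ` D = D" "\<And>g x. x \<in> D \<Longrightarrow> Q (V g x) (V g x) = Q x x"
  obtains T where "bounded_clinear T" "\<And>x y. cinner (T x) y = cinner x (T y)"
    "\<And>x y. x \<in> D \<Longrightarrow> y \<in> D \<Longrightarrow> cinner x (T y) = Q (p x) (p y)" "T \<in> commutant (range V)"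
proof -
  note * = sesquilinear_onD[OF hermitian_form_sesquilinear[OF Q]]
  have dense: "closure D = UNIV" and herm: "\<And>x y. x \<in> D \<Longrightarrow> y \<in> D \<Longrightarrow> Q x y = cnj (Q y x)"
    using Q unfolding hermitian_form_def by blast+
  have h: "hermitian_form (\<lambda>x y. Q (p x) (p y)) D"
    unfolding hermitian_form_def
    by (intro conjI ballI allI *(1) dense)
      (simp_all add: *(2,4) pD bounded_clinearD[OF p(1)], rule herm, simp_all add: pD)
  obtain T where T: "bounded_clinear T" "\<And>x y. cinner (T x) y = cinner x (T y)"
    "\<And>x y. x \<in> D \<Longrightarrow> y \<in> D \<Longrightarrow> cinner x (T y) = Q (p x) (p y)"
  proof (rule bounded_form_operator[OF h, of C])
    fix x assume x: "x \<in> D"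
    have "norm (p x) \<le> norm x" using p(2,3) by (rule projection_norm_le)
    then show "cmod (Q (p x) (p x)) \<le> C * (norm x)\<^sup>2"
      using bd[OF x] C by (meson mult_left_mono norm_ge_zero order_trans power_mono)
  qed auto
  have Vb: "bounded_clinear (V g)" and iso: "cinner (V g x) (V g y) = cinner x y" for g x y
    using V unitary_bounded_clinear[OF V] unfolding unitary_rep_def by auto
  have VD: "x \<in> D \<Longrightarrow> V g x \<in> D" for g x using inv(1)[of g] by auto
  have "V g \<circ> T = T \<circ> V g" for g
  proof -
    \<comment> \<open>Invariance is assumed on the diagonal; both sides are sesquilinear, so
      polarization extends it.\<close>
    have inv2: "Q (V g x) (V g y) = Q x y" if "x \<in> D" "y \<in> D" for x y
    proof (rule sesquilinear_eqI[of D "\<lambda>x y. Q (V g x) (V g y)" Q])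
      show "sesquilinear_on D (\<lambda>x y. Q (V g x) (V g y))"
        unfolding sesquilinear_on_def using * VD by (simp add: bounded_clinearD[OF Vb])
    qed (use hermitian_form_sesquilinear[OF Q] inv that in auto)
    have "(V g \<circ> T) y = (T \<circ> V g) y" if y: "y \<in> D" for y
    proof (rule dense_cinner_eqI[OF dense])
      fix w assume "w \<in> D"
      \<comment> \<open>Since \<open>V g\<close> maps \<open>D\<close> onto \<open>D\<close>, every
        test vector has this form, and \<open>V g\<close> can be cancelled on both sides.\<close>
      then obtain x where x: "x \<in> D" "w = V g x" using inv(1)[of g] by auto
      have "cinner w ((T \<circ> V g) y) = Q (p (V g x)) (p (V g y))" using x y VD by (simp add: T)
      also have "\<dots> = Q (p x) (p y)" using x y by (simp add: pV inv2 pD)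
      also have "\<dots> = cinner w ((V g \<circ> T) y)" using x y by (simp add: T iso)
      finally show "cinner w ((V g \<circ> T) y) = cinner w ((T \<circ> V g) y)" by simp
    qed
    from dense_operator_eqI[OF dense bounded_clinearD(1)[OF bounded_clinear_compose[OF Vb T(1)]]
        bounded_clinearD(1)[OF bounded_clinear_compose[OF T(1) Vb]] this]
    show ?thesis by (rule ext)
  qed
  then have "T \<in> commutant (range V)" using T(1) by (auto simp: commutant_def)
  then show ?thesis using that T by blast
qed

section \<open>The Hausdorff moment problem\<close>

definition falling :: "nat \<Rightarrow> real \<Rightarrow> real" where
  "falling j x = (\<Prod>i<j. x - real i)"

lemma falling_Suc: "x * falling j x = falling (Suc j) x + real j * falling j x"
  by (simp add: falling_def algebra_simps)

lemma falling_binomial: "falling j (real k) = fact j * real (k choose j)"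
  by (simp add: falling_def binomial_gbinomial gbinomial_prod_rev lessThan_atLeast0)

lemma falling_asymp: "(\<lambda>m. falling j (real (Suc m)) / real (Suc m) ^ j) \<longlonglongrightarrow> 1"
proof (induction j)
  case (Suc j)
  have "(\<lambda>m. 1 - real j * (1 / real (Suc m))) \<longlonglongrightarrow> 1 - real j * 0"
    using LIMSEQ_Suc[OF lim_1_over_n] by (intro tendsto_intros)
  from tendsto_mult[OF Suc this]
  have "(\<lambda>m. falling j (real (Suc m)) / real (Suc m) ^ j * (1 - real j * (1 / real (Suc m)))) \<longlonglongrightarrow> 1"
    by simp
  moreover have "falling j (real (Suc m)) / real (Suc m) ^ j * (1 - real j * (1 / real (Suc m)))
      = falling (Suc j) (real (Suc m)) / real (Suc m) ^ Suc j" for m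
  proof -
    have "1 - real j * (1 / real (Suc m)) = (real (Suc m) - real j) / real (Suc m)"
      by (simp add: diff_divide_distrib)
    then show ?thesis by (simp add: falling_def)
  qed
  ultimately show ?case by simp
qed (simp add: falling_def)

text \<open>The factorial moments of a binomial distribution as an identity of polynomials:
  \<open>(m choose k) * (k choose j)\<close> equals
  \<open>(m choose j) * ((m - j) choose (k - j))\<close>, and the binomial theorem sums the rest.
  The ring is general because \<open>a\<close> and \<open>b\<close> will be the polynomials
  \<open>X\<close> and \<open>1 - X\<close>.\<close>

lemma binomial_factorial_moment:
  fixes a b :: "'a::comm_ring_1"
  shows "(\<Sum>k\<le>m. of_nat (m choose k) * of_nat (k choose j) * a ^ k * b ^ (m - k))
    = of_nat (m choose j) * a ^ j * (a + b) ^ (m - j)"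
proof (cases "j \<le> m")
  case True
  have "(\<Sum>k\<le>m. of_nat (m choose k) * of_nat (k choose j) * a ^ k * b ^ (m - k))
      = (\<Sum>k\<in>{j..m}. of_nat (m choose k) * of_nat (k choose j) * a ^ k * b ^ (m - k))"
    by (rule sum.mono_neutral_right) (auto simp: binomial_eq_0)
  also have "\<dots> = (\<Sum>i\<le>m - j. of_nat (m choose (i + j)) * of_nat ((i + j) choose j) * a ^ (i + j) * b ^ (m - (i + j)))"
    by (rule sum.reindex_bij_witness[of _ "\<lambda>i. i + j" "\<lambda>k. k - j"]) (use True in auto)
  also have "\<dots> = (\<Sum>i\<le>m - j. of_nat (m choose j) * a ^ j * (of_nat ((m - j) choose i) * a ^ i * b ^ (m - j - i)))"
  proof (rule sum.cong)
    fix i assume "i \<in> {..m - j}"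
    then have "(m choose (i + j)) * ((i + j) choose j) = (m choose j) * ((m - j) choose i)"
      using choose_mult[of j "i + j" m] True by auto
    then have "(of_nat (m choose (i + j)) * of_nat ((i + j) choose j) :: 'a) = of_nat (m choose j) * of_nat ((m - j) choose i)"
      by (metis of_nat_mult)
    then show "of_nat (m choose (i + j)) * of_nat ((i + j) choose j) * a ^ (i + j) * b ^ (m - (i + j))
        = of_nat (m choose j) * a ^ j * (of_nat ((m - j) choose i) * a ^ i * b ^ (m - j - i))"
      by (simp add: power_add mult_ac diff_diff_add add.commute[of j i])
  qed simp
  also have "\<dots> = of_nat (m choose j) * a ^ j * (a + b) ^ (m - j)"
    unfolding binomial_ring[of a b] by (simp add: sum_distrib_left)
  finally show ?thesis .
next
  case False
  then have "(k choose j) = 0" if "k \<le> m" for k using that by (simp add: binomial_eq_0)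
  then show ?thesis using False by (simp add: binomial_eq_0)
qed

text \<open>\<open>L_nonneg\<close> is Hausdorff's condition of complete monotonicity, with
  \<open>[:0, 1:]\<close> for \<open>X\<close> and \<open>[:1, - 1:]\<close> for
  \<open>1 - X\<close>; \<open>L_one\<close> normalises the representing measure to a
  probability.\<close>

locale positive_functional =
  fixes L :: "real poly \<Rightarrow> real"
  assumes L_add: "L (p + q) = L p + L q"
    and L_smult: "L (smult c p) = c * L p"
    and L_nonneg: "0 \<le> L ([:0, 1:] ^ k * [:1, - 1:] ^ m)"
    and L_one: "L 1 = 1"
begin

lemma L_sum: "L (\<Sum>i\<in>I. f i) = (\<Sum>i\<in>I. L (f i))"
proof -
  have "L 0 = 0" using L_smult[of 0 0] by simp
  then show ?thesis by (induction I rule: infinite_finite_induct) (auto simp: L_add)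
qed

lemma L_of_nat_mult: "L (of_nat n * p) = real n * L p"
  using L_smult[of "real n" p] by (simp add: of_nat_poly)

lemma L_altdef: "L p = (\<Sum>i\<le>degree p. coeff p i * L ([:0, 1:] ^ i))"
proof -
  have "L p = L (\<Sum>i\<le>degree p. smult (coeff p i) ([:0, 1:] ^ i))"
    by (simp add: poly_as_sum_of_monoms flip: monom_altdef)
  then show ?thesis by (simp add: L_sum L_smult)
qed

text \<open>\<open>L\<close> of a Bernstein basis polynomial: the mass that the \<open>m\<close>-th
  approximating measure puts on the node \<open>k / m\<close>.\<close>

definition weight :: "nat \<Rightarrow> nat \<Rightarrow> real" where
  "weight m k = L (of_nat (m choose k) * ([:0, 1:] ^ k * [:1, - 1:] ^ (m - k)))"

lemma weight_nonneg: "0 \<le> weight m k"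
  by (simp add: weight_def L_of_nat_mult L_nonneg)

text \<open>The factorial moment identity at \<open>X\<close> and \<open>1 - X\<close>; these add up
  to 1, so the remaining power disappears.\<close>

lemma weight_binomial: "(\<Sum>k\<le>m. weight m k * real (k choose j)) = real (m choose j) * L ([:0, 1:] ^ j)"
proof -
  have "(\<Sum>k\<le>m. weight m k * real (k choose j))
      = L (\<Sum>k\<le>m. of_nat (m choose k) * of_nat (k choose j) * [:0, 1:] ^ k * [:1, - 1:] ^ (m - k))"
    unfolding L_sum by (simp add: weight_def L_of_nat_mult mult.assoc mult.left_commute mult.commute)
  also have "\<dots> = L (of_nat (m choose j) * [:0, 1:] ^ j * ([:0, 1:] + [:1, - 1:]) ^ (m - j))"
    by (simp only: binomial_factorial_moment)
  also have "[:0, 1:] + [:1, - 1:] = (1 :: real poly)" by (simp add: one_pCons)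
  finally show ?thesis by (simp add: L_of_nat_mult)
qed

lemma weight_sum: "(\<Sum>k\<le>m. weight m k) = 1"
  using weight_binomial[of m 0] by (simp add: L_one)

text \<open>
  Falling factorials have exact moments under the Bernstein weights; trading one factor of the
  power for a falling factor costs a term of order \<open>1 / m\<close>.
\<close>

lemma weight_moments_falling:
  "(\<lambda>m. (\<Sum>k\<le>Suc m. weight (Suc m) k * (real k ^ a * falling j (real k))) / real (Suc m) ^ (a + j))
     \<longlonglongrightarrow> L ([:0, 1:] ^ (a + j))"
proof (induction a arbitrary: j)
  case 0
  have eq: "(\<Sum>k\<le>m. weight m k * falling j (real k)) = falling j (real m) * L ([:0, 1:] ^ j)" for m
    using weight_binomial[of m j] by (simp add: falling_binomial sum_distrib_left mult_ac)
      (metis (no_types, lifting) sum_distrib_left mult.left_commute sum.cong)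
  have "(\<lambda>m. falling j (real (Suc m)) / real (Suc m) ^ j * L ([:0, 1:] ^ j)) \<longlonglongrightarrow> 1 * L ([:0, 1:] ^ j)"
    by (intro tendsto_mult falling_asymp tendsto_const)
  then show ?case by (simp add: eq del: sum.atMost_Suc of_nat_Suc)
next
  case (Suc a)
  let ?E = "\<lambda>m f. \<Sum>k\<le>Suc m. weight (Suc m) k * f (real k)"
  have split: "?E m (\<lambda>x. x ^ Suc a * falling j x) / real (Suc m) ^ (Suc a + j)
      = ?E m (\<lambda>x. x ^ a * falling (Suc j) x) / real (Suc m) ^ (a + Suc j)
        + real j * (1 / real (Suc m)) * (?E m (\<lambda>x. x ^ a * falling j x) / real (Suc m) ^ (a + j))" for m
  proof -
    have "x ^ Suc a * falling j x = x ^ a * falling (Suc j) x + real j * (x ^ a * falling j x)" for x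
      by (simp only: power_Suc2 mult.assoc falling_Suc) (simp add: algebra_simps)
    then have "?E m (\<lambda>x. x ^ Suc a * falling j x)
        = ?E m (\<lambda>x. x ^ a * falling (Suc j) x) + real j * ?E m (\<lambda>x. x ^ a * falling j x)"
      unfolding sum_distrib_left sum.distrib[symmetric]
      by (intro sum.cong refl) (simp add: algebra_simps)
    then show ?thesis by (simp add: add_divide_distrib del: sum.atMost_Suc of_nat_Suc)
  qed
  have "(\<lambda>m. ?E m (\<lambda>x. x ^ a * falling (Suc j) x) / real (Suc m) ^ (a + Suc j)
        + real j * (1 / real (Suc m)) * (?E m (\<lambda>x. x ^ a * falling j x) / real (Suc m) ^ (a + j)))
      \<longlonglongrightarrow> L ([:0, 1:] ^ (a + Suc j)) + real j * 0 * L ([:0, 1:] ^ (a + j))"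
    by (intro tendsto_intros Suc LIMSEQ_Suc[OF lim_1_over_n])
  then show ?case unfolding split by simp
qed

text \<open>The preceding limits with \<open>j = 0\<close>, where the falling factorial is 1, are
  those of the plain powers; the rest is linearity.\<close>

lemma weight_poly:
  "(\<lambda>m. \<Sum>k\<le>Suc m. weight (Suc m) k * poly p (real k / real (Suc m))) \<longlonglongrightarrow> L p"
proof -
  have eq: "(\<Sum>k\<le>Suc m. weight (Suc m) k * poly p (real k / real (Suc m)))
      = (\<Sum>i\<le>degree p. coeff p i * ((\<Sum>k\<le>Suc m. weight (Suc m) k * (real k ^ i * falling 0 (real k))) / real (Suc m) ^ (i + 0)))" for m
    unfolding poly_altdef sum_distrib_left sum_divide_distrib
    by (subst sum.swap) (simp add: power_divide mult_ac falling_def del: sum.atMost_Suc of_nat_Suc)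
  have "(\<lambda>m. \<Sum>i\<le>degree p. coeff p i * ((\<Sum>k\<le>Suc m. weight (Suc m) k * (real k ^ i * falling 0 (real k))) / real (Suc m) ^ (i + 0)))
     \<longlonglongrightarrow> (\<Sum>i\<le>degree p. coeff p i * L ([:0, 1:] ^ (i + 0)))"
    by (intro tendsto_sum tendsto_mult tendsto_const weight_moments_falling)
  then show ?thesis unfolding eq by (simp flip: L_altdef)
qed

text \<open>Indexed by \<open>Suc m\<close> so that the nodes are never divided by zero.\<close>

definition approx :: "nat \<Rightarrow> real measure" where
  "approx m = distr (point_measure {..Suc m} (\<lambda>k. ennreal (weight (Suc m) k))) borel (\<lambda>k. real k / real (Suc m))"

lemma approx_integral:
  assumes "f \<in> borel_measurable borel"
  shows "integral\<^sup>L (approx m) f = (\<Sum>k\<le>Suc m. weight (Suc m) k * f (real k / real (Suc m)))"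
  unfolding approx_def using assms
  by (subst integral_distr) (simp_all add: lebesgue_integral_point_measure_finite weight_nonneg del: sum.atMost_Suc of_nat_Suc)

lemma approx_distribution: "real_distribution (approx m)"
proof -
  have "prob_space (point_measure {..Suc m} (\<lambda>k. ennreal (weight (Suc m) k)))"
    by (rule prob_spaceI)
      (simp add: space_point_measure emeasure_point_measure_finite weight_nonneg weight_sum sum_ennreal del: sum.atMost_Suc)
  then have "prob_space (approx m)"
    unfolding approx_def by (rule prob_space.prob_space_distr) (simp add: point_measure_def)
  then show ?thesis by (simp add: real_distribution_def real_distribution_axioms_def approx_def)
qed

lemma approx_tight: "tight approx"
  unfolding tight_def
proof (intro conjI allI impI approx_distribution)
  fix e :: real assume e: "0 < e"
  \<comment> \<open>All nodes lie in the unit interval. Tightness is phrased with intervals open on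
    the left, so the left end is taken below the node 0.\<close>
  show "\<exists>a b. a < b \<and> (\<forall>m. 1 - e < measure (approx m) {a<..b})"
  proof (rule exI[of _ "-1"], rule exI[of _ 1], intro conjI allI)
    fix m
    interpret real_distribution "approx m" by (rule approx_distribution)
    have "measure (approx m) {-1<..1} = integral\<^sup>L (approx m) (indicator {-1<..1})" by simp
    also have "\<dots> = (\<Sum>k\<le>Suc m. weight (Suc m) k * indicator {-1<..1} (real k / real (Suc m)))"
      by (rule approx_integral) simp
    also have "\<dots> = (\<Sum>k\<le>Suc m. weight (Suc m) k)"
    proof (rule sum.cong)
      fix k assume "k \<in> {..Suc m}"
      then have "0 \<le> real k / real (Suc m)" "real k / real (Suc m) \<le> 1" by (auto simp: field_simps)
      then have "real k / real (Suc m) \<in> {-1<..1}" unfolding greaterThanAtMost_iff by linarith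
      then show "weight (Suc m) k * indicator {-1<..1} (real k / real (Suc m)) = weight (Suc m) k"
        by (simp only: indicator_simps mult_1_right)
    qed simp
    finally have "measure (approx m) {-1<..1} = 1" unfolding weight_sum .
    then show "1 - e < measure (approx m) {-1<..1}" using e by simp
  qed simp
qed

text \<open>The measure is a weak limit along a subsequence of the discrete measures. Weak
  convergence tests bounded continuous functions only, so polynomials are composed with
  \<open>clip\<close>, the retraction onto the unit interval; that this changes nothing in the limit
  requires the limit to live on that interval.\<close>

theorem representing_measure:
  "\<exists>M. real_distribution M \<and> (AE t in M. t \<in> {0..1}) \<and> (\<forall>p. integral\<^sup>L M (poly p) = L p)"
proof -
  obtain r M where r: "strict_mono r" and M: "real_distribution M"
    and conv: "weak_conv_m (approx \<circ> r) M"
    using tight_imp_convergent_subsubsequence[OF approx_tight strict_mono_id] by (auto simp: comp_def id_def)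
  interpret M: real_distribution M by (rule M)
  define clip :: "real \<Rightarrow> real" where "clip t = max 0 (min 1 t)" for t
  have clip_cont: "continuous_on A clip" for A unfolding clip_def by (intro continuous_intros)
  have clip_range: "clip t \<in> {0..1}" for t by (auto simp: clip_def)
  have [measurable]: "clip \<in> borel_measurable borel"
    using clip_cont by (rule borel_measurable_continuous_onI)
  have lim: "(\<lambda>n. integral\<^sup>L (approx (r n)) f) \<longlonglongrightarrow> integral\<^sup>L M f"
    if "continuous_on UNIV f" "\<And>t. norm (f t) \<le> B" for f :: "real \<Rightarrow> real" and B
  proof -
    have "(\<lambda>n. integral\<^sup>L ((approx \<circ> r) n) f) \<longlonglongrightarrow> integral\<^sup>L M f"
      by (rule weak_conv_imp_integral_bdd_continuous_conv[OF _ M conv])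
        (use that approx_distribution in \<open>auto simp: continuous_on_eq_continuous_at\<close>)
    then show ?thesis by simp
  qed
  have supp: "AE t in M. clip t = t"
  proof -
    \<comment> \<open>The distance to the unit interval, capped at 1 to be bounded: a weak test
      function that vanishes exactly on that interval, hence at all nodes.\<close>
    define d where "d t = min 1 \<bar>t - clip t\<bar>" for t
    have d_cont: "continuous_on UNIV d" unfolding d_def by (intro continuous_intros clip_cont)
    then have [measurable]: "d \<in> borel_measurable borel" by (rule borel_measurable_continuous_onI)
    have "(\<lambda>n. integral\<^sup>L (approx (r n)) d) \<longlonglongrightarrow> integral\<^sup>L M d"
      by (rule lim[OF d_cont, of 1]) (auto simp: d_def)
    moreover have "integral\<^sup>L (approx m) d = 0" for m
    proof -
      have "weight (Suc m) k * d (real k / real (Suc m)) = 0" if "k \<le> Suc m" for k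
      proof -
        have "0 \<le> real k / real (Suc m)" "real k / real (Suc m) \<le> 1" using that by (auto simp: field_simps)
        then show ?thesis by (simp add: d_def clip_def)
      qed
      then show ?thesis by (subst approx_integral) (auto simp del: sum.atMost_Suc of_nat_Suc intro!: sum.neutral)
    qed
    ultimately have "integral\<^sup>L M d = 0" by (simp add: LIMSEQ_const_iff)
    moreover have "integrable M d"
      by (rule M.integrable_const_bound[of _ 1]) (auto simp: d_def)
    ultimately have "AE t in M. d t = 0"
      by (subst (asm) integral_nonneg_eq_0_iff_AE) (auto simp: d_def)
    then show ?thesis by eventually_elim (auto simp: d_def min_def split: if_splits)
  qed
  have "integral\<^sup>L M (poly p) = L p" for p
  proof -
    have pc: "continuous_on UNIV (\<lambda>t. poly p (clip t))" by (intro continuous_intros clip_cont)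
    have "compact (poly p ` {0..1})" by (intro compact_continuous_image continuous_intros) auto
    then obtain B where B: "\<And>t. t \<in> {0..1} \<Longrightarrow> norm (poly p t) \<le> B"
      using compact_imp_bounded[of "poly p ` {0..1}"] unfolding bounded_iff by blast
    have "(\<lambda>n. integral\<^sup>L (approx (r n)) (\<lambda>t. poly p (clip t))) \<longlonglongrightarrow> (\<integral>t. poly p (clip t) \<partial>M)"
      by (rule lim[OF pc, of B]) (use B clip_range in blast)
    moreover have "integral\<^sup>L (approx m) (\<lambda>t. poly p (clip t))
        = (\<Sum>k\<le>Suc m. weight (Suc m) k * poly p (real k / real (Suc m)))" for m
    proof (subst approx_integral)
      show "(\<Sum>k\<le>Suc m. weight (Suc m) k * poly p (clip (real k / real (Suc m))))
        = (\<Sum>k\<le>Suc m. weight (Suc m) k * poly p (real k / real (Suc m)))"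
      proof (rule sum.cong)
        fix k assume "k \<in> {..Suc m}"
        then have "0 \<le> real k / real (Suc m)" "real k / real (Suc m) \<le> 1" by (auto simp: field_simps)
        then have "clip (real k / real (Suc m)) = real k / real (Suc m)" by (simp add: clip_def)
        then show "weight (Suc m) k * poly p (clip (real k / real (Suc m))) = weight (Suc m) k * poly p (real k / real (Suc m))"
          by simp
      qed simp
    qed (use pc in \<open>rule borel_measurable_continuous_onI\<close>)
    moreover have "(\<lambda>n. \<Sum>k\<le>Suc (r n). weight (Suc (r n)) k * poly p (real k / real (Suc (r n)))) \<longlonglongrightarrow> L p"
      using LIMSEQ_subseq_LIMSEQ[OF weight_poly r] by (simp add: comp_def)
    ultimately have "(\<integral>t. poly p (clip t) \<partial>M) = L p" by (simp add: LIMSEQ_unique)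
    moreover have "(\<integral>t. poly p (clip t) \<partial>M) = integral\<^sup>L M (poly p)"
      by (rule integral_cong_AE)
        (use supp in \<open>auto intro!: borel_measurable_continuous_onI pc continuous_intros
          simp: measurable_cong_sets[OF M.events_eq_borel refl]\<close>)
    ultimately show ?thesis by simp
  qed
  moreover have "AE t in M. t \<in> {0..1}" using supp by eventually_elim (metis clip_range)
  ultimately show ?thesis using M by blast
qed

end

section \<open>The spectral theorem for bounded symmetric operators\<close>

text \<open>The Bernstein approximant is rewritten as an object of type \<open>poly\<close>, so that
  an operator can be substituted into it.\<close>

lemma Weierstrass_polynomial:
  fixes g :: "real \<Rightarrow> real"
  assumes "continuous_on {0..1} g" "0 < e"
  obtains p where "\<And>t. t \<in> {0..1} \<Longrightarrow> \<bar>g t - poly p t\<bar> < e"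
proof -
  obtain N where N: "\<bar>g t - (\<Sum>k\<le>N. g (real k / real N) * Bernstein N k t)\<bar> < e" if "t \<in> {0..1}" for t
    using Bernstein_Weierstrass[OF assms] by blast
  define p where "p = (\<Sum>k\<le>N. smult (g (real k / real N) * real (N choose k)) ([:0, 1:] ^ k * [:1, - 1:] ^ (N - k)))"
  have "poly p t = (\<Sum>k\<le>N. g (real k / real N) * Bernstein N k t)" for t
    by (simp add: p_def poly_sum Bernstein_def mult_ac)
  then show ?thesis using N by (intro that[of p]) (simp only:)
qed

text \<open>From polynomials to continuous functions by Weierstrass, to half-lines by continuous
  ramps, and to all Borel sets because half-lines are stable under intersection and generate them.
  Bounds and limits are demanded on the unit interval only: polynomial approximation gives no
  control outside it, and the measures do not charge the outside.\<close>

lemma indicator_class: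
  fixes P :: "(real \<Rightarrow> real) \<Rightarrow> bool"
  assumes poly: "\<And>p. P (poly p)"
    and lin: "\<And>f g a b. P f \<Longrightarrow> P g \<Longrightarrow> P (\<lambda>t. a * f t + b * g t)"
    and lim: "\<And>(f :: nat \<Rightarrow> _) g C. (\<And>n. P (f n)) \<Longrightarrow> (\<And>n t. t \<in> {0..1} \<Longrightarrow> \<bar>f n t\<bar> \<le> C) \<Longrightarrow>
        (\<And>t. t \<in> {0..1} \<Longrightarrow> (\<lambda>n. f n t) \<longlonglongrightarrow> g t) \<Longrightarrow> g \<in> borel_measurable borel \<Longrightarrow> P g"
    and \<sigma>: "\<sigma> \<in> sets borel"
  shows "P (indicator \<sigma>)"
proof -
  have cont: "P g" if g: "continuous_on UNIV g" for g :: "real \<Rightarrow> real"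
  proof -
    have g01: "continuous_on {0..1} g" using g continuous_on_subset by blast
    then have "compact (g ` {0..1})" by (intro compact_continuous_image) auto
    then obtain C where C: "\<And>t. t \<in> {0..1} \<Longrightarrow> \<bar>g t\<bar> \<le> C"
      using compact_imp_bounded[of "g ` {0..1}"] unfolding bounded_iff real_norm_def by blast
    have "\<exists>p. \<forall>t\<in>{0..1}. \<bar>g t - poly p t\<bar> < 1 / real (Suc n)" for n
    proof -
      have "0 < 1 / real (Suc n)" by simp
      from Weierstrass_polynomial[OF g01 this] show ?thesis by metis
    qed
    then obtain p where p: "\<And>n t. t \<in> {0..1} \<Longrightarrow> \<bar>g t - poly (p n) t\<bar> < 1 / real (Suc n)" by metis
    show ?thesis
    proof (rule lim)
      show "P (poly (p n))" for n by (rule poly)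
      show "\<bar>poly (p n) t\<bar> \<le> C + 1" if "t \<in> {0..1}" for n t
      proof -
        have "1 / real (Suc n) \<le> 1" by simp
        then show ?thesis using C[OF that] p[OF that, of n] by linarith
      qed
      show "(\<lambda>n. poly (p n) t) \<longlonglongrightarrow> g t" if t: "t \<in> {0..1}" for t
      proof -
        have "(\<lambda>n. poly (p n) t - g t) \<longlonglongrightarrow> 0"
        proof (rule Lim_null_comparison)
          show "\<forall>\<^sub>F n in sequentially. norm (poly (p n) t - g t) \<le> 1 / real (Suc n)"
            using p[OF t] by (intro always_eventually allI) (simp add: abs_minus_commute less_imp_le)
        qed (rule LIMSEQ_Suc[OF lim_1_over_n])
        then show ?thesis by (simp add: LIM_zero_iff)
      qed
    qed (use g in \<open>rule borel_measurable_continuous_onI\<close>)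
  qed
  have atMost: "P (indicator {..a})" for a
  proof (rule lim)
    \<comment> \<open>A ramp that is 1 up to \<open>a\<close> and then descends to 0 with slope
      \<open>- n\<close>.\<close>
    show "P (\<lambda>t. max 0 (min 1 (1 - real n * (t - a))))" for n
      by (rule cont) (intro continuous_intros)
    show "\<bar>max 0 (min 1 (1 - real n * (t - a)))\<bar> \<le> 1" for n t by auto
    show "(\<lambda>n. max 0 (min 1 (1 - real n * (t - a)))) \<longlonglongrightarrow> indicator {..a} t" for t
    proof (cases "t \<le> a")
      case True
      then have "max 0 (min 1 (1 - real n * (t - a))) = indicator {..a} t" for n
        using mult_nonneg_nonpos[of "real n" "t - a"] by (simp add: indicator_def)
      then show ?thesis by simp
    next
      case False
      obtain N where N: "1 < real N * (t - a)" using reals_Archimedean3[of "t - a"] False by auto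
      have "max 0 (min 1 (1 - real n * (t - a))) = indicator {..a} t" if "N \<le> n" for n
      proof -
        have "real N * (t - a) \<le> real n * (t - a)" using that False by (intro mult_right_mono) auto
        then have "1 - real n * (t - a) \<le> 0" using N by linarith
        then show ?thesis using False by (simp add: indicator_def max_def)
      qed
      then show ?thesis by (intro tendsto_eventually eventually_sequentiallyI)
    qed
  qed simp
  have "sigma_sets UNIV (range atMost) = sets (borel :: real measure)"
    by (simp add: borel_eq_atMost)
  then have mem: "\<sigma> \<in> sigma_sets UNIV (range atMost)" using \<sigma> by simp
  have "Int_stable (range (atMost :: real \<Rightarrow> _))" by (auto simp: Int_stable_def)
  moreover have "range (atMost :: real \<Rightarrow> _) \<subseteq> Pow UNIV" by simp
  ultimately show ?thesis
  using mem
  proof (induction rule: sigma_sets_induct_disjoint)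
    case (basic A) then show ?case using atMost by auto
  next
    case empty
    have "indicator {} = (poly 0 :: real \<Rightarrow> real)" by auto
    then show ?case using poly by metis
  next
    case (compl A)
    have "indicator (UNIV - A) = (\<lambda>t::real. 1 * poly 1 t + (-1) * indicator A t :: real)"
      by (auto simp: indicator_def)
    then show ?case using lin[OF poly[of 1] compl(2), of 1 "-1"] by simp
  next
    case (union A)
    have part: "P (indicator (\<Union>i<n. A i))" for n
    proof (induction n)
      case 0
      have "indicator (\<Union>i<0. A i) = (poly 0 :: real \<Rightarrow> real)" by auto
      then show ?case using poly by metis
    next
      case (Suc n)
      have "A n \<inter> A i = {}" if "i < n" for i
        using union(1) that by (intro disjoint_family_onD) auto
      then have "A n \<inter> (\<Union>i<n. A i) = {}" by blast
      then have "indicator (\<Union>i<Suc n. A i) = (\<lambda>t. 1 * indicator (\<Union>i<n. A i) t + 1 * indicator (A n) t :: real)"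
        by (auto simp: indicator_def less_Suc_eq fun_eq_iff)
      then show ?case using lin[OF Suc union(3), of 1 1] by simp
    qed
    show ?case
    proof (rule lim[of "\<lambda>n. indicator (\<Union>i<n. A i)" 1])
      show "P (indicator (\<Union>i<n. A i))" for n by (rule part)
      show "\<bar>indicator (\<Union>i<n. A i) t\<bar> \<le> (1::real)" for n t by (auto simp: indicator_def)
      show "(\<lambda>n. indicator (\<Union>i<n. A i) t :: real) \<longlonglongrightarrow> indicator (\<Union>i. A i) t" for t
        by (rule LIMSEQ_indicator_UN)
      have "A i \<in> sets borel" for i
        using union(2) by (auto simp: borel_eq_atMost)
      then show "(indicator (\<Union>i. A i) :: real \<Rightarrow> real) \<in> borel_measurable borel" by measurable
    qed
  qed
qed

section \<open>Projection-valued measures and their scalar measures\<close>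

lemma pvm_rules:
  assumes "projection_valued_measure E"
  shows "\<sigma> \<in> sets borel \<Longrightarrow> bounded_clinear (E \<sigma>)"
    and "\<sigma> \<in> sets borel \<Longrightarrow> cinner (E \<sigma> x) y = cinner x (E \<sigma> y)"
    and "\<sigma> \<in> sets borel \<Longrightarrow> \<tau> \<in> sets borel \<Longrightarrow> E \<sigma> (E \<tau> x) = E (\<sigma> \<inter> \<tau>) x"
    and "range s \<subseteq> sets borel \<Longrightarrow> disjoint_family s \<Longrightarrow> (\<lambda>i::nat. E (s i) x) sums E (\<Union>i. s i) x"
    and "E UNIV x = x"
    and "E {} x = 0"
proof -
  show "\<sigma> \<in> sets borel \<Longrightarrow> bounded_clinear (E \<sigma>)"
    and "\<sigma> \<in> sets borel \<Longrightarrow> cinner (E \<sigma> x) y = cinner x (E \<sigma> y)"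
    and "E UNIV x = x"
    and s: "range s \<subseteq> sets borel \<Longrightarrow> disjoint_family s \<Longrightarrow> (\<lambda>i::nat. E (s i) x) sums E (\<Union>i. s i) x" for s
    using assms unfolding projection_valued_measure_def is_orth_projection_def by auto
  have "\<sigma> \<in> sets borel \<Longrightarrow> \<tau> \<in> sets borel \<Longrightarrow> E (\<sigma> \<inter> \<tau>) = E \<sigma> \<circ> E \<tau>"
    using assms unfolding projection_valued_measure_def by blast
  then show "\<sigma> \<in> sets borel \<Longrightarrow> \<tau> \<in> sets borel \<Longrightarrow> E \<sigma> (E \<tau> x) = E (\<sigma> \<inter> \<tau>) x" by simp
  have "(\<lambda>i::nat. E {} x) sums E (\<Union>i::nat. {}) x"
    by (rule s) (auto simp: disjoint_family_on_def)
  then have "(\<lambda>i::nat. E {} x) \<longlonglongrightarrow> 0" using summable_LIMSEQ_zero sums_summable by blast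
  then show "E {} x = 0" by (simp add: LIMSEQ_const_iff)
qed

lemma pvm_norm_square:
  assumes "projection_valued_measure E" "\<sigma> \<in> sets borel"
  shows "cinner x (E \<sigma> x) = complex_of_real ((norm (E \<sigma> x))\<^sup>2)"
  using pvm_rules(2)[OF assms, of x "E \<sigma> x"] pvm_rules(3)[OF assms(1,2,2), of x]
  by (simp add: cinner_self)

lemma pvm_norm_le:
  assumes "projection_valued_measure E" "\<sigma> \<in> sets borel"
  shows "norm (E \<sigma> x) \<le> norm x"
  by (rule projection_norm_le) (use pvm_rules(2,3)[OF assms(1)] assms(2) in auto)

text \<open>Convergence of the vectors is reduced to additivity of squared norms, since the pieces
  are orthogonal; the latter is a statement about scalar measures.\<close>

lemma projection_valued_measureI:
  assumes bc: "\<And>\<sigma>. \<sigma> \<in> sets borel \<Longrightarrow> bounded_clinear (E \<sigma>)"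
    and sym: "\<And>\<sigma> x y. \<sigma> \<in> sets borel \<Longrightarrow> cinner (E \<sigma> x) y = cinner x (E \<sigma> y)"
    and UNIV: "\<And>x. E UNIV x = x" and empty: "\<And>x. E {} x = 0"
    and Int: "\<And>\<sigma> \<tau> x. \<sigma> \<in> sets borel \<Longrightarrow> \<tau> \<in> sets borel \<Longrightarrow> E \<sigma> (E \<tau> x) = E (\<sigma> \<inter> \<tau>) x"
    and sums: "\<And>s x. range s \<subseteq> sets borel \<Longrightarrow> disjoint_family s \<Longrightarrow>
      (\<lambda>i::nat. (norm (E (s i) x))\<^sup>2) sums (norm (E (\<Union>i. s i) x))\<^sup>2"
  shows "projection_valued_measure E"
  unfolding projection_valued_measure_def is_orth_projection_def
proof (intro conjI ballI allI impI)
  show "E \<sigma> \<circ> E \<sigma> = E \<sigma>" if "\<sigma> \<in> sets borel" for \<sigma>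
    using Int[OF that that] by (auto simp: fun_eq_iff)
  show "E (\<sigma> \<inter> \<tau>) = E \<sigma> \<circ> E \<tau>" if "\<sigma> \<in> sets borel" "\<tau> \<in> sets borel" for \<sigma> \<tau>
    using Int[OF that] by (auto simp: fun_eq_iff)
  show "(\<lambda>i. E (s i) x) sums E (\<Union>i. s i) x"
    if s: "range s \<subseteq> sets borel \<and> disjoint_family s" for s :: "nat \<Rightarrow> _" and x
  proof -
    have [simp]: "s i \<in> sets borel" for i using s by auto
    have [simp]: "(\<Union>i. s i) \<in> sets borel" using s by (intro sets.countable_nat_UN) auto
    have "cinner (E (s i) x) (E (s j) x) = 0" if "i \<noteq> j" for i j
      using s that by (simp add: sym Int empty disjoint_family_on_def)
    moreover have "cinner (E (s i) x) (E (\<Union>i. s i) x) = cinner (E (s i) x) (E (s i) x)" for i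
    proof -
      have "s i \<inter> (\<Union>i. s i) = s i" by auto
      then show ?thesis by (simp add: sym Int)
    qed
    ultimately show ?thesis using sums s by (subst orthogonal_sums_iff_norm) auto
  qed
qed (use bc sym UNIV in auto)

lemma spectral_measure_sets [simp, measurable_cong]: "sets (spectral_measure E x) = sets borel"
  unfolding spectral_measure_def using sets.sigma_sets_eq[of "borel :: real measure"]
  by (subst sets_measure_of) auto

lemma spectral_measure_space [simp]: "space (spectral_measure E x) = UNIV"
  by (simp add: spectral_measure_def)

text \<open>\<open>measure_of\<close> takes the intended values only once these are countably
  additive. The squared norm equals \<open>cinner x (E \<sigma> x)\<close>, which is linear in the
  projection, and that yields additivity.\<close>

lemma emeasure_spectral_measure:
  assumes E: "projection_valued_measure E" and \<sigma>: "\<sigma> \<in> sets borel"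
  shows "emeasure (spectral_measure E x) \<sigma> = ennreal ((norm (E \<sigma> x))\<^sup>2)"
proof -
  have "countably_additive (sets borel) (\<lambda>\<sigma>. ennreal ((norm (E \<sigma> x))\<^sup>2))"
    unfolding countably_additive_def
  proof (intro allI impI)
    fix s :: "nat \<Rightarrow> real set" assume s: "range s \<subseteq> sets borel" "disjoint_family s"
    have [simp]: "s i \<in> sets borel" for i using s by auto
    have [simp]: "(\<Union>i. s i) \<in> sets borel" using s by (intro sets.countable_nat_UN) auto
    have "(\<lambda>i. cinner x (E (s i) x)) sums cinner x (E (\<Union>i. s i) x)"
      by (rule sums_cinner_right[OF pvm_rules(4)[OF E s]])
    then have "(\<lambda>i. Re (cinner x (E (s i) x))) sums Re (cinner x (E (\<Union>i. s i) x))"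
      by (rule sums_Re)
    then have "(\<lambda>i. (norm (E (s i) x))\<^sup>2) sums (norm (E (\<Union>i. s i) x))\<^sup>2"
      by (simp add: pvm_norm_square[OF E])
    then show "(\<Sum>i. ennreal ((norm (E (s i) x))\<^sup>2)) = ennreal ((norm (E (\<Union>i. s i) x))\<^sup>2)"
      by (intro suminf_ennreal_eq) auto
  qed
  moreover have "positive (sets borel) (\<lambda>\<sigma>. ennreal ((norm (E \<sigma> x))\<^sup>2))"
    by (simp add: positive_def pvm_rules(6)[OF E])
  ultimately show ?thesis
    unfolding spectral_measure_def using \<sigma> sets.sigma_algebra_axioms[of "borel :: real measure"]
    by (subst emeasure_measure_of_sigma) auto
qed

lemma finite_spectral_measure:
  assumes "projection_valued_measure E" shows "finite_measure (spectral_measure E x)"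
  by (rule finite_measureI) (simp add: emeasure_spectral_measure[OF assms])

text \<open>The resolution of a function \<open>h\<close> of the operator; it serves to undo an
  affine rescaling.\<close>

lemma pvm_vimage:
  assumes E: "projection_valued_measure E" and h: "h \<in> borel_measurable borel"
  shows "projection_valued_measure (\<lambda>\<sigma>. E (h -` \<sigma>))"
    and "spectral_measure (\<lambda>\<sigma>. E (h -` \<sigma>)) x = distr (spectral_measure E x) borel h"
proof -
  have m: "h -` \<sigma> \<in> sets borel" if "\<sigma> \<in> sets borel" for \<sigma>
    using measurable_sets[OF h that] by simp
  show pvm: "projection_valued_measure (\<lambda>\<sigma>. E (h -` \<sigma>))"
    unfolding projection_valued_measure_def
  proof (intro conjI ballI allI impI)
    show "is_orth_projection (E (h -` \<sigma>))" if "\<sigma> \<in> sets borel" for \<sigma>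
      using m[OF that] E unfolding projection_valued_measure_def by blast
    show "E (h -` UNIV) = id" by (auto simp: pvm_rules(5)[OF E])
    show "E (h -` (\<sigma> \<inter> \<tau>)) = E (h -` \<sigma>) \<circ> E (h -` \<tau>)" if "\<sigma> \<in> sets borel" "\<tau> \<in> sets borel" for \<sigma> \<tau>
      using that m by (auto simp: fun_eq_iff pvm_rules(3)[OF E] vimage_Int)
    show "(\<lambda>i. E (h -` s i) x) sums E (h -` (\<Union>i. s i)) x"
      if "range s \<subseteq> sets borel \<and> disjoint_family s" for s :: "nat \<Rightarrow> _" and x
      unfolding vimage_UN
      by (rule pvm_rules(4)[OF E]) (use that m in \<open>auto simp: disjoint_family_on_def disjoint_iff\<close>)
  qed
  show "spectral_measure (\<lambda>\<sigma>. E (h -` \<sigma>)) x = distr (spectral_measure E x) borel h"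
  proof (rule measure_eqI)
    fix \<sigma> assume "\<sigma> \<in> sets (spectral_measure (\<lambda>\<sigma>. E (h -` \<sigma>)) x)"
    then have "\<sigma> \<in> sets borel" by simp
    then show "emeasure (spectral_measure (\<lambda>\<sigma>. E (h -` \<sigma>)) x) \<sigma> = emeasure (distr (spectral_measure E x) borel h) \<sigma>"
      using h m by (simp add: emeasure_spectral_measure[OF pvm] emeasure_spectral_measure[OF E] emeasure_distr)
  qed simp
qed

section \<open>Functional calculus of an operator between 0 and 1\<close>

locale positive_contraction =
  fixes A :: "'h::complex_hilbert \<Rightarrow> 'h"
  assumes bc: "bounded_clinear A" and sym: "cinner (A x) y = cinner x (A y)"
    and pos: "0 \<le> Re (cinner x (A x))" and contr: "Re (cinner x (A x)) \<le> (norm x)\<^sup>2"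
begin

text \<open>The polynomial evaluated at \<open>A\<close> by Horner's scheme, which gives the
  recursion over \<open>pCons\<close> directly.\<close>

definition poly_op :: "real poly \<Rightarrow> 'h \<Rightarrow> 'h" where
  "poly_op p = fold_coeffs (\<lambda>a f x. a *\<^sub>R x + A (f x)) p (\<lambda>_. 0)"

lemma poly_op_0: "poly_op 0 x = 0" by (simp add: poly_op_def)

lemma poly_op_pCons: "poly_op (pCons a p) x = a *\<^sub>R x + A (poly_op p x)"
  by (cases "a = 0 \<and> p = 0") (auto simp: poly_op_def bounded_clinearD(5)[OF bc])

lemma poly_op_bounded_clinear: "bounded_clinear (poly_op p)"
proof (induction p)
  case 0
  have "poly_op 0 = (\<lambda>_. 0)" by (auto simp: poly_op_0)
  then show ?case by (simp add: bounded_clinear_def clinear_on_def)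
next
  case (pCons a p)
  have "poly_op (pCons a p) = (\<lambda>x. a *\<^sub>R id x + 1 *\<^sub>R (A \<circ> poly_op p) x)" by (auto simp: poly_op_pCons)
  then show ?case
    using bounded_clinear_combination[OF bounded_clinear_id bounded_clinear_compose[OF bc pCons(2)], of a 1] by simp
qed

lemma poly_op_add: "poly_op (p + q) x = poly_op p x + poly_op q x"
  by (induction p q rule: poly_induct2)
    (simp_all add: poly_op_0 poly_op_pCons scaleR_add_left bounded_clinearD(2)[OF bc])

lemma poly_op_smult: "poly_op (smult c p) x = c *\<^sub>R poly_op p x"
  by (induction p) (simp_all add: poly_op_0 poly_op_pCons scaleR_add_right bounded_clinearD(6)[OF bc])

lemma poly_op_mult: "poly_op (p * q) x = poly_op p (poly_op q x)"
  by (induction p) (simp_all add: poly_op_0 poly_op_pCons poly_op_add poly_op_smult)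

lemma poly_op_simps: "poly_op 1 x = x" "poly_op [:0, 1:] x = A x" "poly_op [:1, - 1:] x = x - A x"
  by (simp_all add: one_pCons poly_op_pCons poly_op_0 bounded_clinearD(5,6)[OF bc] bounded_clinearD(6)[OF bc, of "-1", simplified])

lemma poly_op_commute:
  assumes B: "bounded_clinear B" and AB: "A \<circ> B = B \<circ> A"
  shows "poly_op p (B x) = B (poly_op p x)"
proof -
  have "A (B y) = B (A y)" for y using AB by (metis comp_apply)
  then show ?thesis
    by (induction p) (simp_all add: poly_op_0 poly_op_pCons bounded_clinearD(2,5,6)[OF B])
qed

lemma poly_op_symmetric: "cinner (poly_op p x) y = cinner x (poly_op p y)"
proof (induction p arbitrary: x y)
  case (pCons a p)
  have "poly_op p (A y) = A (poly_op p y)" by (rule poly_op_commute[OF bc refl])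
  then show ?case
    using pCons(2)[of x "A y"]
    by (simp add: poly_op_pCons cinner_add_left cinner_add_right cinner_scaleR_left cinner_scaleR_right sym)
qed (simp add: poly_op_0)

lemma poly_op_conjugate: "cinner x (poly_op (s * r * s) x) = cinner (poly_op s x) (poly_op r (poly_op s x))"
  by (simp add: poly_op_mult poly_op_symmetric)

text \<open>Conjugation by a symmetric operator preserves positivity, so half of the even part of
  each exponent can be moved to either side. This leaves the four cases \<open>1\<close>,
  \<open>X\<close>, \<open>Y\<close> and \<open>X * Y\<close>, of which only the last is not
  immediate.\<close>

lemma poly_op_bernstein_nonneg: "0 \<le> Re (cinner x (poly_op ([:0, 1:] ^ k * [:1, - 1:] ^ m) x))"
proof -
  let ?X = "[:0, 1:] :: real poly" and ?Y = "[:1, - 1:] :: real poly"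
  have X: "0 \<le> Re (cinner y (poly_op ?X y))" and Y: "0 \<le> Re (cinner y (poly_op ?Y y))" for y
    using pos[of y] contr[of y] by (simp_all add: poly_op_simps cinner_diff_right cinner_self)
  have XY: "0 \<le> Re (cinner y (poly_op (?X * ?Y) y))" for y
  proof -
    \<comment> \<open>Since \<open>X + Y = 1\<close>, the product equals
      \<open>X * Y * (X + Y)\<close>, a sum of a conjugate of \<open>Y\<close> by \<open>X\<close>
      and a conjugate of \<open>X\<close> by \<open>Y\<close>.\<close>
    have "?X * ?Y = ?X * ?Y * ?X + ?Y * ?X * ?Y" by simp
    then show ?thesis
      using X[of "poly_op ?Y y"] Y[of "poly_op ?X y"]
      by (metis (no_types, lifting) poly_op_add cinner_add_right poly_op_conjugate plus_complex.sel(1) add_nonneg_nonneg)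
  qed
  have r: "0 \<le> Re (cinner y (poly_op (?X ^ (k mod 2) * ?Y ^ (m mod 2)) y))" for y
  proof -
    have "0 \<le> Re (cinner y (poly_op 1 y))" by (simp add: poly_op_simps cinner_self)
    then show ?thesis using X[of y] Y[of y] XY[of y]
      by (cases "even k"; cases "even m") (simp_all add: even_iff_mod_2_eq_zero odd_iff_mod_2_eq_one del: mult_pCons_left mult_pCons_right)
  qed
  have pw: "z ^ n = z ^ (n div 2) * z ^ (n mod 2) * z ^ (n div 2)" for z :: "real poly" and n :: nat
  proof -
    have "z ^ n = z ^ (n div 2 + n mod 2 + n div 2)" by (rule arg_cong[of _ _ "\<lambda>k. z ^ k"]) presburger
    then show ?thesis by (simp only: power_add)
  qed
  have "?X ^ k * ?Y ^ m = (?X ^ (k div 2) * ?Y ^ (m div 2)) * (?X ^ (k mod 2) * ?Y ^ (m mod 2)) * (?X ^ (k div 2) * ?Y ^ (m div 2))"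
    by (subst pw[of ?X k], subst pw[of ?Y m]) (simp only: mult_ac)
  then show ?thesis using r by (simp only: poly_op_conjugate)
qed

lemma ex_distribution:
  "\<exists>M. real_distribution M \<and> (AE t in M. t \<in> {0..1}) \<and>
    (\<forall>p. (norm x)\<^sup>2 * integral\<^sup>L M (poly p) = Re (cinner x (poly_op p x)))"
proof -
  \<comment> \<open>Dividing by the squared norm normalises \<open>L 1\<close>. For
    \<open>x = 0\<close> evaluation at 0 serves as a default that still satisfies the axioms of the
    locale.\<close>
  define L where "L p = (if x = 0 then poly p 0 else Re (cinner x (poly_op p x)) / (norm x)\<^sup>2)" for p
  interpret positive_functional L
  proof
    show "0 \<le> L ([:0, 1:] ^ k * [:1, - 1:] ^ m)" for k m
      unfolding L_def using poly_op_bernstein_nonneg[of x k m] by (simp add: poly_mult poly_power)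
  qed (auto simp: L_def poly_op_add poly_op_smult poly_op_simps cinner_add_right cinner_scaleR_right cinner_self add_divide_distrib)
  obtain M where "real_distribution M" "AE t in M. t \<in> {0..1}" "\<forall>p. integral\<^sup>L M (poly p) = L p"
    using representing_measure by blast
  then show ?thesis by (intro exI[of _ M]) (auto simp: L_def)
qed

definition moment_dist :: "'h \<Rightarrow> real measure" where
  "moment_dist x = (SOME M. real_distribution M \<and> (AE t in M. t \<in> {0..1}) \<and>
    (\<forall>p. (norm x)\<^sup>2 * integral\<^sup>L M (poly p) = Re (cinner x (poly_op p x))))"

lemma moment_dist: "real_distribution (moment_dist x)" "AE t in moment_dist x. t \<in> {0..1}"
    "(norm x)\<^sup>2 * integral\<^sup>L (moment_dist x) (poly p) = Re (cinner x (poly_op p x))"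
  using someI_ex[OF ex_distribution[of x]] unfolding moment_dist_def by auto

lemma moment_dist_sets [measurable_cong]: "sets (moment_dist x) = sets borel"
  using moment_dist(1) by (simp add: real_distribution_def real_distribution_axioms_def)

lemma moment_dist_integrable:
  fixes f :: "real \<Rightarrow> real"
  assumes "f \<in> borel_measurable borel" "\<And>t. t \<in> {0..1} \<Longrightarrow> \<bar>f t\<bar> \<le> C"
  shows "integrable (moment_dist x) f"
proof -
  interpret real_distribution "moment_dist x" by (rule moment_dist)
  have "AE t in moment_dist x. norm (f t) \<le> C" using moment_dist(2) by eventually_elim (use assms in auto)
  then show ?thesis using assms(1) by (intro integrable_const_bound) auto
qed

text \<open>\<open>F\<close> is the operator \<open>f(A)\<close>, known through its diagonal values
  against the measure of each vector. The commutation clause is carried along because it passes to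
  limits; for a symmetric \<open>B\<close> it does so weakly, by moving \<open>B\<close> to the
  other side of the inner product.\<close>

definition represents :: "(real \<Rightarrow> real) \<Rightarrow> ('h \<Rightarrow> 'h) \<Rightarrow> bool" where
  "represents f F \<longleftrightarrow> f \<in> borel_measurable borel \<and> (\<exists>C. \<forall>t\<in>{0..1}. \<bar>f t\<bar> \<le> C) \<and> bounded_clinear F \<and>
     (\<forall>x. cinner x (F x) = complex_of_real ((norm x)\<^sup>2 * integral\<^sup>L (moment_dist x) f)) \<and>
     (\<forall>B. bounded_clinear B \<longrightarrow> (\<forall>x y. cinner (B x) y = cinner x (B y)) \<longrightarrow> A \<circ> B = B \<circ> A \<longrightarrow>
        (\<forall>x. F (B x) = B (F x)))"

lemma representsD:
  assumes "represents f F"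
  shows "f \<in> borel_measurable borel" "\<exists>C. \<forall>t\<in>{0..1}. \<bar>f t\<bar> \<le> C" "bounded_clinear F"
    "cinner x (F x) = complex_of_real ((norm x)\<^sup>2 * integral\<^sup>L (moment_dist x) f)"
    "bounded_clinear B \<Longrightarrow> (\<And>x y. cinner (B x) y = cinner x (B y)) \<Longrightarrow> A \<circ> B = B \<circ> A \<Longrightarrow> F (B x) = B (F x)"
    "integrable (moment_dist x) f"
proof -
  show "f \<in> borel_measurable borel" "\<exists>C. \<forall>t\<in>{0..1}. \<bar>f t\<bar> \<le> C" "bounded_clinear F"
    "cinner x (F x) = complex_of_real ((norm x)\<^sup>2 * integral\<^sup>L (moment_dist x) f)"
    using assms unfolding represents_def by blast+
  then show "integrable (moment_dist x) f" using moment_dist_integrable by blast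
  show "bounded_clinear B \<Longrightarrow> (\<And>x y. cinner (B x) y = cinner x (B y)) \<Longrightarrow> A \<circ> B = B \<circ> A \<Longrightarrow> F (B x) = B (F x)"
    using assms unfolding represents_def by simp
qed

lemma represents_symmetric: "represents f F \<Longrightarrow> cinner (F x) y = cinner x (F y)"
  by (rule symmetric_operatorI) (auto dest: representsD(3) simp: representsD(4))

lemma represents_unique: "represents f F \<Longrightarrow> represents f G \<Longrightarrow> F = G"
  by (rule operator_eqI) (auto dest: representsD(3) simp: representsD(4))

lemma represents_poly: "represents (poly p) (poly_op p)"
proof -
  have "compact (poly p ` {0..1})" by (intro compact_continuous_image continuous_intros) auto
  then have "\<exists>C. \<forall>t\<in>{0..1}. \<bar>poly p t\<bar> \<le> C"
    using compact_imp_bounded[of "poly p ` {0..1}"] unfolding bounded_iff real_norm_def by blast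
  moreover have "cinner x (poly_op p x) = complex_of_real ((norm x)\<^sup>2 * integral\<^sup>L (moment_dist x) (poly p))" for x
  proof -
    have "cnj (cinner x (poly_op p x)) = cinner x (poly_op p x)"
      using poly_op_symmetric[of p x x] cinner_commute[of "poly_op p x" x] by simp
    then have "Im (cinner x (poly_op p x)) = 0" by (simp add: complex_eq_iff)
    then show ?thesis by (simp add: moment_dist(3) complex_eq_iff)
  qed
  moreover have "poly p \<in> borel_measurable borel"
    by (intro borel_measurable_continuous_onI continuous_intros)
  ultimately show ?thesis unfolding represents_def using poly_op_bounded_clinear poly_op_commute by blast
qed

lemma represents_combination:
  assumes f: "represents f F" and g: "represents g G"
  shows "represents (\<lambda>t. a * f t + b * g t) (\<lambda>x. a *\<^sub>R F x + b *\<^sub>R G x)"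
  unfolding represents_def
proof (intro conjI allI impI)
  show "(\<lambda>t. a * f t + b * g t) \<in> borel_measurable borel"
    using representsD(1)[OF f] representsD(1)[OF g] by measurable
  obtain C C' where C: "\<forall>t\<in>{0..1}. \<bar>f t\<bar> \<le> C" "\<forall>t\<in>{0..1}. \<bar>g t\<bar> \<le> C'"
    using representsD(2)[OF f] representsD(2)[OF g] by blast
  show "\<exists>C. \<forall>t\<in>{0..1}. \<bar>a * f t + b * g t\<bar> \<le> C"
  proof (intro exI ballI)
    fix t :: real assume t: "t \<in> {0..1}"
    have "\<bar>a * f t + b * g t\<bar> \<le> \<bar>a\<bar> * \<bar>f t\<bar> + \<bar>b\<bar> * \<bar>g t\<bar>"
      using abs_triangle_ineq[of "a * f t" "b * g t"] by (simp add: abs_mult)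
    also have "\<dots> \<le> \<bar>a\<bar> * C + \<bar>b\<bar> * C'" using C t by (intro add_mono mult_left_mono) auto
    finally show "\<bar>a * f t + b * g t\<bar> \<le> \<bar>a\<bar> * C + \<bar>b\<bar> * C'" .
  qed
  show "bounded_clinear (\<lambda>x. a *\<^sub>R F x + b *\<^sub>R G x)"
    using representsD(3)[OF f] representsD(3)[OF g] by (rule bounded_clinear_combination)
  show "cinner x (a *\<^sub>R F x + b *\<^sub>R G x)
      = complex_of_real ((norm x)\<^sup>2 * (\<integral>t. a * f t + b * g t \<partial>moment_dist x))" for x
    using representsD(6)[OF f, of x] representsD(6)[OF g, of x]
    by (simp add: cinner_add_right cinner_scaleR_right representsD(4)[OF f] representsD(4)[OF g] algebra_simps)
  show "a *\<^sub>R F (B x) + b *\<^sub>R G (B x) = B (a *\<^sub>R F x + b *\<^sub>R G x)"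
    if "bounded_clinear B" "\<forall>x y. cinner (B x) y = cinner x (B y)" "A \<circ> B = B \<circ> A" for B x
    using that representsD(5)[OF f, of B x] representsD(5)[OF g, of B x] by (simp add: bounded_clinearD(2,6))
qed

text \<open>Dominated convergence handles the diagonal, separately for each vector's measure.
  Polarization then makes all matrix elements converge, and their limit is a bounded Hermitian form,
  hence an operator. Convergence is only weak, which explains the second conclusion.\<close>

lemma represents_limit:
  assumes f: "\<And>n::nat. represents (f n) (F n)" and C: "\<And>n t. t \<in> {0..1} \<Longrightarrow> \<bar>f n t\<bar> \<le> C"
    and lim: "\<And>t. t \<in> {0..1} \<Longrightarrow> (\<lambda>n. f n t) \<longlonglongrightarrow> g t" and g: "g \<in> borel_measurable borel"
  obtains G where "represents g G" "\<And>x y. (\<lambda>n. cinner x (F n y)) \<longlonglongrightarrow> cinner x (G y)"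
proof -
  have gC: "\<bar>g t\<bar> \<le> C" if t: "t \<in> {0..1}" for t
    by (rule Lim_bounded[OF tendsto_rabs[OF lim[OF t]], of 0]) (use C t in auto)
  define q where "q x = complex_of_real ((norm x)\<^sup>2 * integral\<^sup>L (moment_dist x) g)" for x
  have q: "(\<lambda>n. cinner x (F n x)) \<longlonglongrightarrow> q x" for x
  proof -
    interpret real_distribution "moment_dist x" by (rule moment_dist)
    have "(\<lambda>n. integral\<^sup>L (moment_dist x) (f n)) \<longlonglongrightarrow> integral\<^sup>L (moment_dist x) g"
    proof (rule integral_dominated_convergence[where w = "\<lambda>_. C"])
      show "AE t in moment_dist x. (\<lambda>n. f n t) \<longlonglongrightarrow> g t" using moment_dist(2) by eventually_elim (rule lim)
      show "AE t in moment_dist x. norm (f n t) \<le> C" for n using moment_dist(2) by eventually_elim (use C in auto)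
    qed (use g representsD(1)[OF f] in auto)
    then show ?thesis unfolding representsD(4)[OF f] q_def by (intro tendsto_intros)
  qed
  define b where "b x y = (q (x + y) - q (x - y) - \<i> * q (x + \<i> *\<^sub>C y) + \<i> * q (x - \<i> *\<^sub>C y)) / 4" for x y
  have b: "(\<lambda>n. cinner x (F n y)) \<longlonglongrightarrow> b x y" for x y
  proof -
    have eq: "cinner x (F n y) = (cinner (x + y) (F n (x + y)) - cinner (x - y) (F n (x - y))
      - \<i> * cinner (x + \<i> *\<^sub>C y) (F n (x + \<i> *\<^sub>C y)) + \<i> * cinner (x - \<i> *\<^sub>C y) (F n (x - \<i> *\<^sub>C y))) / 4" for n
      using polarization[OF sesquilinear_operator[OF representsD(3)[OF f[of n]]], of x y] by (simp add: field_simps)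
    show ?thesis unfolding eq b_def by (intro tendsto_intros q) simp
  qed
  have bq: "b x x = q x" for x using LIMSEQ_unique[OF b q] .
  have "hermitian_form b UNIV"
    unfolding hermitian_form_def
  proof (intro conjI ballI allI)
    show "b x (y + z) = b x y + b x z" for x y z
      by (rule LIMSEQ_unique[OF b])
        (simp add: bounded_clinearD(2)[OF representsD(3)[OF f]] cinner_add_right tendsto_add[OF b b])
    show "b x (c *\<^sub>C y) = c * b x y" for c x y
      by (rule LIMSEQ_unique[OF b])
        (simp add: bounded_clinearD(3)[OF representsD(3)[OF f]] cinner_scaleC_right tendsto_mult[OF tendsto_const b])
    show "b x y = cnj (b y x)" for x y
    proof (rule LIMSEQ_unique[OF b])
      have "cinner x (F n y) = cnj (cinner y (F n x))" for n
        using represents_symmetric[OF f, of n x y] cinner_commute[of y "F n x"] by simp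
      then show "(\<lambda>n. cinner x (F n y)) \<longlonglongrightarrow> cnj (b y x)" using tendsto_cnj[OF b[of y x]] by simp
    qed
  qed (auto intro: complex_vector.subspace_UNIV)
  moreover have "cmod (b x x) \<le> C * (norm x)\<^sup>2" for x
  proof -
    interpret real_distribution "moment_dist x" by (rule moment_dist)
    have "\<bar>integral\<^sup>L (moment_dist x) g\<bar> \<le> (\<integral>t. \<bar>g t\<bar> \<partial>moment_dist x)" by (rule integral_abs_bound)
    also have "\<dots> \<le> (\<integral>t. C \<partial>moment_dist x)"
    proof (rule integral_mono_AE)
      show "integrable (moment_dist x) (\<lambda>t. \<bar>g t\<bar>)" using moment_dist_integrable[OF g gC] by simp
      show "AE t in moment_dist x. \<bar>g t\<bar> \<le> C" using moment_dist(2) by eventually_elim (rule gC)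
    qed simp
    finally have "\<bar>integral\<^sup>L (moment_dist x) g\<bar> \<le> C" using prob_space by simp
    then have "(norm x)\<^sup>2 * \<bar>integral\<^sup>L (moment_dist x) g\<bar> \<le> (norm x)\<^sup>2 * C" by (rule mult_left_mono) simp
    then show ?thesis unfolding bq q_def norm_of_real by (simp add: abs_mult mult.commute)
  qed
  ultimately obtain G where G: "bounded_clinear G" "\<And>x y. cinner x (G y) = b x y"
    using bounded_form_operator[of b UNIV C] by (metis UNIV_I)
  have "represents g G"
    unfolding represents_def
  proof (intro conjI allI impI)
    show "G (B x) = B (G x)"
      if B: "bounded_clinear B" "\<forall>x y. cinner (B x) y = cinner x (B y)" "A \<circ> B = B \<circ> A" for B x
    proof (rule cinner_eqI)
      fix z
      have "cinner z (F n (B x)) = cinner (B z) (F n x)" for n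
        using representsD(5)[OF f, of B n x] B by simp
      then have "(\<lambda>n. cinner z (F n (B x))) \<longlonglongrightarrow> b (B z) x" using b by simp
      then show "cinner z (G (B x)) = cinner z (B (G x))"
        using LIMSEQ_unique[OF b] G(2) B(2) by metis
    qed
    show "\<exists>C. \<forall>t\<in>{0..1}. \<bar>g t\<bar> \<le> C" using gC by blast
    show "cinner x (G x) = complex_of_real ((norm x)\<^sup>2 * integral\<^sup>L (moment_dist x) g)" for x
      by (simp only: G(2) bq q_def)
  qed (fact g G(1))+
  then show ?thesis using that b G(2) by simp
qed

text \<open>For fixed \<open>K\<close>, the property that \<open>f(A)\<close> composed with
  \<open>K\<close> represents \<open>f * h\<close> is linear in \<open>f\<close> and survives weak
  limits, since these are respected by multiplication on the right with a fixed operator. It is used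
  with \<open>K\<close> the identity to get spectral projections, then with a polynomial and with a
  spectral projection to get products.\<close>

lemma represents_indicator_mult:
  assumes K: "bounded_clinear K" and h: "h \<in> borel_measurable borel" "\<And>t. t \<in> {0..1} \<Longrightarrow> \<bar>h t\<bar> \<le> C"
    and pol: "\<And>p. represents (\<lambda>t. poly p t * h t) (poly_op p \<circ> K)" and \<sigma>: "\<sigma> \<in> sets borel"
  shows "\<exists>G. represents (indicator \<sigma>) G \<and> represents (\<lambda>t. indicator \<sigma> t * h t) (G \<circ> K)"
proof (rule indicator_class[where P = "\<lambda>g. \<exists>G. represents g G \<and> represents (\<lambda>t. g t * h t) (G \<circ> K)", OF _ _ _ \<sigma>])
  show "\<exists>G. represents (poly p) G \<and> represents (\<lambda>t. poly p t * h t) (G \<circ> K)" for p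
    using pol represents_poly by blast
next
  fix f g a b
  assume "\<exists>G. represents f G \<and> represents (\<lambda>t. f t * h t) (G \<circ> K)"
    and "\<exists>G. represents g G \<and> represents (\<lambda>t. g t * h t) (G \<circ> K)"
  then obtain F G where F: "represents f F" "represents (\<lambda>t. f t * h t) (F \<circ> K)"
    and G: "represents g G" "represents (\<lambda>t. g t * h t) (G \<circ> K)" by blast
  have "represents (\<lambda>t. a * (f t * h t) + b * (g t * h t)) (\<lambda>x. a *\<^sub>R (F \<circ> K) x + b *\<^sub>R (G \<circ> K) x)"
    by (rule represents_combination[OF F(2) G(2)])
  moreover have "(\<lambda>t. a * (f t * h t) + b * (g t * h t)) = (\<lambda>t. (a * f t + b * g t) * h t)"
    by (auto simp: algebra_simps)
  moreover have "(\<lambda>x. a *\<^sub>R (F \<circ> K) x + b *\<^sub>R (G \<circ> K) x) = (\<lambda>x. a *\<^sub>R F x + b *\<^sub>R G x) \<circ> K" by auto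
  ultimately show "\<exists>G. represents (\<lambda>t. a * f t + b * g t) G \<and> represents (\<lambda>t. (a * f t + b * g t) * h t) (G \<circ> K)"
    using represents_combination[OF F(1) G(1), of a b] by metis
next
  fix f :: "nat \<Rightarrow> real \<Rightarrow> real" and g D
  assume "\<And>n. \<exists>G. represents (f n) G \<and> represents (\<lambda>t. f n t * h t) (G \<circ> K)"
    and bd: "\<And>n t. t \<in> {0..1} \<Longrightarrow> \<bar>f n t\<bar> \<le> D" and lim: "\<And>t. t \<in> {0..1} \<Longrightarrow> (\<lambda>n. f n t) \<longlonglongrightarrow> g t"
    and g: "g \<in> borel_measurable borel"
  then obtain F where F: "\<And>n. represents (f n) (F n)" "\<And>n. represents (\<lambda>t. f n t * h t) (F n \<circ> K)" by metis
  obtain G where G: "represents g G" "\<And>x y. (\<lambda>n. cinner x (F n y)) \<longlonglongrightarrow> cinner x (G y)"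
    using represents_limit[OF F(1) bd lim g] by blast
  obtain H where H: "represents (\<lambda>t. g t * h t) H" "\<And>x y. (\<lambda>n. cinner x ((F n \<circ> K) y)) \<longlonglongrightarrow> cinner x (H y)"
  proof (rule represents_limit[OF F(2), where C = "D * C" and g = "\<lambda>t. g t * h t"])
    show "\<bar>f n t * h t\<bar> \<le> D * C" if t: "t \<in> {0..1}" for n t
    proof -
      have "0 \<le> D" using bd[OF t, of n] abs_ge_zero[of "f n t"] by linarith
      then show ?thesis unfolding abs_mult using bd[OF t] h(2)[OF t] by (intro mult_mono) auto
    qed
    show "(\<lambda>n. f n t * h t) \<longlonglongrightarrow> g t * h t" if "t \<in> {0..1}" for t
      by (intro tendsto_mult lim[OF that] tendsto_const)
    show "(\<lambda>t. g t * h t) \<in> borel_measurable borel" using g h(1) by measurable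
  qed auto
  have "H = G \<circ> K"
  proof
    fix y
    show "H y = (G \<circ> K) y"
    proof (rule cinner_eqI)
      fix x
      show "cinner x (H y) = cinner x ((G \<circ> K) y)"
        using LIMSEQ_unique[OF H(2)[of x y], of "cinner x (G (K y))"] G(2)[of x "K y"] by simp
    qed
  qed
  then show "\<exists>G. represents g G \<and> represents (\<lambda>t. g t * h t) (G \<circ> K)" using G(1) H(1) by blast
qed

definition spec :: "real set \<Rightarrow> 'h \<Rightarrow> 'h" where
  "spec \<sigma> = (SOME F. represents (indicator \<sigma>) F)"

lemma represents_spec: "\<sigma> \<in> sets borel \<Longrightarrow> represents (indicator \<sigma>) (spec \<sigma>)"
proof -
  assume "\<sigma> \<in> sets borel"
  moreover have "represents (\<lambda>t. poly p t * 1) (poly_op p \<circ> id)" for p using represents_poly[of p] by simp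
  ultimately have "\<exists>F. represents (indicator \<sigma>) F"
    using represents_indicator_mult[of id "\<lambda>_. 1" 1 \<sigma>] bounded_clinear_id by auto
  then show ?thesis unfolding spec_def by (rule someI_ex)
qed

lemma poly_op_comm_A: "A \<circ> poly_op p = poly_op p \<circ> A"
  using poly_op_commute[OF bc refl, of p] by (auto simp: fun_eq_iff)

text \<open>The factor that is passed to the limit has to stand on the left. So
  \<open>spec \<tau>\<close> is first reached with a polynomial on its right, then exchanged with
  that polynomial, and then the polynomial is replaced by \<open>spec \<sigma>\<close>.\<close>

lemma represents_spec_Int:
  assumes \<sigma>: "\<sigma> \<in> sets borel" and \<tau>: "\<tau> \<in> sets borel"
  shows "represents (indicator (\<sigma> \<inter> \<tau>)) (spec \<sigma> \<circ> spec \<tau>)"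
proof -
  have pt: "represents (\<lambda>t. poly p t * indicator \<tau> t) (poly_op p \<circ> spec \<tau>)" for p
  proof -
    have pq: "represents (\<lambda>t. poly q t * poly p t) (poly_op q \<circ> poly_op p)" for q
    proof -
      have "poly_op (q * p) = poly_op q \<circ> poly_op p" "poly (q * p) = (\<lambda>t. poly q t * poly p t)"
        by (auto simp: poly_op_mult)
      then show ?thesis using represents_poly[of "q * p"] by simp
    qed
    obtain C where C: "\<And>t. t \<in> {0..1} \<Longrightarrow> \<bar>poly p t\<bar> \<le> C" using representsD(2)[OF represents_poly[of p]] by blast
    obtain G where G: "represents (indicator \<tau>) G" "represents (\<lambda>t. indicator \<tau> t * poly p t) (G \<circ> poly_op p)"
      using represents_indicator_mult[OF poly_op_bounded_clinear representsD(1)[OF represents_poly] C pq \<tau>] by blast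
    have "G = spec \<tau>" using G(1) represents_spec[OF \<tau>] by (rule represents_unique)
    \<comment> \<open>The commutation clause of \<open>represents\<close> performs the exchange,
      polynomials in \<open>A\<close> being symmetric and commuting with \<open>A\<close>.\<close>
    moreover have "G (poly_op p x) = poly_op p (G x)" for x
      using representsD(5)[OF G(1) poly_op_bounded_clinear poly_op_symmetric poly_op_comm_A] .
    then have "G \<circ> poly_op p = poly_op p \<circ> G" by auto
    ultimately show ?thesis using G(2) by (simp add: mult.commute)
  qed
  obtain G where G: "represents (indicator \<sigma>) G" "represents (\<lambda>t. indicator \<sigma> t * indicator \<tau> t) (G \<circ> spec \<tau>)"
    using represents_indicator_mult[OF representsD(3)[OF represents_spec[OF \<tau>]]
        representsD(1)[OF represents_spec[OF \<tau>]] _ pt \<sigma>, of 1] by (auto simp: indicator_def)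
  have "G = spec \<sigma>" using G(1) represents_spec[OF \<sigma>] by (rule represents_unique)
  moreover have "(\<lambda>t. indicator \<sigma> t * indicator \<tau> t) = (indicator (\<sigma> \<inter> \<tau>) :: real \<Rightarrow> real)"
    by (auto simp: indicator_def)
  ultimately show ?thesis using G(2) by simp
qed

lemma spec_norm:
  assumes "\<sigma> \<in> sets borel"
  shows "(norm (spec \<sigma> x))\<^sup>2 = (norm x)\<^sup>2 * measure (moment_dist x) \<sigma>"
proof -
  interpret real_distribution "moment_dist x" by (rule moment_dist)
  have "spec \<sigma> \<circ> spec \<sigma> = spec \<sigma>"
    by (rule represents_unique[OF represents_spec_Int[OF assms assms, unfolded Int_absorb] represents_spec[OF assms]])
  from fun_cong[OF this, of x] have "spec \<sigma> (spec \<sigma> x) = spec \<sigma> x" by simp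
  then have "complex_of_real ((norm (spec \<sigma> x))\<^sup>2) = cinner x (spec \<sigma> x)"
    using represents_symmetric[OF represents_spec[OF assms], of x "spec \<sigma> x"] by (simp add: cinner_self)
  also have "\<dots> = complex_of_real ((norm x)\<^sup>2 * measure (moment_dist x) \<sigma>)"
    using assms by (simp add: representsD(4)[OF represents_spec[OF assms]])
  finally show ?thesis using of_real_eq_iff by blast
qed

lemma spec_pvm: "projection_valued_measure spec"
proof (rule projection_valued_measureI)
  show "bounded_clinear (spec \<sigma>)" "cinner (spec \<sigma> x) y = cinner x (spec \<sigma> y)"
    if "\<sigma> \<in> sets borel" for \<sigma> x y
    using representsD(3) represents_symmetric represents_spec[OF that] by blast+
  show "spec \<sigma> (spec \<tau> x) = spec (\<sigma> \<inter> \<tau>) x" if "\<sigma> \<in> sets borel" "\<tau> \<in> sets borel" for \<sigma> \<tau> x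
    using represents_unique[OF represents_spec_Int[OF that] represents_spec] that by (metis comp_apply sets.Int)
  show "spec UNIV x = x" for x
  proof -
    have "(indicator UNIV :: real \<Rightarrow> real) = poly 1" by auto
    then have "spec UNIV = poly_op 1"
      using represents_unique[OF represents_spec[of UNIV], of "poly_op 1"] represents_poly[of 1] by simp
    then show ?thesis by (simp add: poly_op_simps)
  qed
  show "spec {} x = 0" for x
    using spec_norm[of "{}" x] by simp
  show "(\<lambda>i. (norm (spec (s i) x))\<^sup>2) sums (norm (spec (\<Union>i. s i) x))\<^sup>2"
    if s: "range s \<subseteq> sets borel" "disjoint_family s" for s :: "nat \<Rightarrow> _" and x
  proof -
    interpret real_distribution "moment_dist x" by (rule moment_dist)
    have [simp]: "s i \<in> sets borel" for i using s by auto
    have [simp]: "(\<Union>i. s i) \<in> sets borel" using s by (intro sets.countable_nat_UN) auto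
    have "(\<lambda>i. measure (moment_dist x) (s i)) sums measure (moment_dist x) (\<Union>i. s i)"
      by (rule finite_measure_UNION) (use s in auto)
    then show ?thesis by (simp add: spec_norm sums_mult)
  qed
qed

text \<open>The density restores the squared norm by which the moment functional was
  divided.\<close>

lemma spectral_measure_spec: "spectral_measure spec x = density (moment_dist x) (\<lambda>_. ennreal ((norm x)\<^sup>2))"
proof (rule measure_eqI)
  fix \<sigma> assume "\<sigma> \<in> sets (spectral_measure spec x)"
  then have \<sigma>: "\<sigma> \<in> sets borel" by simp
  interpret real_distribution "moment_dist x" by (rule moment_dist)
  show "emeasure (spectral_measure spec x) \<sigma> = emeasure (density (moment_dist x) (\<lambda>_. ennreal ((norm x)\<^sup>2))) \<sigma>"
    using \<sigma> by (simp add: emeasure_spectral_measure[OF spec_pvm] spec_norm emeasure_density_const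
        emeasure_eq_measure ennreal_mult')
qed (simp add: moment_dist_sets)

lemma spectral_measure_spec_poly:
  "integral\<^sup>L (spectral_measure spec x) (poly p) = Re (cinner x (poly_op p x))"
proof -
  have "poly p \<in> borel_measurable (moment_dist x)" "(\<lambda>_. (norm x)\<^sup>2) \<in> borel_measurable (moment_dist x)"
    using representsD(1)[OF represents_poly] by (simp_all add: measurable_cong_sets[OF moment_dist_sets refl])
  then show ?thesis
    unfolding spectral_measure_spec by (subst integral_density) (auto simp: moment_dist(3))
qed

lemma spectral_measure_spec_AE: "AE t in spectral_measure spec x. t \<in> {0..1}"
  unfolding spectral_measure_spec using moment_dist(2)[of x] by (subst AE_density) (auto elim: eventually_mono)

end

text \<open>Only two moments are recorded: the first gives the form, the second the domain of an
  orthogonal sum. The commutation clause makes the resolution respect the blocks, and the bound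
  \<open>K\<close> makes the moments on a block finite.\<close>

definition spectral_resolution ::
  "('h::complex_hilbert \<Rightarrow> 'h) \<Rightarrow> (real set \<Rightarrow> 'h \<Rightarrow> 'h) \<Rightarrow> real \<Rightarrow> bool" where
  "spectral_resolution T E K \<longleftrightarrow> projection_valued_measure E \<and>
     (\<forall>\<sigma>\<in>sets borel. \<forall>B. bounded_clinear B \<longrightarrow> (\<forall>x y. cinner (B x) y = cinner x (B y)) \<longrightarrow>
        (\<forall>x. T (B x) = B (T x)) \<longrightarrow> (\<forall>x. E \<sigma> (B x) = B (E \<sigma> x))) \<and>
     (\<forall>x. (AE t in spectral_measure E x. \<bar>t\<bar> \<le> K) \<and>
        (\<integral>t. t \<partial>spectral_measure E x) = Re (cinner x (T x)) \<and>
        (\<integral>t. t\<^sup>2 \<partial>spectral_measure E x) = (norm (T x))\<^sup>2)"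

theorem ex_spectral_resolution:
  assumes T: "bounded_clinear T" and sym: "\<And>x y. cinner (T x) y = cinner x (T y)"
  shows "\<exists>E K. spectral_resolution T E K"
proof -
  obtain K where K: "0 < K" "\<And>x. norm (T x) \<le> norm x * K"
    using bounded_linear.pos_bounded[OF bounded_clinearD(1)[OF T]] by blast
  \<comment> \<open>In the sense of forms \<open>T\<close> lies between \<open>- K\<close> and
    \<open>K\<close>, so this affine image lies between 0 and 1.\<close>
  define A where "A x = (1 / (2 * K)) *\<^sub>R T x + (1 / 2) *\<^sub>R id x" for x
  have A: "bounded_clinear A" unfolding A_def by (rule bounded_clinear_combination[OF T bounded_clinear_id])
  have ReA: "Re (cinner x (A x)) = Re (cinner x (T x)) / (2 * K) + (norm x)\<^sup>2 / 2" for x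
    by (simp add: A_def cinner_add_right cinner_scaleR_right cinner_self)
  have ReT: "\<bar>Re (cinner x (T x))\<bar> \<le> K * (norm x)\<^sup>2" for x
  proof -
    have "\<bar>Re (cinner x (T x))\<bar> \<le> cmod (cinner x (T x))" by (rule abs_Re_le_cmod)
    also have "\<dots> \<le> norm x * norm (T x)" by (rule cinner_Cauchy_Schwarz)
    also have "\<dots> \<le> norm x * (norm x * K)" using K by (intro mult_left_mono) auto
    finally show ?thesis by (simp add: power2_eq_square mult_ac)
  qed
  interpret positive_contraction A
  proof
    show "cinner (A x) y = cinner x (A y)" for x y
      by (simp add: A_def cinner_add_right cinner_scaleR_right cinner_add_left cinner_scaleR_left sym)
    show "0 \<le> Re (cinner x (A x))" "Re (cinner x (A x)) \<le> (norm x)\<^sup>2" for x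
      using ReT[of x] K(1) by (simp_all add: ReA abs_le_iff field_simps)
  qed (rule A)
  \<comment> \<open>The inverse of the affine map that defines \<open>A\<close>; it maps the unit
    interval onto \<open>[- K, K]\<close>.\<close>
  let ?p = "[:- K, 2 * K:]"
  have poly_op_T: "poly_op ?p x = T x" for x
    using K(1) by (simp add: poly_op_pCons poly_op_0 bounded_clinearD(5,6)[OF A]) (simp add: A_def scaleR_add_right)
  have meas: "poly q \<in> borel_measurable borel" for q :: "real poly"
    by (rule representsD(1)[OF represents_poly])
  define E where "E \<sigma> = spec (poly ?p -` \<sigma>)" for \<sigma>
  have sm: "spectral_measure E x = distr (spectral_measure spec x) borel (poly ?p)" for x
    unfolding E_def by (rule pvm_vimage[OF spec_pvm meas])
  have "spectral_resolution T E K"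
    unfolding spectral_resolution_def
  proof (intro conjI allI ballI impI)
    show "projection_valued_measure E" unfolding E_def by (rule pvm_vimage[OF spec_pvm meas])
    show "E \<sigma> (B x) = B (E \<sigma> x)"
      if "\<sigma> \<in> sets borel" and B: "bounded_clinear B" "\<forall>x y. cinner (B x) y = cinner x (B y)" "\<forall>x. T (B x) = B (T x)"
      for \<sigma> B x
    proof -
      have "A \<circ> B = B \<circ> A" using B(3) by (auto simp: A_def bounded_clinearD(2,6)[OF B(1)])
      moreover have "poly ?p -` \<sigma> \<in> sets borel" using measurable_sets[OF meas that(1)] by simp
      ultimately show ?thesis unfolding E_def using representsD(5)[OF represents_spec B(1)] B(2) by blast
    qed
    show "AE t in spectral_measure E x. \<bar>t\<bar> \<le> K" for x
      unfolding sm
    proof (subst AE_distr_iff)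
      show "AE t in spectral_measure spec x. \<bar>poly ?p t\<bar> \<le> K"
        using spectral_measure_spec_AE
      proof eventually_elim
        fix t :: real assume "t \<in> {0..1}"
        then have "0 \<le> K * t" "K * t \<le> K" using K(1) by (auto intro: mult_left_le)
        then show "\<bar>poly ?p t\<bar> \<le> K" by (simp add: mult.commute abs_le_iff)
      qed
    qed (use meas in \<open>auto simp: measurable_cong_sets[OF spectral_measure_sets refl]\<close>)
    have int: "(\<integral>t. f t \<partial>spectral_measure E x) = (\<integral>t. f (poly ?p t) \<partial>spectral_measure spec x)"
      if "f \<in> borel_measurable borel" for f :: "real \<Rightarrow> real" and x
      unfolding sm by (rule integral_distr) (use meas that in \<open>auto simp: measurable_cong_sets[OF spectral_measure_sets refl]\<close>)
    show "(\<integral>t. t \<partial>spectral_measure E x) = Re (cinner x (T x))" for x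
    proof -
      have "(\<lambda>t. t) \<in> borel_measurable (borel :: real measure)" by simp
      from int[OF this, of x] spectral_measure_spec_poly[of x ?p] show ?thesis by (simp only: poly_op_T)
    qed
    show "(\<integral>t. t\<^sup>2 \<partial>spectral_measure E x) = (norm (T x))\<^sup>2" for x
    proof -
      have "(\<lambda>t. (poly ?p t)\<^sup>2) = poly (?p * ?p)" by (rule ext) (simp only: poly_mult power2_eq_square)
      then have "(\<integral>t. t\<^sup>2 \<partial>spectral_measure E x) = Re (cinner x (poly_op (?p * ?p) x))"
        using int[of "\<lambda>t. t\<^sup>2" x] by (simp only: spectral_measure_spec_poly) simp
      also have "\<dots> = Re (cinner (T x) (T x))" by (simp only: poly_op_mult poly_op_T assms(2))
      finally show ?thesis by (simp add: cinner_self)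
    qed
  qed
  then show ?thesis by blast
qed

section \<open>Orthogonal sums of bounded symmetric operators\<close>

lemma nn_integral_measure_suminf:
  assumes sets: "sets M = sets L" "\<And>i::nat. sets (N i) = sets L"
    and eq: "\<And>\<sigma>. \<sigma> \<in> sets L \<Longrightarrow> emeasure M \<sigma> = (\<Sum>i. emeasure (N i) \<sigma>)"
    and u: "u \<in> borel_measurable L"
  shows "(\<integral>\<^sup>+t. u t \<partial>M) = (\<Sum>i. \<integral>\<^sup>+t. u t \<partial>N i)"
proof -
  note [measurable_cong] = sets
  have sp: "space M = space L" "space (N i) = space L" for i
    using sets by (auto dest: sets_eq_imp_space_eq)
  show ?thesis using u
  proof (induction rule: borel_measurable_induct)
    case (cong f g)
    then have "(\<integral>\<^sup>+t. f t \<partial>M) = (\<integral>\<^sup>+t. g t \<partial>M)" by (intro nn_integral_cong) (simp add: sp)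
    moreover have "(\<integral>\<^sup>+t. f t \<partial>N i) = (\<integral>\<^sup>+t. g t \<partial>N i)" for i
      using cong by (intro nn_integral_cong) (simp add: sp)
    ultimately show ?case using cong by simp
  next
    case (set A)
    then show ?case using eq sets by simp
  next
    case (mult u c)
    have [measurable]: "u \<in> borel_measurable L" by fact
    show ?case using mult by (simp add: nn_integral_cmult)
  next
    case (add u v)
    have [measurable]: "u \<in> borel_measurable L" "v \<in> borel_measurable L" by fact+
    show ?case using add by (simp add: nn_integral_add suminf_add[OF summableI summableI])
  next
    case (seq U)
    have [measurable]: "U i \<in> borel_measurable L" for i by fact
    have "(\<integral>\<^sup>+t. (SUP j. U j) t \<partial>M) = (SUP j. \<integral>\<^sup>+t. U j t \<partial>M)"
      unfolding SUP_apply by (rule nn_integral_monotone_convergence_SUP[OF \<open>incseq U\<close>]) measurable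
    moreover have "(\<integral>\<^sup>+t. (SUP j. U j) t \<partial>N i) = (SUP j. \<integral>\<^sup>+t. U j t \<partial>N i)" for i
      unfolding SUP_apply by (rule nn_integral_monotone_convergence_SUP[OF \<open>incseq U\<close>]) measurable
    moreover have "(\<Sum>i. SUP j. \<integral>\<^sup>+t. U j t \<partial>N i) = (SUP j. \<Sum>i. \<integral>\<^sup>+t. U j t \<partial>N i)"
      using \<open>incseq U\<close> by (intro ennreal_suminf_SUP_eq) (auto simp: incseq_def le_fun_def intro!: nn_integral_mono)
    ultimately show ?case using seq.IH by simp
  qed
qed

text \<open>Lifts the setwise estimate for the spectral measure of a sum of vectors to integrals;
  this is how the form domain is seen to be a subspace.\<close>

lemma nn_integral_measure_le:
  assumes sets: "sets M = sets L" "sets N = sets L" "sets N' = sets L"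
    and le: "\<And>\<sigma>. \<sigma> \<in> sets L \<Longrightarrow> emeasure M \<sigma> \<le> c * (emeasure N \<sigma> + emeasure N' \<sigma>)"
    and u: "u \<in> borel_measurable L"
  shows "(\<integral>\<^sup>+t. u t \<partial>M) \<le> c * ((\<integral>\<^sup>+t. u t \<partial>N) + (\<integral>\<^sup>+t. u t \<partial>N'))"
proof -
  note [measurable_cong] = sets
  have sp: "space M = space L" "space N = space L" "space N' = space L"
    using sets by (auto dest: sets_eq_imp_space_eq)
  show ?thesis using u
  proof (induction rule: borel_measurable_induct)
    case (cong f g)
    have "(\<integral>\<^sup>+t. f t \<partial>R) = (\<integral>\<^sup>+t. g t \<partial>R)" if "space R = space L" for R
      using cong that by (intro nn_integral_cong) simp
    then show ?case using cong by (simp add: sp)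
  next
    case (set A)
    then show ?case using le sets by simp
  next
    case (mult u d)
    have [measurable]: "u \<in> borel_measurable L" by fact
    have "d * (\<integral>\<^sup>+t. u t \<partial>M) \<le> d * (c * ((\<integral>\<^sup>+t. u t \<partial>N) + (\<integral>\<^sup>+t. u t \<partial>N')))"
      using mult by (intro mult_left_mono) auto
    then show ?case by (simp add: nn_integral_cmult algebra_simps)
  next
    case (add u v)
    have [measurable]: "u \<in> borel_measurable L" "v \<in> borel_measurable L" by fact+
    show ?case using mult_left_mono[OF add_mono[OF add.IH], of 1] by (simp add: nn_integral_add algebra_simps)
  next
    case (seq U)
    have [measurable]: "U i \<in> borel_measurable L" for i by fact
    have "(\<integral>\<^sup>+t. (SUP j. U j) t \<partial>M) = (SUP j. \<integral>\<^sup>+t. U j t \<partial>M)"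
      unfolding SUP_apply by (rule nn_integral_monotone_convergence_SUP[OF \<open>incseq U\<close>]) measurable
    also have "\<dots> \<le> c * ((\<integral>\<^sup>+t. (SUP j. U j) t \<partial>N) + (\<integral>\<^sup>+t. (SUP j. U j) t \<partial>N'))"
    proof (rule SUP_least)
      fix j
      have "(\<integral>\<^sup>+t. U j t \<partial>M) \<le> c * ((\<integral>\<^sup>+t. U j t \<partial>N) + (\<integral>\<^sup>+t. U j t \<partial>N'))" by (rule seq.IH)
      also have "\<dots> \<le> c * ((\<integral>\<^sup>+t. (SUP j. U j) t \<partial>N) + (\<integral>\<^sup>+t. (SUP j. U j) t \<partial>N'))"
        by (intro mult_left_mono add_mono nn_integral_mono) (auto intro: SUP_upper)
      finally show "(\<integral>\<^sup>+t. U j t \<partial>M) \<le> \<dots>" .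
    qed
    finally show ?case .
  qed
qed

lemma sums_enn2real:
  assumes "(\<Sum>n. a n) \<noteq> (top :: ennreal)"
  shows "(\<lambda>n. enn2real (a n)) sums enn2real (\<Sum>n. a n)"
proof -
  have "a n \<noteq> top" for n
    using assms ennreal_suminf_lessD[of a top n] by (simp add: less_top[symmetric])
  then have "(\<lambda>n. ennreal (enn2real (a n))) sums ennreal (enn2real (\<Sum>n. a n))"
    using summable_sums[OF summableI, of a] assms by (simp add: less_top)
  then show ?thesis by (subst (asm) sums_ennreal) auto
qed

lemma suminf_swap_ennreal: "(\<Sum>i::nat. \<Sum>j::nat. f i j :: ennreal) = (\<Sum>j. \<Sum>i. f i j)"
proof -
  have "(\<Sum>i. \<Sum>j. f i j) = (\<integral>\<^sup>+i. (\<Sum>j. f i j) \<partial>count_space UNIV)" by (simp add: nn_integral_count_space_nat)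
  also have "\<dots> = (\<Sum>j. \<integral>\<^sup>+i. f i j \<partial>count_space UNIV)" by (rule nn_integral_suminf) simp
  finally show ?thesis by (simp add: nn_integral_count_space_nat)
qed

section \<open>The resolution of the identity of an orthogonal sum\<close>

locale orthogonal_operators =
  fixes P T :: "nat \<Rightarrow> 'h::complex_hilbert \<Rightarrow> 'h"
  assumes P_bc: "bounded_clinear (P n)" and P_sym: "cinner (P n x) y = cinner x (P n y)"
    and P_idem: "P n (P n x) = P n x" and P_orth: "m \<noteq> n \<Longrightarrow> P m (P n x) = 0"
    and P_sums: "(\<lambda>n. P n x) sums x"
    and T_bc: "bounded_clinear (T n)" and T_sym: "cinner (T n x) y = cinner x (T n y)"
    and TP: "T n (P n x) = T n x" and PT: "P n (T n x) = T n x"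
begin

text \<open>Resolution and bound are chosen as one pair, so that the bound belongs to the chosen
  resolution.\<close>

definition block_resolution :: "nat \<Rightarrow> (real set \<Rightarrow> 'h \<Rightarrow> 'h) \<times> real" where
  "block_resolution n = (SOME EK. spectral_resolution (T n) (fst EK) (snd EK))"

abbreviation "En n \<equiv> fst (block_resolution n)"
abbreviation "Kn n \<equiv> snd (block_resolution n)"

lemma block_resolution: "spectral_resolution (T n) (En n) (Kn n)"
proof -
  have "\<exists>EK. spectral_resolution (T n) (fst EK) (snd EK)"
    using ex_spectral_resolution[OF T_bc T_sym, of n] by auto
  then show ?thesis unfolding block_resolution_def by (rule someI_ex)
qed

lemma En_pvm: "projection_valued_measure (En n)"
  using block_resolution[of n] unfolding spectral_resolution_def by blast

lemma En_P: assumes \<sigma>: "\<sigma> \<in> sets borel" shows "En n \<sigma> (P n x) = P n (En n \<sigma> x)"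
proof -
  have "\<forall>x. T n (P n x) = P n (T n x)" by (simp add: TP PT)
  then show ?thesis using block_resolution[of n] \<sigma> P_bc[of n] P_sym[of n] unfolding spectral_resolution_def by blast
qed

text \<open>\<open>T n\<close> vanishes off its block, so \<open>En n\<close> acts on the whole
  space and puts the rest of a vector as mass at 0. Applying \<open>P n\<close> beforehand removes
  that mass, and the blocks then add up correctly.\<close>

definition N :: "nat \<Rightarrow> 'h \<Rightarrow> real measure" where "N n x = spectral_measure (En n) (P n x)"

lemma N_sets [simp, measurable_cong]: "sets (N n x) = sets borel"
  by (simp add: N_def)

lemma N_space [simp]: "space (N n x) = UNIV"
  by (simp add: N_def)

lemma N_finite: "finite_measure (N n x)"
  unfolding N_def by (rule finite_spectral_measure[OF En_pvm])

lemma N_total: "measure (N n x) UNIV = (norm (P n x))\<^sup>2"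
  by (simp add: N_def measure_def emeasure_spectral_measure[OF En_pvm] pvm_rules(5)[OF En_pvm])

lemma N_bound: "AE t in N n x. \<bar>t\<bar> \<le> Kn n"
  using block_resolution[of n] unfolding spectral_resolution_def N_def by blast

lemma N_moments:
  "(\<integral>t. t \<partial>N n x) = Re (cinner x (T n x))" "(\<integral>t. t\<^sup>2 \<partial>N n x) = (norm (T n x))\<^sup>2"
proof -
  have "(\<integral>t. t \<partial>N n x) = Re (cinner (P n x) (T n (P n x)))" "(\<integral>t. t\<^sup>2 \<partial>N n x) = (norm (T n (P n x)))\<^sup>2"
    using block_resolution[of n] unfolding spectral_resolution_def N_def by blast+
  then show "(\<integral>t. t \<partial>N n x) = Re (cinner x (T n x))" "(\<integral>t. t\<^sup>2 \<partial>N n x) = (norm (T n x))\<^sup>2"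
    by (simp_all add: TP PT P_sym)
qed

lemma block_orth:
  assumes "m \<noteq> n" "P m x = x" "P n y = y" shows "cinner x y = 0"
proof -
  have "cinner x y = cinner (P m x) (P n y)" using assms by simp
  also have "\<dots> = cinner x (P m (P n y))" by (simp add: P_sym)
  finally show ?thesis using P_orth[OF assms(1)] by simp
qed

lemma block_suminf:
  assumes v: "\<And>n. P n (v n) = v n" "v sums w"
  shows "P n w = v n" "(\<lambda>n. (norm (v n))\<^sup>2) sums (norm w)\<^sup>2"
proof -
  have P: "P n w = v n" for n
  proof -
    have "(\<lambda>m. P n (v m)) sums P n w"
      using bounded_linear.sums[OF bounded_clinearD(1)[OF P_bc] v(2)] .
    moreover have "P n (v m) = 0" if "m \<noteq> n" for m
      using P_orth[of n m "v m"] that v(1)[of m] by simp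
    then have "(\<lambda>m. P n (v m)) sums P n (v n)"
      using sums_finite[of "{n}" "\<lambda>m. P n (v m)"] by simp
    ultimately show ?thesis using sums_unique2 v(1) by metis
  qed
  then show "P n w = v n" .
  have "cinner (v n) w = cinner (v n) (v n)" for n
    using P_sym[of n "v n" w] v(1)[of n] P by simp
  moreover have "cinner (v m) (v n) = 0" if "m \<noteq> n" for m n using block_orth[OF that v(1) v(1)] .
  ultimately show "(\<lambda>n. (norm (v n))\<^sup>2) sums (norm w)\<^sup>2"
    using orthogonal_sums_iff_norm[of v w] v(2) by simp
qed

lemma P_norm_sums: "(\<lambda>n. (norm (P n x))\<^sup>2) sums (norm x)\<^sup>2"
  by (rule block_suminf(2)[OF P_idem P_sums])

definition E :: "real set \<Rightarrow> 'h \<Rightarrow> 'h" where "E \<sigma> x = (\<Sum>n. En n \<sigma> (P n x))"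

lemma En_block: "\<sigma> \<in> sets borel \<Longrightarrow> P n (En n \<sigma> (P n x)) = En n \<sigma> (P n x)"
  by (simp add: En_P P_idem)

lemma E_sums:
  assumes \<sigma>: "\<sigma> \<in> sets borel"
  shows "(\<lambda>n. En n \<sigma> (P n x)) sums E \<sigma> x"
proof -
  have "summable (\<lambda>n. (norm (En n \<sigma> (P n x)))\<^sup>2)"
  proof (rule summable_comparison_test')
    show "norm ((norm (En n \<sigma> (P n x)))\<^sup>2) \<le> (norm (P n x))\<^sup>2" if "0 \<le> n" for n
      using pvm_norm_le[OF En_pvm \<sigma>, of n "P n x"] by (simp add: power_mono)
  qed (rule sums_summable[OF P_norm_sums])
  then have "summable (\<lambda>n. En n \<sigma> (P n x))"
    by (subst orthogonal_summable_iff) (auto intro: block_orth En_block[OF \<sigma>])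
  then show ?thesis unfolding E_def by (rule summable_sums)
qed

lemma P_E: "\<sigma> \<in> sets borel \<Longrightarrow> P n (E \<sigma> x) = En n \<sigma> (P n x)"
  by (rule block_suminf(1)[OF En_block E_sums])

lemma E_norm_sums: "\<sigma> \<in> sets borel \<Longrightarrow> (\<lambda>n. (norm (En n \<sigma> (P n x)))\<^sup>2) sums (norm (E \<sigma> x))\<^sup>2"
  by (rule block_suminf(2)[OF En_block E_sums])

text \<open>Read through \<open>emeasure_spectral_measure\<close>, this makes the spectral measure
  of the orthogonal sum the sum of the block measures.\<close>

lemma E_norm_suminf:
  assumes "\<sigma> \<in> sets borel"
  shows "ennreal ((norm (E \<sigma> x))\<^sup>2) = (\<Sum>n. emeasure (N n x) \<sigma>)"
proof -
  have "(\<Sum>n. ennreal ((norm (En n \<sigma> (P n x)))\<^sup>2)) = ennreal ((norm (E \<sigma> x))\<^sup>2)"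
    by (rule suminf_ennreal_eq[OF _ E_norm_sums[OF assms]]) simp
  then show ?thesis by (simp add: N_def emeasure_spectral_measure[OF En_pvm assms])
qed

lemma E_bounded_clinear: assumes \<sigma>: "\<sigma> \<in> sets borel" shows "bounded_clinear (E \<sigma>)"
proof -
  note lin = bounded_clinearD(2,3)[OF pvm_rules(1)[OF En_pvm \<sigma>]] bounded_clinearD(2,3)[OF P_bc]
  have add: "E \<sigma> (x + y) = E \<sigma> x + E \<sigma> y" for x y
    using sums_unique2[OF E_sums[OF \<sigma>, of "x + y"]] sums_add[OF E_sums[OF \<sigma>, of x] E_sums[OF \<sigma>, of y]]
    by (simp add: lin)
  have sc: "E \<sigma> (c *\<^sub>C x) = c *\<^sub>C E \<sigma> x" for c x
    using sums_unique2[OF E_sums[OF \<sigma>, of "c *\<^sub>C x"]]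
      bounded_linear.sums[OF bounded_linear_scaleC E_sums[OF \<sigma>, of x], of c]
    by (simp add: lin)
  have "norm (E \<sigma> x) \<le> norm x" for x
  proof -
    have "(norm (E \<sigma> x))\<^sup>2 \<le> (norm x)\<^sup>2"
      by (rule sums_le[OF _ E_norm_sums[OF \<sigma>] P_norm_sums]) (simp add: pvm_norm_le[OF En_pvm \<sigma>] power_mono)
    then show ?thesis by (simp add: power2_le_iff_abs_le)
  qed
  then have "bounded_linear (E \<sigma>)"
    using add sc[of "complex_of_real _"] by (intro bounded_linear_intro[of _ 1]) (auto simp: scaleC_of_real)
  then show ?thesis using add sc by (simp add: bounded_clinear_def clinear_on_def)
qed

lemma E_pvm: "projection_valued_measure E"
proof (rule projection_valued_measureI)
  show "cinner (E \<sigma> x) y = cinner x (E \<sigma> y)" if \<sigma>: "\<sigma> \<in> sets borel" for \<sigma> x y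
  proof -
    have "cinner (En n \<sigma> (P n x)) y = cinner x (En n \<sigma> (P n y))" for n
      by (simp add: pvm_rules(2)[OF En_pvm \<sigma>] P_sym flip: En_P[OF \<sigma>])
    then have "(\<lambda>n. cinner (En n \<sigma> (P n x)) y) sums cinner x (E \<sigma> y)"
      using sums_cinner_right[OF E_sums[OF \<sigma>, of y], of x] by simp
    with sums_cinner_left[OF E_sums[OF \<sigma>, of x], of y] show ?thesis by (rule sums_unique2)
  qed
  show "E UNIV x = x" for x
    using sums_unique2[OF E_sums[of UNIV x]] P_sums[of x] by (simp add: pvm_rules(5)[OF En_pvm])
  show "E {} x = 0" for x
    by (simp add: E_def pvm_rules(6)[OF En_pvm])
  show "E \<sigma> (E \<tau> x) = E (\<sigma> \<inter> \<tau>) x" if "\<sigma> \<in> sets borel" "\<tau> \<in> sets borel" for \<sigma> \<tau> x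
    unfolding E_def[of \<sigma>] E_def[of "\<sigma> \<inter> \<tau>"] using that by (simp add: P_E pvm_rules(3)[OF En_pvm])
  show "(\<lambda>i. (norm (E (s i) x))\<^sup>2) sums (norm (E (\<Union>i. s i) x))\<^sup>2"
    if s: "range s \<subseteq> sets borel" "disjoint_family s" for s :: "nat \<Rightarrow> _" and x
  proof -
    have [simp]: "s i \<in> sets borel" for i using s by auto
    have [simp]: "(\<Union>i. s i) \<in> sets borel" using s by (intro sets.countable_nat_UN) auto
    have "(\<Sum>i. ennreal ((norm (E (s i) x))\<^sup>2)) = (\<Sum>n. \<Sum>i. emeasure (N n x) (s i))"
      by (simp add: E_norm_suminf) (rule suminf_swap_ennreal)
    also have "\<dots> = (\<Sum>n. emeasure (N n x) (\<Union>i. s i))"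
      by (intro suminf_cong suminf_emeasure) (use s in auto)
    also have "\<dots> = ennreal ((norm (E (\<Union>i. s i) x))\<^sup>2)" by (simp add: E_norm_suminf)
    finally have "(\<lambda>i. ennreal ((norm (E (s i) x))\<^sup>2)) sums ennreal ((norm (E (\<Union>i. s i) x))\<^sup>2)"
      using summable_sums[OF summableI, of "\<lambda>i. ennreal ((norm (E (s i) x))\<^sup>2)"] by simp
    then show ?thesis by simp
  qed
qed (rule E_bounded_clinear)

lemma spectral_nn_integral:
  assumes "u \<in> borel_measurable borel"
  shows "(\<integral>\<^sup>+t. u t \<partial>spectral_measure E x) = (\<Sum>n. \<integral>\<^sup>+t. u t \<partial>N n x)"
  by (rule nn_integral_measure_suminf[OF _ _ _ assms])
    (simp_all add: emeasure_spectral_measure[OF E_pvm] E_norm_suminf)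

text \<open>For nonnegative integrands the blocks always add up; a signed one is split into positive
  and negative part, both with finite sums by integrability.\<close>

lemma spectral_integral_sums:
  fixes g :: "real \<Rightarrow> real"
  assumes g: "integrable (spectral_measure E x) g"
  shows "(\<lambda>n. \<integral>t. g t \<partial>N n x) sums (\<integral>t. g t \<partial>spectral_measure E x)"
proof -
  have m: "g \<in> borel_measurable borel"
    using borel_measurable_integrable[OF g] by (simp add: measurable_cong_sets[OF spectral_measure_sets refl])
  have fin: "(\<Sum>n. \<integral>\<^sup>+t. ennreal (g t) \<partial>N n x) \<noteq> top" "(\<Sum>n. \<integral>\<^sup>+t. ennreal (- g t) \<partial>N n x) \<noteq> top"
    using g m unfolding real_integrable_def by (simp_all add: spectral_nn_integral)
  have "integrable (N n x) g" for n
  proof -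
    have "(\<integral>\<^sup>+t. ennreal (g t) \<partial>N n x) \<noteq> top" "(\<integral>\<^sup>+t. ennreal (- g t) \<partial>N n x) \<noteq> top"
      using fin ennreal_suminf_lessD[of "\<lambda>n. \<integral>\<^sup>+t. ennreal (g t) \<partial>N n x" top n]
        ennreal_suminf_lessD[of "\<lambda>n. \<integral>\<^sup>+t. ennreal (- g t) \<partial>N n x" top n] by (simp_all add: less_top)
    then show ?thesis unfolding real_integrable_def using m by (simp add: measurable_cong_sets[OF N_sets refl])
  qed
  then have "(\<integral>t. g t \<partial>N n x) = enn2real (\<integral>\<^sup>+t. ennreal (g t) \<partial>N n x) - enn2real (\<integral>\<^sup>+t. ennreal (- g t) \<partial>N n x)" for n
    by (rule real_lebesgue_integral_def)
  moreover have "(\<integral>t. g t \<partial>spectral_measure E x)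
      = enn2real (\<Sum>n. \<integral>\<^sup>+t. ennreal (g t) \<partial>N n x) - enn2real (\<Sum>n. \<integral>\<^sup>+t. ennreal (- g t) \<partial>N n x)"
    unfolding real_lebesgue_integral_def[OF g] using m by (simp add: spectral_nn_integral)
  ultimately show ?thesis using sums_diff[OF sums_enn2real[OF fin(1)] sums_enn2real[OF fin(2)]] by simp
qed

section \<open>Domain, operator and form of the orthogonal sum\<close>

definition sum_dom :: "'h set" where "sum_dom = {x. summable (\<lambda>n. T n x)}"

definition sum_op :: "'h \<Rightarrow> 'h" where "sum_op x = (\<Sum>n. T n x)"

definition qdom :: "'h set" where "qdom = calculus_domain E (\<lambda>t. sqrt \<bar>t\<bar>)"

definition qform :: "'h \<Rightarrow> 'h \<Rightarrow> complex" where "qform x y = (\<Sum>n. cinner x (T n y))"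

lemma sum_dom_iff: "x \<in> sum_dom \<longleftrightarrow> summable (\<lambda>n. (norm (T n x))\<^sup>2)"
  unfolding sum_dom_def by (simp add: orthogonal_summable_iff block_orth[OF _ PT PT])

lemma sum_op_sums: "x \<in> sum_dom \<Longrightarrow> (\<lambda>n. T n x) sums sum_op x"
  unfolding sum_dom_def sum_op_def by (simp add: summable_sums)

lemma qdom_iff: "x \<in> qdom \<longleftrightarrow> integrable (spectral_measure E x) (\<lambda>t. \<bar>t\<bar>)"
  by (simp add: qdom_def calculus_domain_def)

lemma qdom_iff_nn: "x \<in> qdom \<longleftrightarrow> (\<integral>\<^sup>+t. ennreal \<bar>t\<bar> \<partial>spectral_measure E x) < top"
  unfolding qdom_iff by (subst integrable_iff_bounded)
    (simp add: measurable_cong_sets[OF spectral_measure_sets refl])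

text \<open>The second moment on block \<open>n\<close> is \<open>(norm (T n x))\<^sup>2\<close>, so
  integrability of the square is square summability, which for orthogonal terms is convergence of
  the series.\<close>

lemma sum_dom_eq_calculus_domain: "sum_dom = calculus_domain E (\<lambda>t. t)"
proof -
  have "(\<integral>\<^sup>+t. ennreal (t\<^sup>2) \<partial>spectral_measure E x) = (\<Sum>n. ennreal ((norm (T n x))\<^sup>2))" for x
  proof -
    have "(\<integral>\<^sup>+t. ennreal (t\<^sup>2) \<partial>N n x) = ennreal ((norm (T n x))\<^sup>2)" for n
    proof -
      interpret finite_measure "N n x" by (rule N_finite)
      have "integrable (N n x) (\<lambda>t. t\<^sup>2)"
      proof (rule integrable_const_bound[of _ "(Kn n)\<^sup>2"])
        show "AE t in N n x. norm (t\<^sup>2) \<le> (Kn n)\<^sup>2"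
          using N_bound by eventually_elim (simp add: abs_le_square_iff[symmetric])
      qed (simp add: measurable_cong_sets[OF N_sets refl])
      then show ?thesis by (simp add: nn_integral_eq_integral N_moments)
    qed
    then show ?thesis by (simp add: spectral_nn_integral)
  qed
  then have "x \<in> calculus_domain E (\<lambda>t. t) \<longleftrightarrow> (\<Sum>n. ennreal ((norm (T n x))\<^sup>2)) < top" for x
    unfolding calculus_domain_def
    by (simp add: integrable_iff_bounded measurable_cong_sets[OF spectral_measure_sets refl])
  moreover have "(\<Sum>n. ennreal ((norm (T n x))\<^sup>2)) < top \<longleftrightarrow> summable (\<lambda>n. (norm (T n x))\<^sup>2)" for x
    unfolding less_top[symmetric]
    using summable_suminf_not_top[of "\<lambda>n. (norm (T n x))\<^sup>2"] ennreal_suminf_neq_top[of "\<lambda>n. (norm (T n x))\<^sup>2"]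
    by (meson zero_le_power2)
  ultimately show ?thesis by (intro set_eqI) (simp only: sum_dom_iff)
qed

lemma sum_dom_subset_qdom: "sum_dom \<subseteq> qdom"
proof
  fix x assume "x \<in> sum_dom"
  then have i: "integrable (spectral_measure E x) (\<lambda>t. t\<^sup>2)"
    by (simp add: sum_dom_eq_calculus_domain calculus_domain_def)
  interpret finite_measure "spectral_measure E x" by (rule finite_spectral_measure[OF E_pvm])
  have "integrable (spectral_measure E x) (\<lambda>t. \<bar>t\<bar>)"
  proof (rule Bochner_Integration.integrable_bound)
    show "integrable (spectral_measure E x) (\<lambda>t. 1 + t\<^sup>2)" using i by simp
    have "\<bar>t\<bar> \<le> 1 + t\<^sup>2" for t :: real
      using zero_le_power2[of "\<bar>t\<bar> - 1/2"] by (simp add: power2_eq_square algebra_simps)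
    then show "AE t in spectral_measure E x. norm \<bar>t\<bar> \<le> norm (1 + t\<^sup>2)" by (simp add: abs_of_nonneg)
  qed (simp add: measurable_cong_sets[OF spectral_measure_sets refl])
  then show "x \<in> qdom" by (simp add: qdom_iff)
qed

lemma P_in_sum_dom: "P n x \<in> sum_dom" "sum_op (P n x) = T n x"
proof -
  have "T m (P n x) = 0" if "m \<noteq> n" for m
    using TP[of m "P n x"] P_orth[OF that, of x] bounded_clinearD(5)[OF T_bc] by simp
  then have "(\<lambda>m. T m (P n x)) sums T n (P n x)"
    using sums_finite[of "{n}" "\<lambda>m. T m (P n x)"] by simp
  then show "P n x \<in> sum_dom" "sum_op (P n x) = T n x"
    unfolding sum_dom_def sum_op_def by (auto simp: TP sums_iff)
qed

lemma sum_dom_csubspace: "csubspace sum_dom"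
proof (rule complex_vector.subspaceI)
  show "x + y \<in> sum_dom" if "x \<in> sum_dom" "y \<in> sum_dom" for x y
    using that by (simp add: sum_dom_def bounded_clinearD(2)[OF T_bc] summable_add)
  show "c *\<^sub>C x \<in> sum_dom" if "x \<in> sum_dom" for c x
    using that bounded_linear.summable[OF bounded_linear_scaleC] by (simp add: sum_dom_def bounded_clinearD(3)[OF T_bc])
qed (simp add: sum_dom_def bounded_clinearD(5)[OF T_bc])

lemma sum_dom_dense: "closure sum_dom = UNIV"
proof -
  have "x \<in> closure sum_dom" for x
    unfolding closure_sequential
  proof (intro exI conjI allI)
    show "(\<Sum>n<m. P n x) \<in> sum_dom" for m
      by (intro complex_vector.subspace_sum[OF sum_dom_csubspace] P_in_sum_dom(1))
    show "(\<lambda>m. \<Sum>n<m. P n x) \<longlonglongrightarrow> x" using P_sums[of x] by (simp add: sums_def)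
  qed
  then show ?thesis by auto
qed

lemma self_adjoint_sum_op: "self_adjoint sum_dom sum_op"
  unfolding self_adjoint_def
proof (intro conjI allI sum_dom_csubspace sum_dom_dense)
  show "clinear_on sum_dom sum_op" unfolding clinear_on_def
  proof (intro conjI ballI allI)
    show "sum_op (x + y) = sum_op x + sum_op y" if "x \<in> sum_dom" "y \<in> sum_dom" for x y
      using sums_add[OF sum_op_sums[OF that(1)] sum_op_sums[OF that(2)]]
      by (simp add: sum_op_def bounded_clinearD(2)[OF T_bc] sums_iff)
    show "sum_op (c *\<^sub>C x) = c *\<^sub>C sum_op x" if "x \<in> sum_dom" for c x
      using bounded_linear.sums[OF bounded_linear_scaleC sum_op_sums[OF that], of c]
      by (simp add: sum_op_def bounded_clinearD(3)[OF T_bc] sums_iff)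
  qed
  fix x y
  show "x \<in> sum_dom \<and> sum_op x = y \<longleftrightarrow> (\<forall>z\<in>sum_dom. cinner x (sum_op z) = cinner y z)"
  proof
    assume x: "x \<in> sum_dom \<and> sum_op x = y"
    show "\<forall>z\<in>sum_dom. cinner x (sum_op z) = cinner y z"
    proof
      fix z assume "z \<in> sum_dom"
      then have "(\<lambda>n. cinner x (T n z)) sums cinner x (sum_op z)" by (intro sums_cinner_right sum_op_sums)
      moreover have "(\<lambda>n. cinner (T n x) z) sums cinner y z" using x sum_op_sums[of x] by (intro sums_cinner_left) auto
      ultimately show "cinner x (sum_op z) = cinner y z" by (simp add: T_sym sums_unique2)
    qed
  next
    assume y: "\<forall>z\<in>sum_dom. cinner x (sum_op z) = cinner y z"
    \<comment> \<open>Testing the adjoint relation with vectors of a single block identifies the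
      components of \<open>y\<close>. Their series converges to \<open>y\<close>, which puts
      \<open>x\<close> into the domain.\<close>
    have "T n x = P n y" for n
    proof (rule cinner_eqI)
      fix z
      have "cinner (T n x) z = cinner (P n y) z"
        using bspec[OF y P_in_sum_dom(1)[of n z]] by (simp add: P_in_sum_dom(2) T_sym P_sym)
      then show "cinner z (T n x) = cinner z (P n y)" by (metis cinner_commute)
    qed
    then have "(\<lambda>n. T n x) sums y" using P_sums by simp
    then show "x \<in> sum_dom \<and> sum_op x = y" by (auto simp: sum_dom_def sum_op_def sums_iff)
  qed
qed

lemma cinner_T_real: "cinner x (T n x) = complex_of_real (Re (cinner x (T n x)))"
proof -
  have "cnj (cinner x (T n x)) = cinner x (T n x)"
    using T_sym[of n x x] cinner_commute[of "T n x" x] by simp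
  then show ?thesis by (simp add: complex_eq_iff)
qed

lemma qform_diag_sums:
  assumes "x \<in> qdom"
  shows "(\<lambda>n. cinner x (T n x)) sums complex_of_real (\<integral>t. t \<partial>spectral_measure E x)"
proof -
  have "integrable (spectral_measure E x) (\<lambda>t. t)"
    using assms unfolding qdom_iff
    by (subst (asm) integrable_abs_iff) (simp_all add: measurable_cong_sets[OF spectral_measure_sets refl])
  from spectral_integral_sums[OF this]
  have "(\<lambda>n. complex_of_real (Re (cinner x (T n x)))) sums complex_of_real (\<integral>t. t \<partial>spectral_measure E x)"
    by (simp add: N_moments sums_of_real_iff)
  then show ?thesis by (simp flip: cinner_T_real)
qed

lemma resolution_sum_op: "resolution_of_identity E sum_dom sum_op"
  unfolding resolution_of_identity_def
proof (intro conjI ballI E_pvm sum_dom_eq_calculus_domain)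
  fix x assume x: "x \<in> sum_dom"
  have "(\<lambda>n. cinner x (T n x)) sums cinner x (sum_op x)" by (intro sums_cinner_right sum_op_sums x)
  moreover have "x \<in> qdom" using x sum_dom_subset_qdom by blast
  ultimately show "cinner x (sum_op x) = complex_of_real (\<integral>t. t \<partial>spectral_measure E x)"
    using qform_diag_sums sums_unique2 by blast
qed

lemma qdom_csubspace: "csubspace qdom"
proof (rule complex_vector.subspaceI)
  show "0 \<in> qdom" using complex_vector.subspace_0[OF sum_dom_csubspace] sum_dom_subset_qdom by blast
  show "x + y \<in> qdom" if "x \<in> qdom" "y \<in> qdom" for x y
  proof -
    have "(\<integral>\<^sup>+t. ennreal \<bar>t\<bar> \<partial>spectral_measure E (x + y))
      \<le> 2 * ((\<integral>\<^sup>+t. ennreal \<bar>t\<bar> \<partial>spectral_measure E x) + (\<integral>\<^sup>+t. ennreal \<bar>t\<bar> \<partial>spectral_measure E y))"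
    proof (rule nn_integral_measure_le[of _ borel])
      fix \<sigma> :: "real set" assume \<sigma>: "\<sigma> \<in> sets borel"
      have "(norm (a + b))\<^sup>2 \<le> 2 * ((norm a)\<^sup>2 + (norm b)\<^sup>2)" for a b :: 'h
      proof -
        have "(norm (a + b))\<^sup>2 \<le> (norm (a + b))\<^sup>2 + (norm (a - b))\<^sup>2" by simp
        also have "\<dots> = 2 * ((norm a)\<^sup>2 + (norm b)\<^sup>2)"
          by (simp add: power2_norm_eq_inner inner_diff inner_add inner_commute)
        finally show ?thesis .
      qed
      then have "ennreal ((norm (E \<sigma> (x + y)))\<^sup>2) \<le> ennreal (2 * ((norm (E \<sigma> x))\<^sup>2 + (norm (E \<sigma> y))\<^sup>2))"
        by (intro ennreal_leI) (simp add: bounded_clinearD(2)[OF E_bounded_clinear[OF \<sigma>]])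
      also have "\<dots> = 2 * ennreal ((norm (E \<sigma> x))\<^sup>2 + (norm (E \<sigma> y))\<^sup>2)"
        by (subst ennreal_mult) auto
      finally show "emeasure (spectral_measure E (x + y)) \<sigma>
          \<le> 2 * (emeasure (spectral_measure E x) \<sigma> + emeasure (spectral_measure E y) \<sigma>)"
        using \<sigma> by (simp add: emeasure_spectral_measure[OF E_pvm] flip: ennreal_plus)
    qed simp_all
    also have "\<dots> < top" using that by (simp add: qdom_iff_nn ennreal_mult_less_top)
    finally show ?thesis by (simp add: qdom_iff_nn)
  qed
  show "c *\<^sub>C x \<in> qdom" if "x \<in> qdom" for c x
  proof -
    have "(\<integral>\<^sup>+t. ennreal \<bar>t\<bar> \<partial>spectral_measure E (c *\<^sub>C x))
      \<le> ennreal ((cmod c)\<^sup>2) * ((\<integral>\<^sup>+t. ennreal \<bar>t\<bar> \<partial>spectral_measure E x) + (\<integral>\<^sup>+t. ennreal \<bar>t\<bar> \<partial>spectral_measure E x))"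
    \<comment> \<open>The comparison has two measures on its right side; both are taken equal, at
      the price of a factor 2 that does not affect finiteness.\<close>
    proof (rule nn_integral_measure_le[of _ borel])
      fix \<sigma> :: "real set" assume \<sigma>: "\<sigma> \<in> sets borel"
      have "emeasure (spectral_measure E (c *\<^sub>C x)) \<sigma> = ennreal ((cmod c)\<^sup>2) * emeasure (spectral_measure E x) \<sigma>"
        using \<sigma> by (simp add: emeasure_spectral_measure[OF E_pvm] bounded_clinearD(3)[OF E_bounded_clinear]
            norm_scaleC power_mult_distrib ennreal_mult)
      then show "emeasure (spectral_measure E (c *\<^sub>C x)) \<sigma>
          \<le> ennreal ((cmod c)\<^sup>2) * (emeasure (spectral_measure E x) \<sigma> + emeasure (spectral_measure E x) \<sigma>)"
        by (simp add: mult_left_mono)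
    qed simp_all
    also have "\<dots> < top" using that by (simp add: qdom_iff_nn ennreal_mult_less_top)
    finally show ?thesis by (simp add: qdom_iff_nn)
  qed
qed

text \<open>Off the diagonal each term is a fixed combination of four diagonal terms, whose series
  converge on the subspace \<open>qdom\<close>.\<close>

lemma qform_sums:
  assumes x: "x \<in> qdom" and y: "y \<in> qdom"
  shows "(\<lambda>n. cinner x (T n y)) sums qform x y"
proof -
  note sub = complex_vector.subspace_add[OF qdom_csubspace] complex_vector.subspace_diff[OF qdom_csubspace]
    complex_vector.subspace_scale[OF qdom_csubspace]
  have s: "summable (\<lambda>n. cinner z (T n z))" if "z \<in> qdom" for z
    using qform_diag_sums[OF that] by (rule sums_summable)
  have eq: "(\<lambda>n. cinner x (T n y)) = (\<lambda>n. (cinner (x + y) (T n (x + y)) - cinner (x - y) (T n (x - y))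
      - \<i> * cinner (x + \<i> *\<^sub>C y) (T n (x + \<i> *\<^sub>C y)) + \<i> * cinner (x - \<i> *\<^sub>C y) (T n (x - \<i> *\<^sub>C y))) / 4)"
  proof
    fix n
    show "cinner x (T n y) = (cinner (x + y) (T n (x + y)) - cinner (x - y) (T n (x - y))
      - \<i> * cinner (x + \<i> *\<^sub>C y) (T n (x + \<i> *\<^sub>C y)) + \<i> * cinner (x - \<i> *\<^sub>C y) (T n (x - \<i> *\<^sub>C y))) / 4"
      using polarization[OF sesquilinear_operator[OF T_bc[of n]], of x y] by (simp add: field_simps)
  qed
  have "summable (\<lambda>n. cinner x (T n y))"
    unfolding eq by (intro summable_divide summable_add summable_diff summable_mult s sub x y)
  then show ?thesis unfolding qform_def by (rule summable_sums)
qed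

lemma hermitian_qform: "hermitian_form qform qdom"
  unfolding hermitian_form_def
proof (intro conjI ballI allI qdom_csubspace)
  note sub = complex_vector.subspace_add[OF qdom_csubspace] complex_vector.subspace_scale[OF qdom_csubspace]
  show "closure qdom = UNIV" using closure_mono[OF sum_dom_subset_qdom] sum_dom_dense by auto
  show "qform x (y + z) = qform x y + qform x z" if "x \<in> qdom" "y \<in> qdom" "z \<in> qdom" for x y z
  proof (rule sums_unique2)
    show "(\<lambda>n. cinner x (T n (y + z))) sums qform x (y + z)" using that sub by (intro qform_sums)
    show "(\<lambda>n. cinner x (T n (y + z))) sums (qform x y + qform x z)"
      using sums_add[OF qform_sums[OF that(1,2)] qform_sums[OF that(1,3)]]
      by (simp add: bounded_clinearD(2)[OF T_bc] cinner_add_right)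
  qed
  show "qform x (c *\<^sub>C y) = c * qform x y" if "x \<in> qdom" "y \<in> qdom" for c x y
  proof (rule sums_unique2)
    show "(\<lambda>n. cinner x (T n (c *\<^sub>C y))) sums qform x (c *\<^sub>C y)" using that sub by (intro qform_sums)
    show "(\<lambda>n. cinner x (T n (c *\<^sub>C y))) sums (c * qform x y)"
      using sums_mult[OF qform_sums[OF that], of c]
      by (simp add: bounded_clinearD(3)[OF T_bc] cinner_scaleC_right)
  qed
  show "qform x y = cnj (qform y x)" if "x \<in> qdom" "y \<in> qdom" for x y
  proof (rule sums_unique2[OF qform_sums[OF that]])
    have "cinner x (T n y) = cnj (cinner y (T n x))" for n
      using T_sym[of n x y] cinner_commute[of y "T n x"] by simp
    then show "(\<lambda>n. cinner x (T n y)) sums cnj (qform y x)"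
      using qform_sums[OF that(2,1)] by (simp add: sums_cnj)
  qed
qed

lemma N_spectral_norm_le: "(\<integral>t. 1 + \<bar>t\<bar> \<partial>N n x) \<le> (1 + \<bar>Kn n\<bar>) * (norm (P n x))\<^sup>2"
proof -
  interpret finite_measure "N n x" by (rule N_finite)
  have "(\<integral>t. 1 + \<bar>t\<bar> \<partial>N n x) \<le> (\<integral>t. 1 + \<bar>Kn n\<bar> \<partial>N n x)"
  proof (rule integral_mono_AE)
    show "integrable (N n x) (\<lambda>t. 1 + \<bar>t\<bar>)"
    proof (rule integrable_const_bound[of _ "1 + \<bar>Kn n\<bar>"])
      show "AE t in N n x. norm (1 + \<bar>t\<bar>) \<le> 1 + \<bar>Kn n\<bar>" using N_bound by eventually_elim auto
    qed (simp add: measurable_cong_sets[OF N_sets refl])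
    show "AE t in N n x. 1 + \<bar>t\<bar> \<le> 1 + \<bar>Kn n\<bar>" using N_bound by eventually_elim auto
  qed simp
  then show ?thesis using N_total[of n x] by (simp add: mult.commute)
qed

text \<open>The squared spectral norm splits into blocks. Far blocks contribute a small tail of
  \<open>x\<close> alone, provided that the approximant has no components there; on the remaining
  finitely many blocks a common bound reduces the claim to approximation in the Hilbert
  norm.\<close>

lemma qdom_approximation:
  assumes D: "csubspace D" "closure D = UNIV" "\<And>n x. x \<in> D \<Longrightarrow> P n x \<in> D" "D \<subseteq> sum_dom"
    and x: "x \<in> qdom" and e: "0 < e"
  shows "\<exists>y\<in>D. spectral_norm E (x - y) < e"
proof -
  define r where "r z n = (\<integral>t. 1 + \<bar>t\<bar> \<partial>N n z)" for z n
  have r_sums: "r z sums (\<integral>t. 1 + \<bar>t\<bar> \<partial>spectral_measure E z)" if "z \<in> qdom" for z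
  proof -
    interpret finite_measure "spectral_measure E z" by (rule finite_spectral_measure[OF E_pvm])
    have "integrable (spectral_measure E z) (\<lambda>t. 1 + \<bar>t\<bar>)" using that by (simp add: qdom_iff)
    then show ?thesis unfolding r_def by (rule spectral_integral_sums)
  qed
  have "(\<lambda>m. suminf (r x) - (\<Sum>n<m. r x n)) \<longlonglongrightarrow> suminf (r x) - suminf (r x)"
    using r_sums[OF x] by (intro tendsto_intros summable_LIMSEQ) (simp add: sums_iff)
  then have "\<forall>\<^sub>F m in sequentially. suminf (r x) - (\<Sum>n<m. r x n) < e\<^sup>2 / 2"
    using e by (intro order_tendstoD(2)) auto
  then obtain m where m: "suminf (r x) - (\<Sum>n<m. r x n) < e\<^sup>2 / 2"
    using eventually_happens'[OF sequentially_bot] by blast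
  \<comment> \<open>A sum is used as a convenient upper bound of the finitely many constants, valid
    also for \<open>m = 0\<close>.\<close>
  define C where "C = 1 + (\<Sum>n<m. \<bar>Kn n\<bar>)"
  have C: "1 \<le> C" unfolding C_def by (simp add: sum_nonneg)
  have KC: "1 + \<bar>Kn n\<bar> \<le> C" if "n < m" for n
    unfolding C_def using that member_le_sum[of n "{..<m}" "\<lambda>n. \<bar>Kn n\<bar>"] by simp
  \<comment> \<open>Chosen so that \<open>C * d\<^sup>2\<close> is the half of
    \<open>e\<^sup>2\<close> left over by the tail.\<close>
  define d where "d = e / sqrt (2 * C)"
  have d: "0 < d" "C * d\<^sup>2 = e\<^sup>2 / 2" using e C by (auto simp: d_def power_divide)
  have "x \<in> closure D" using D(2) by simp
  then obtain w where w: "w \<in> D" "dist w x < d" unfolding closure_approachable using d(1) by blast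
  \<comment> \<open>Truncation keeps the approximant in \<open>D\<close> and removes its components
    in the far blocks.\<close>
  define y where "y = (\<Sum>n<m. P n w)"
  have y: "y \<in> D" unfolding y_def by (intro complex_vector.subspace_sum[OF D(1)] D(3) w(1))
  have z: "x - y \<in> qdom"
    using complex_vector.subspace_diff[OF qdom_csubspace x] y D(4) sum_dom_subset_qdom by blast
  have Py: "P n y = (if n < m then P n w else 0)" for n
  proof -
    have "P n y = (\<Sum>k<m. P n (P k w))" unfolding y_def by (rule bounded_clinearD(7)[OF P_bc])
    also have "\<dots> = (\<Sum>k<m. if k = n then P n w else 0)"
      by (intro sum.cong refl) (use P_orth P_idem in auto)
    finally show ?thesis by simp
  qed
  have tail: "r (x - y) n = r x n" if "\<not> n < m" for n
    using that by (simp add: r_def N_def bounded_clinearD(4)[OF P_bc] Py)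
  have head: "r (x - y) n \<le> C * (norm (P n (x - w)))\<^sup>2" if "n < m" for n
  proof -
    have "r (x - y) n \<le> (1 + \<bar>Kn n\<bar>) * (norm (P n (x - y)))\<^sup>2" unfolding r_def by (rule N_spectral_norm_le)
    also have "P n (x - y) = P n (x - w)" using that by (simp add: bounded_clinearD(4)[OF P_bc] Py)
    also have "(1 + \<bar>Kn n\<bar>) * (norm (P n (x - w)))\<^sup>2 \<le> C * (norm (P n (x - w)))\<^sup>2"
      using KC[OF that] by (intro mult_right_mono) auto
    finally show ?thesis .
  qed
  have "(\<Sum>n<m. r (x - y) n) \<le> C * (\<Sum>n<m. (norm (P n (x - w)))\<^sup>2)"
    unfolding sum_distrib_left by (intro sum_mono head) simp
  also have "(\<Sum>n<m. (norm (P n (x - w)))\<^sup>2) \<le> (norm (x - w))\<^sup>2"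
    using sum_le_suminf[OF sums_summable[OF P_norm_sums[of "x - w"]], of "{..<m}"] sums_unique[OF P_norm_sums[of "x - w"]]
    by simp
  then have "C * (\<Sum>n<m. (norm (P n (x - w)))\<^sup>2) \<le> C * (norm (x - w))\<^sup>2"
    using C by (intro mult_left_mono) auto
  also have "\<dots> < C * d\<^sup>2"
    using C w(2) by (intro mult_strict_left_mono power_strict_mono) (auto simp: dist_norm norm_minus_commute)
  finally have 1: "(\<Sum>n<m. r (x - y) n) < e\<^sup>2 / 2" using d(2) by simp
  have sm: "summable (r (x - y))" "summable (r x)" using r_sums[OF z] r_sums[OF x] by (auto simp: sums_iff)
  have "suminf (r (x - y)) = (\<Sum>n. r (x - y) (n + m)) + (\<Sum>n<m. r (x - y) n)"
    by (rule suminf_split_initial_segment[OF sm(1)])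
  also have "(\<Sum>n. r (x - y) (n + m)) = (\<Sum>n. r x (n + m))" by (intro suminf_cong tail) simp
  also have "\<dots> = suminf (r x) - (\<Sum>n<m. r x n)"
    using suminf_split_initial_segment[OF sm(2), of m] by simp
  finally have "suminf (r (x - y)) < e\<^sup>2" using 1 m by simp
  then have "spectral_norm E (x - y) < sqrt (e\<^sup>2)"
    unfolding spectral_norm_def sums_unique[OF r_sums[OF z]] by (rule real_sqrt_less_mono)
  then show ?thesis using y e by auto
qed

theorem strongly_representable_sum_op:
  assumes Q: "hermitian_form Q D" and PD: "\<And>n x. x \<in> D \<Longrightarrow> P n x \<in> D" and sum_dom: "D \<subseteq> sum_dom"
    and diag: "\<And>x. x \<in> D \<Longrightarrow> Q x x = cinner x (sum_op x)"
  shows "strongly_representable_by sum_dom sum_op Q D"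
proof -
  have D: "csubspace D" "closure D = UNIV" using Q unfolding hermitian_form_def by blast+
  have qdiag: "qform x x = complex_of_real (\<integral>t. t \<partial>spectral_measure E x)" if "x \<in> qdom" for x
    using sums_unique2[OF qform_sums[OF that that] qform_diag_sums[OF that]] .
  have Dq: "D \<subseteq> qdom" using sum_dom sum_dom_subset_qdom by blast
  have ext: "form_extends qform qdom Q D"
    unfolding form_extends_def
  proof (intro conjI ballI Dq)
    fix x y assume xy: "x \<in> D" "y \<in> D"
    have "sesquilinear_on D qform"
      using hermitian_form_sesquilinear[OF hermitian_qform] D(1) Dq unfolding sesquilinear_on_def by blast
    then show "qform x y = Q x y"
    proof (rule sesquilinear_eqI[OF _ hermitian_form_sesquilinear[OF Q] _ xy])
      fix z assume z: "z \<in> D"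
      have "(\<lambda>n. cinner z (T n z)) sums cinner z (sum_op z)" using z sum_dom by (intro sums_cinner_right sum_op_sums) auto
      then show "qform z z = Q z z" using z Dq diag sums_unique2[OF qform_sums] by fastforce
    qed
  qed
  \<comment> \<open>The closure of \<open>D\<close> in the spectral norm is the entire form domain,
    so \<open>qform\<close> on \<open>qdom\<close> is the extension to be exhibited.\<close>
  have "qdom = {x \<in> qdom. \<forall>e>0. \<exists>y\<in>D. spectral_norm E (x - y) < e}"
    using qdom_approximation[OF D PD sum_dom] by blast
  then have "qdom = {x \<in> calculus_domain E (\<lambda>t. sqrt \<bar>t\<bar>). \<forall>e>0. \<exists>y\<in>D. spectral_norm E (x - y) < e}"
    unfolding qdom_def .
  then show ?thesis
    unfolding strongly_representable_by_def
    using self_adjoint_sum_op resolution_sum_op hermitian_qform ext sum_dom_subset_qdom Dq[unfolded qdom_def] qdiag by blast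
qed

end

section \<open>Invariant forms over a central decomposition\<close>

text \<open>Phrased as a single existential statement, so that one choice gives an operator for
  every set of finite measure together with all its properties.\<close>

lemma invariant_form_local_operator:
  fixes V :: "'g::topological_group_add \<Rightarrow> 'h::complex_hilbert \<Rightarrow> 'h"
  assumes V: "unitary_rep UNIV V" and cd: "central_decomposition \<mu> Hf S J V Vf"
    and Q: "hermitian_form Q D" and G: "G_invariant_form \<mu> (dint_proj \<mu> S J) V Q D"
    and ps: "projection_system \<mu> (dint_proj \<mu> S J)"
    and \<Delta>: "\<Delta> \<in> sets \<mu>" "emeasure \<mu> \<Delta> < \<infinity>"
  shows "\<exists>T. bounded_clinear T \<and> (\<forall>x y. cinner (T x) y = cinner x (T y)) \<and>
    (\<forall>x\<in>D. \<forall>y\<in>D. cinner x (T y) = Q (dint_proj \<mu> S J \<Delta> x) (dint_proj \<mu> S J \<Delta> y)) \<and>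
    (\<forall>\<Delta>'\<in>sets \<mu>. \<forall>x. T (dint_proj \<mu> S J \<Delta>' x) = dint_proj \<mu> S J \<Delta>' (T x))"
proof -
  interpret projection_system \<mu> "dint_proj \<mu> S J" by (rule ps)
  let ?P = "dint_proj \<mu> S J"
  have G1: "?P \<Delta> ` D \<subseteq> D" and
    "\<exists>M>0. \<forall>\<Phi>\<in>D. cmod (Q (?P \<Delta> \<Phi>) (?P \<Delta> \<Phi>)) \<le> M * (norm (?P \<Delta> \<Phi>))\<^sup>2" and
    G4: "\<And>g. V g ` D = D" "\<And>g \<Phi>. \<Phi> \<in> D \<Longrightarrow> Q (V g \<Phi>) (V g \<Phi>) = Q \<Phi> \<Phi>"
    using G \<Delta> unfolding G_invariant_form_def by blast+
  then obtain M where M: "0 < M" "\<And>\<Phi>. \<Phi> \<in> D \<Longrightarrow> cmod (Q (?P \<Delta> \<Phi>) (?P \<Delta> \<Phi>)) \<le> M * (norm (?P \<Delta> \<Phi>))\<^sup>2"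
    by blast
  have centre: "?P \<Delta>' \<in> vN_centre V" if "\<Delta>' \<in> sets \<mu>" for \<Delta>'
    by (rule dint_proj_in_centre[OF cd that])
  have PV: "?P \<Delta> (V g x) = V g (?P \<Delta> x)" for g x
    using vN_centre_commutes[OF V centre[OF \<Delta>(1)], of g] by (metis comp_apply)
  obtain T where T: "bounded_clinear T" "\<And>x y. cinner (T x) y = cinner x (T y)"
    "\<And>x y. x \<in> D \<Longrightarrow> y \<in> D \<Longrightarrow> cinner x (T y) = Q (?P \<Delta> x) (?P \<Delta> y)" "T \<in> commutant (range V)"
  proof (rule invariant_form_operator[OF Q V, of "?P \<Delta>" M])
    show "?P \<Delta> x \<in> D" if "x \<in> D" for x using G1 that by blast
  qed (use proj_bounded_clinear proj_symmetric proj_idem \<Delta>(1) PV M G4 in auto)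
  have "T (?P \<Delta>' x) = ?P \<Delta>' (T x)" if "\<Delta>' \<in> sets \<mu>" for \<Delta>' x
  proof -
    have "?P \<Delta>' \<in> commutant (commutant (range V))"
      using centre[OF that] by (simp add: vN_centre_def vN_generated_def)
    then have "T \<circ> ?P \<Delta>' = ?P \<Delta>' \<circ> T" using T(4) unfolding commutant_def[of "commutant (range V)"] by blast
    then show ?thesis by (metis comp_apply)
  qed
  then show ?thesis using T by blast
qed

theorem theorem5p7:
  fixes V :: "'g::{topological_group_add, t2_space} \<Rightarrow> 'h::complex_hilbert \<Rightarrow> 'h"
    and \<mu> :: "'a::t2_space measure"
    and Hf :: "'a \<Rightarrow> 'k::complex_hilbert set"
    and S :: "('a \<Rightarrow> 'k) set"
    and J :: "('a \<Rightarrow> 'k) \<Rightarrow> 'h"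
    and Vf :: "'a \<Rightarrow> 'g \<Rightarrow> 'k \<Rightarrow> 'k"
    and Q :: "'h \<Rightarrow> 'h \<Rightarrow> complex"
    and D0 :: "'h set"
  assumes "separable_space (euclidean :: 'g topology)"
    and "locally_compact_space (euclidean :: 'g topology)"
    and "separable_space (euclidean :: 'h topology)"
    and "unitary_rep UNIV V"
    and "sigma_finite_measure \<mu>"
    and "central_decomposition \<mu> Hf S J V Vf"
    and "hermitian_form Q D0"
    and "closable_form Q D0"
    and "\<forall>\<Phi>\<in>D0. \<exists>\<Delta>\<in>sets \<mu>. emeasure \<mu> \<Delta> < \<infinity> \<and> dint_proj \<mu> S J \<Delta> \<Phi> = \<Phi>"
  shows "(G_invariant_form \<mu> (dint_proj \<mu> S J) V Q D0 \<longrightarrow>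
            countably_orthogonally_additive \<mu> (dint_proj \<mu> S J) Q D0) \<and>
         (G_invariant_form \<mu> (dint_proj \<mu> S J) V Q D0 \<and> point_supported \<mu> \<longrightarrow>
            (\<exists>DT T. strongly_representable_by DT T Q D0))"
proof -
  let ?P = "dint_proj \<mu> S J"
  have di: "is_direct_integral \<mu> Hf S J"
    using assms(6) unfolding central_decomposition_def by blast
  have ps: "projection_system \<mu> ?P"
    by (rule dint_proj_projection_system[OF di])
      (rule vN_centre_bounded_clinear[OF dint_proj_in_centre[OF assms(6)]])
  interpret projection_system \<mu> ?P by (rule ps)
  have dense: "closure D0 = UNIV" using assms(7) unfolding hermitian_form_def by blast
  have "countably_orthogonally_additive \<mu> ?P Q D0 \<and> (\<exists>DT T. strongly_representable_by DT T Q D0)"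
    if G: "G_invariant_form \<mu> ?P V Q D0"
  proof -
    have PD: "?P \<Delta> x \<in> D0" if "\<Delta> \<in> sets \<mu>" "x \<in> D0" for \<Delta> x
      using G that unfolding G_invariant_form_def by blast
    define loc where "loc \<Delta> = (SOME T. bounded_clinear T \<and> (\<forall>x y. cinner (T x) y = cinner x (T y)) \<and>
      (\<forall>x\<in>D0. \<forall>y\<in>D0. cinner x (T y) = Q (?P \<Delta> x) (?P \<Delta> y)) \<and>
      (\<forall>\<Delta>'\<in>sets \<mu>. \<forall>x. T (?P \<Delta>' x) = ?P \<Delta>' (T x)))" for \<Delta>
    have loc: "bounded_clinear (loc \<Delta>)" "\<And>x y. cinner (loc \<Delta> x) y = cinner x (loc \<Delta> y)"
      "\<And>x y. x \<in> D0 \<Longrightarrow> y \<in> D0 \<Longrightarrow> cinner x (loc \<Delta> y) = Q (?P \<Delta> x) (?P \<Delta> y)"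
      "\<And>\<Delta>' x. \<Delta>' \<in> sets \<mu> \<Longrightarrow> loc \<Delta> (?P \<Delta>' x) = ?P \<Delta>' (loc \<Delta> x)"
      if "\<Delta> \<in> sets \<mu>" "emeasure \<mu> \<Delta> < \<infinity>" for \<Delta>
      using someI_ex[OF invariant_form_local_operator[OF assms(4,6,7) G ps that]]
      unfolding loc_def[symmetric] by blast+
    have supp: "\<exists>\<Delta>\<in>sets \<mu>. emeasure \<mu> \<Delta> < \<infinity> \<and> ?P \<Delta> x = x" if "x \<in> D0" for x
      using assms(9) that by blast
    have "countably_orthogonally_additive \<mu> ?P Q D0"
      unfolding countably_orthogonally_additive_def
    proof (intro conjI ballI allI impI)
      show "?P \<Delta> ` D0 \<subseteq> D0" if "\<Delta> \<in> sets \<mu>" for \<Delta> using PD that by blast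
      fix \<Delta> and \<Delta>s :: "nat \<Rightarrow> 'a set" and x
      assume \<Delta>: "\<Delta> \<in> sets \<mu>" and s: "range \<Delta>s \<subseteq> sets \<mu> \<and> disjoint_family \<Delta>s \<and> (\<Union>i. \<Delta>s i) = \<Delta>"
        and x: "x \<in> D0"
      obtain F where F: "F \<in> sets \<mu>" "emeasure \<mu> F < \<infinity>" "?P F x = x" using supp[OF x] by blast
      \<comment> \<open>Moving both projections to the right argument makes the value linear in
        \<open>?P A x\<close>, so that a convergent series of vectors can be inserted.\<close>
      have eq: "Q (?P A x) (?P A x) = cinner x (loc F (?P A x))" if A: "A \<in> sets \<mu>" for A
      proof -
        have FA: "?P F (?P A x) = ?P A x" using proj_commute[OF F(1) A, of x] F(3) by simp
        have "Q (?P A x) (?P A x) = cinner (?P A x) (loc F (?P A x))"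
          using loc(3)[OF F(1,2) PD[OF A x] PD[OF A x]] FA by simp
        also have "\<dots> = cinner x (loc F (?P A x))"
          by (simp add: proj_symmetric[OF A] proj_idem[OF A] loc(4)[OF F(1,2) A])
        finally show ?thesis .
      qed
      have "(\<lambda>i. ?P (\<Delta>s i) x) sums ?P \<Delta> x" using proj_sums[of \<Delta>s x] s by simp
      then have "(\<lambda>i. cinner x (loc F (?P (\<Delta>s i) x))) sums cinner x (loc F (?P \<Delta> x))"
        by (intro sums_cinner_right bounded_linear.sums[OF bounded_clinearD(1)[OF loc(1)[OF F(1,2)]]])
      moreover have "\<Delta>s i \<in> sets \<mu>" for i using s by auto
      ultimately show "(\<lambda>i. Q (?P (\<Delta>s i) x) (?P (\<Delta>s i) x)) sums Q (?P \<Delta> x) (?P \<Delta> x)"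
        using \<Delta> by (simp add: eq)
    qed
    moreover have "\<exists>DT T. strongly_representable_by DT T Q D0"
    proof -
      \<comment> \<open>The blocks are fixed once and for all and bear no relation to the sets that
        support the individual vectors of \<open>D0\<close>.\<close>
      obtain A :: "nat \<Rightarrow> 'a set" where A: "range A \<subseteq> sets \<mu>" "(\<Union>i. A i) = space \<mu>"
        "\<And>i. emeasure \<mu> (A i) \<noteq> \<infinity>" "disjoint_family A"
        using sigma_finite_measure.sigma_finite_disjoint[OF assms(5)] by blast
      have As: "A n \<in> sets \<mu>" "emeasure \<mu> (A n) < \<infinity>" for n
        using A(1) A(3)[of n] by (auto simp: less_top)
      note locA = loc[OF As]
      \<comment> \<open>On \<open>D0\<close> the compressed form does not change when its second
        argument is projected again; density extends this to all vectors.\<close>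
      have lP: "loc (A n) (?P (A n) x) = loc (A n) x" for n x
      proof -
        have "(loc (A n) \<circ> ?P (A n)) x = loc (A n) x" for x
        proof (rule dense_operator_eqI[OF dense, of "loc (A n) \<circ> ?P (A n)" "loc (A n)"])
          show "bounded_linear (loc (A n) \<circ> ?P (A n))"
            by (rule bounded_clinearD(1)[OF bounded_clinear_compose[OF locA(1) proj_bounded_clinear[OF As(1)]]])
          show "bounded_linear (loc (A n))" by (rule bounded_clinearD(1)[OF locA(1)])
          fix y assume y: "y \<in> D0"
          show "(loc (A n) \<circ> ?P (A n)) y = loc (A n) y"
            by (rule dense_cinner_eqI[OF dense]) (use y in \<open>simp add: locA(3) PD[OF As(1)] proj_idem[OF As(1)]\<close>)
        qed
        then show ?thesis by simp
      qed
      interpret orthogonal_operators "\<lambda>n. ?P (A n)" "\<lambda>n. loc (A n)"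
      proof
        show "?P (A m) (?P (A n) x) = 0" if "m \<noteq> n" for m n x
          using A(4) that by (simp add: proj_Int As disjoint_family_on_def proj_empty)
        show "(\<lambda>n. ?P (A n) x) sums x" for x
          using proj_sums[OF A(1,4), of x] by (simp add: A(2) proj_space)
        show "?P (A n) (loc (A n) x) = loc (A n) x" for n x
          using locA(4)[OF As(1)[of n], of n x] lP[of n x] by simp
      qed (use As proj_bounded_clinear proj_symmetric proj_idem locA(1,2) lP in auto)
      have local: "x \<in> sum_dom \<and> Q x x = cinner x (sum_op x)" if x: "x \<in> D0" for x
      proof -
        obtain F where F: "F \<in> sets \<mu>" "emeasure \<mu> F < \<infinity>" "?P F x = x" using supp[OF x] by blast
        \<comment> \<open>Both sides, tested against \<open>D0\<close>, are values of
          \<open>Q\<close> at vectors cut by \<open>A n\<close> and by \<open>F\<close>: on the left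
          \<open>F\<close> comes in through \<open>?P F x = x\<close>, on the right
          \<open>A n\<close> through commutation.\<close>
        have eq: "loc (A n) x = ?P (A n) (loc F x)" for n
        proof (rule dense_cinner_eqI[OF dense])
          fix w assume w: "w \<in> D0"
          note pF = PD[OF F(1)] and pA = PD[OF As(1)]
          have "cinner w (loc (A n) x) = cinner w (?P F (loc (A n) x))"
            using locA(4)[OF F(1), of n x] F(3) by simp
          also have "\<dots> = Q (?P (A n) (?P F w)) (?P (A n) x)"
            using locA(3)[OF pF[OF w] x, of n] by (simp add: proj_symmetric[OF F(1)])
          also have "\<dots> = Q (?P F (?P (A n) w)) (?P F (?P (A n) x))"
            using proj_commute[OF F(1) As(1), of n x] F(3) by (simp add: proj_commute[OF F(1) As(1)])
          also have "\<dots> = cinner (?P (A n) w) (loc F (?P (A n) x))"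
            using loc(3)[OF F(1,2) pA[OF w] pA[OF x]] by simp
          also have "\<dots> = cinner w (?P (A n) (loc F x))"
            by (simp add: proj_symmetric[OF As(1)] loc(4)[OF F(1,2) As(1)] proj_idem[OF As(1)])
          finally show "cinner w (loc (A n) x) = cinner w (?P (A n) (loc F x))" .
        qed
        then have "(\<lambda>n. loc (A n) x) sums loc F x"
          using proj_sums[OF A(1,4), of "loc F x"] by (simp add: A(2) proj_space)
        then have "x \<in> sum_dom" "sum_op x = loc F x" unfolding sum_dom_def sum_op_def by (auto simp: sums_iff)
        then show ?thesis using loc(3)[OF F(1,2) x x] F(3) by simp
      qed
      have "strongly_representable_by sum_dom sum_op Q D0"
        by (rule strongly_representable_sum_op[OF assms(7)]) (use local PD As in auto)
      then show ?thesis by blast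
    qed
    ultimately show ?thesis by blast
  qed
  then show ?thesis by blast
qed

end
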